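(* Assume conditions [A], [B] and [C1] given in the context. Let $m\in\mathfrak M\setminus\{m^*\}$ and suppose that Model $m^*$ is nested in Model $m$. Then, as $n\to\infty$, $$\mathbf P\bigl(\mathrm{QBIC}^{(m^* )}_{1,n}<\mathrm{QBIC}^{(m)}_{1,n}\bigr)\to1,\qquad \mathbf P\bigl(\mathrm{QBIC}^{(m^* )}_{2,n}<\mathrm{QBIC}^{(m)}_{2,n}\bigr)\to1.$$
   Context: **True model.** On a stochastic basis $(\Omega,\mathscr F,\{\mathscr F_t\},\mathbf P)$ satisfying the usual conditions, let $W_{1,t},\dots,W_{4,t}$ be independent standard Wiener processes of dimensions $r_1,\dots,r_4$. Fix $p_1,p_2\ge 1$, $k_1\le p_1$, $k_2\le p_2$ (all independent of $n$), and put $p=p_1+p_2$. Let $$\mathbb X_{1,0,t}=\mathbf\Lambda_{x_1,0}\xi_{0,t}+\delta_{0,t},\quad \mathbb X_{2,0,t}=\mathbf\Lambda_{x_2,0}\eta_{0,t}+\varepsilon_{0,t},\quad \eta_{0,t}=\mathbf B_0\eta_{0,t}+\mathbf\Gamma_0\xi_{0,t}+\zeta_{0,t},$$ where $d\xi_{0,t}=B_1(\xi_{0,t})dt+\mathbf S_{1,0}dW_{1,t}$, $\xi_{0,0}=c_1\in\mathbb R^{k_1}$; $d\delta_{0,t}=B_2(\delta_{0,t})dt+\mathbf S_{2,0}dW_{2,t}$, $\delta_{0,0}=c_2\in\mathbb R^{p_1}$; $d\varepsilon_{0,t}=B_3(\varepsilon_{0,t})dt+\mathbf S_{3,0}dW_{3,t}$,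 $\varepsilon_{0,0}=c_3\in\mathbb R^{p_2}$; $d\zeta_{0,t}=B_4(\zeta_{0,t})dt+\mathbf S_{4,0}dW_{4,t}$, $\zeta_{0,0}=c_4\in\mathbb R^{k_2}$. Here $B_1:\mathbb R^{k_1}\to\mathbb R^{k_1}$, $B_2:\mathbb R^{p_1}\to\mathbb R^{p_1}$, $B_3:\mathbb R^{p_2}\to\mathbb R^{p_2}$, $B_4:\mathbb R^{k_2}\to\mathbb R^{k_2}$; $\mathbf S_{1,0}\in\mathbb R^{k_1\times r_1}$, $\mathbf S_{2,0}\in\mathbb R^{p_1\times r_2}$, $\mathbf S_{3,0}\in\mathbb R^{p_2\times r_3}$, $\mathbf S_{4,0}\in\mathbb R^{k_2\times r_4}$, $\mathbf\Lambda_{x_1,0}\in\mathbb R^{p_1\times k_1}$, $\mathbf\Lambda_{x_2,0}\in\mathbb R^{p_2\times k_2}$, $\mathbf\Gamma_0\in\mathbb R^{k_2\times k_1}$ and $\mathbf B_0\in\mathbb R^{k_2\times k_2}$ (with zero diagonal) are constant matrices. Put $\mathbf\Psi_0=\mathbb I_{k_2}-\mathbf B_0$, $\mathbf\Sigma_{\xi\xi,0}=\mathbf S_{1,0}\mathbf S_{1,0}^\top$, $\mathbf\Sigma_{\delta\delta,0}=\mathbf S_{2,0}\mathbf S_{2,0}^\top$, $\mathbf\Sigma_{\varepsilon\varepsilon,0}=\mathbf S_{3,0}\mathbf S_{3,0}^\top$, $\mathbf\Sigma_{\zeta\zeta,0}=\mathbf S_{4,0}\mathbf S_{4,0}^\top$.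 It is assumed that $\mathbf\Lambda_{x_1,0}$ has full column rank, $\mathbf\Psi_0$ is non-singular, and $\mathbf\Sigma_{\delta\delta,0},\mathbf\Sigma_{\varepsilon\varepsilon,0}$ are positive definite. Define $\mathbf\Sigma_0=\begin{pmatrix}\mathbf\Sigma_0^{11}&\mathbf\Sigma_0^{12}\\ \mathbf\Sigma_0^{12\top}&\mathbf\Sigma_0^{22}\end{pmatrix}$ with $\mathbf\Sigma_0^{11}=\mathbf\Lambda_{x_1,0}\mathbf\Sigma_{\xi\xi,0}\mathbf\Lambda_{x_1,0}^\top+\mathbf\Sigma_{\delta\delta,0}$, $\mathbf\Sigma_0^{12}=\mathbf\Lambda_{x_1,0}\mathbf\Sigma_{\xi\xi,0}\mathbf\Gamma_0^\top(\mathbf\Psi_0^{-1})^\top\mathbf\Lambda_{x_2,0}^\top$, $\mathbf\Sigma_0^{22}=\mathbf\Lambda_{x_2,0}\mathbf\Psi_0^{-1}(\mathbf\Gamma_0\mathbf\Sigma_{\xi\xi,0}\mathbf\Gamma_0^\top+\mathbf\Sigma_{\zeta\zeta,0})(\mathbf\Psi_0^{-1})^\top\mathbf\Lambda_{x_2,0}^\top+\mathbf\Sigma_{\varepsilon\varepsilon,0}$. **Observations.** $\mathbb X_t=(\mathbb X_{1,0,t}^\top,\mathbb X_{2,0,t}^\top)^\top$ is observed at $t_i^n=ih_n$, $i=0,\dots,n$, with $h_n=T/n$ and $T>0$ fixed; $\Delta_i\mathbb X=\mathbb X_{t_i^n}-\mathbb X_{t_{i-1}^n}$. **Parametric models.**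 For $m=1,\dots,M$, Model $m$ has parameter $\theta_m\in\Theta_m$, where $\Theta_m\subset\mathbb R^{q_m}$ is convex and compact with locally Lipschitz boundary. It has the same structure, dimensions, drifts $B_i$, Wiener processes $W_{i}$ and initial values $c_i$ as the true model, with the constant matrices replaced by $\theta_m$-dependent matrices $\mathbf\Lambda^\theta_{x_1,m},\mathbf\Lambda^\theta_{x_2,m},\mathbf B^\theta_m$ (zero diagonal), $\mathbf\Gamma^\theta_m,\mathbf S^\theta_{1,m},\dots,\mathbf S^\theta_{4,m}$ of the same sizes. Put $\mathbf\Psi^\theta_m=\mathbb I_{k_2}-\mathbf B^\theta_m$, $\mathbf\Sigma^\theta_{\xi\xi,m}=\mathbf S^\theta_{1,m}\mathbf S^{\theta\top}_{1,m}$, $\mathbf\Sigma^\theta_{\delta\delta,m}=\mathbf S^\theta_{2,m}\mathbf S^{\theta\top}_{2,m}$, $\mathbf\Sigma^\theta_{\varepsilon\varepsilon,m}=\mathbf S^\theta_{3,m}\mathbf S^{\theta\top}_{3,m}$, $\mathbf\Sigma^\theta_{\zeta\zeta,m}=\mathbf S^\theta_{4,m}\mathbf S^{\theta\top}_{4,m}$. It is assumed that $\mathbf\Lambda^\theta_{x_1,m}$ has full column rank, $\mathbf\Psi^\theta_m$ is non-singular, and $\mathbf\Sigma^\theta_{\delta\delta,m},\mathbf\Sigma^\theta_{\varepsilon\varepsilon,m}$ are positive definite. $\mathbf\Sigma_m(\theta_m)$ is defined by the same formula as $\mathbf\Sigma_0$ with these matrices. **Notation.** $A[B]=\mathrm{tr}(AB^\top)$;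 $A^{\otimes2}=AA^\top$; $|A|=\sqrt{\mathrm{tr}(AA^\top)}$; $A>0$ means positive definite; $\mathrm{vech}$ is half-vectorization; $\partial^2_{\theta_m}=\partial_{\theta_m}\partial_{\theta_m}^\top$ is the Hessian. $C^k_\uparrow(\mathbb R^d)$ is the space of functions that are continuously differentiable up to order $k$ and which, together with all these derivatives, are of polynomial growth. **Quasi-likelihood.** $$\mathbb L_{m,n}(\theta_m)=\prod_{i=1}^n\frac{1}{(2\pi h_n)^{p/2}\det\mathbf\Sigma_m(\theta_m)^{1/2}}\exp\Bigl(-\frac{1}{2h_n}\mathbf\Sigma_m(\theta_m)^{-1}\bigl[(\Delta_i\mathbb X)^{\otimes2}\bigr]\Bigr),\qquad \mathbb H_{m,n}(\theta_m)=\log\bigl\{(2\pi h_n)^{np/2}\mathbb L_{m,n}(\theta_m)\bigr\}.$$ The quasi-maximum likelihood estimator $\hat\theta_{m,n}$ satisfies $\mathbb L_{m,n}(\hat\theta_{m,n})=\sup_{\theta_m\in\Theta_m}\mathbb L_{m,n}(\theta_m)$. $\pi_{m,n}$ is the prior density of $\theta_m$ on $\Theta_m$. **Information criteria.** Let $J_{m,n}=\{-n^{-1}\partial^2_{\theta_m}\mathbb H_{m,n}(\hat\theta_{m,n})>0\}$, and let $\tilde{\mathbf\Gamma}_{m,n}(\hat\theta_{m,n})$ equal $-n^{-1}\partial^2_{\theta_m}\mathbb H_{m,n}(\hat\theta_{m,n})$ on $J_{m,n}$ and $\mathbb I_{q_m}$ on $J_{m,n}^c$. Set $$\mathrm{QBIC}^{(m)}_{1,n}=-2\mathbb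 H_{m,n}(\hat\theta_{m,n})+\log\det\bigl\{n\tilde{\mathbf\Gamma}_{m,n}(\hat\theta_{m,n})\bigr\},\qquad \mathrm{QBIC}^{(m)}_{2,n}=-2\mathbb H_{m,n}(\hat\theta_{m,n})+q_m\log n.$$ **Correct specification, optimal model, nesting.** The competing models may include some, but not all, misspecified models. $\mathfrak M$ is the set of correctly specified models, i.e. of $m\in\{1,\dots,M\}$ for which there is $\theta_{m,0}\in\Theta_m$ with $\mathbf\Sigma_0=\mathbf\Sigma_m(\theta_{m,0})$; for $m\in\mathfrak M$ it is assumed that $\theta_{m,0}\in\mathrm{Int}(\Theta_m)$. The optimal model $m^*$ is given by $\{m^*\}=\mathrm{argmin}_{m\in\mathfrak M}\dim(\Theta_m)$, where $\dim(\Theta_m)=q_m$, and is assumed to be unique. Model $i$ is nested in Model $j$ when $q_i<q_j$ and there exist a matrix $F\in\mathbb R^{q_j\times q_i}$ with $F^\top F=\mathbb I_{q_i}$ and a constant $c\in\mathbb R^{q_j}$ such that $\mathbb H_{i,n}(\theta_i)=\mathbb H_{j,n}(F\theta_i+c)$ for all $\theta_i\in\Theta_i$. **[A]** For each pair $(B,Z)\in\{(B_1,\xi_0),(B_2,\delta_0),(B_3,\varepsilon_0),(B_4,\zeta_0)\}$: (i) $B$ is globally Lipschitz; (ii) $\sup_t\mathbf E[|Z_t|^\ell]<\infty$ for all $\ell>0$; (iii) $B\in C^4_\uparrow$. **[B]** For $m\in\mathfrak M$, with $\mathbb U_{m,n}(\theta_{m,0})=\{u_m\in\mathbb R^{q_m}:\theta_{m,0}+n^{-1/2}u_m\in\Theta_m\}$: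 (a) $\inf_{n}\pi_{m,n}(\theta_{m,0})>0$ and $\sup_{\theta_m\in\Theta_m}\sup_n\pi_{m,n}(\theta_m)<\infty$; (b) for each $L>0$, $\sup_{u_m\in\{|u_m|<L\}\cap\mathbb U_{m,n}(\theta_{m,0})}|\pi_{m,n}(\theta_{m,0}+n^{-1/2}u_m)-\pi_{m,n}(\theta_{m,0})|\to0$ as $n\to\infty$. **[C1]** For $m\in\mathfrak M$, let $$\mathbb Y_m(\theta_m)=-\tfrac12\bigl(\mathbf\Sigma_m(\theta_m)^{-1}-\mathbf\Sigma_m(\theta_{m,0})^{-1}\bigr)\bigl[\mathbf\Sigma_m(\theta_{m,0})\bigr]-\tfrac12\log\frac{\det\mathbf\Sigma_m(\theta_m)}{\det\mathbf\Sigma_m(\theta_{m,0})},\qquad \Delta_{m,0}=\frac{\partial}{\partial\theta_m^\top}\mathrm{vech}\,\mathbf\Sigma_m(\theta_m)\Big|_{\theta_m=\theta_{m,0}}.$$ (a) There is $\chi>0$ with $\mathbb Y_m(\theta_m)\le-\chi|\theta_m-\theta_{m,0}|^2$ for all $\theta_m\in\Theta_m$; (b) $\mathrm{rank}\,\Delta_{m,0}=q_m$. *)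

theory Defs
  imports
    "HOL-Probability.Probability"
    "Jordan_Normal_Form.Determinant"
    "Jordan_Normal_Form.DL_Rank"
begin

text \<open>
  Two encodings of finite-dimensional spaces are used. The dimensions of the state and observation
  processes are fixed, hence they are index types (\<open>real ^ 'n\<close>). The parameter dimension depends
  on the model, hence parameters are functions \<open>nat \<Rightarrow> real\<close> in the carrier of
  \<open>Euclidean_space q\<close>, i.e. vanishing from index \<open>q\<close> on; matrices whose size depends on the
  model are those of \<open>Jordan_Normal_Form\<close>.
\<close>

no_notation vec_index (infixl \<open>$\<close> 100)

hide_const (open) Matrix.mat Determinant.det Matrix.vec
hide_type (open) Matrix.vec


section \<open>Stochastic basis, Wiener processes, diffusions with constant diffusion coefficient\<close>

definition stochastic_basis :: "'w measure \<Rightarrow> (real \<Rightarrow> 'w measure) \<Rightarrow> bool" where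
  "stochastic_basis P F \<longleftrightarrow> prob_space P \<and>
     (\<forall>t\<ge>0. subalgebra P (F t)) \<and>
     (\<forall>s t. 0 \<le> s \<and> s \<le> t \<longrightarrow> sets (F s) \<subseteq> sets (F t)) \<and>
     (\<forall>N\<in>null_sets P. \<forall>A\<subseteq>N. A \<in> sets (F 0)) \<and>
     (\<forall>t\<ge>0. sets (F t) = (\<Inter>s\<in>{t<..}. sets (F s)))"

text \<open>In the last clause below, the product of one-dimensional densities makes the components of the
  increment independent and normally distributed with variance \<open>t - s\<close>.\<close>

definition wiener_process ::
  "'w measure \<Rightarrow> (real \<Rightarrow> 'w measure) \<Rightarrow> (real \<Rightarrow> 'w \<Rightarrow> real ^ 'r::finite) \<Rightarrow> bool" where
  "wiener_process P F W \<longleftrightarrow>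
     (\<forall>t\<ge>0. W t \<in> borel_measurable (F t)) \<and>
     (AE \<omega> in P. W 0 \<omega> = 0) \<and>
     (AE \<omega> in P. continuous_on {0..} (\<lambda>t. W t \<omega>)) \<and>
     (\<forall>s t. 0 \<le> s \<and> s < t \<longrightarrow>
        prob_space.indep_set P (sets (F s))
          (sets (vimage_algebra (space P) (\<lambda>\<omega>. W t \<omega> - W s \<omega>) borel)) \<and>
        distributed P lborel (\<lambda>\<omega>. W t \<omega> - W s \<omega>)
          (\<lambda>x. ennreal (\<Prod>i\<in>UNIV. normal_density 0 (sqrt (t - s)) (x $ i))))"

definition process_events ::
  "'w measure \<Rightarrow> (real \<Rightarrow> 'w \<Rightarrow> real ^ 'r::finite) \<Rightarrow> 'w set set" where
  "process_events P W =
     sigma_sets (space P) {W t -` A \<inter> space P | t A. 0 \<le> t \<and> A \<in> sets borel}"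

text \<open>\<open>dZ = B(Z) dt + S dW\<close>, \<open>Z\<^sub>0 = c\<close>. As \<open>S\<close> is a constant matrix and \<open>W\<^sub>0 = 0\<close>, the stochastic integral
  \<open>\<integral>\<^sub>0\<^sup>t S dW\<close> is \<open>S W\<^sub>t\<close>.\<close>

definition diffusion_solution ::
  "'w measure \<Rightarrow> (real \<Rightarrow> 'w measure) \<Rightarrow> (real \<Rightarrow> 'w \<Rightarrow> real ^ 'r::finite) \<Rightarrow>
   (real ^ 'k \<Rightarrow> real ^ 'k) \<Rightarrow> real ^ 'r ^ 'k::finite \<Rightarrow> real ^ 'k \<Rightarrow>
   (real \<Rightarrow> 'w \<Rightarrow> real ^ 'k) \<Rightarrow> bool" where
  "diffusion_solution P F W B S c Z \<longleftrightarrow>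
     (\<forall>t\<ge>0. Z t \<in> borel_measurable (F t)) \<and>
     (AE \<omega> in P. continuous_on {0..} (\<lambda>t. Z t \<omega>)) \<and>
     (AE \<omega> in P. \<forall>t\<ge>0. ((\<lambda>s. B (Z s \<omega>)) has_integral (Z t \<omega> - c - S *v W t \<omega>)) {0..t})"

definition poly_growth :: "('a::real_normed_vector \<Rightarrow> 'b::real_normed_vector) \<Rightarrow> bool" where
  "poly_growth f \<longleftrightarrow> (\<exists>C N. \<forall>x. norm (f x) \<le> C * (1 + norm x) ^ N)"

text \<open>\<open>C\<^sup>k\<close> with polynomial growth of the function and all its partial derivatives up to order \<open>k\<close>.\<close>

primrec C_poly_growth ::
  "nat \<Rightarrow> ('a::euclidean_space \<Rightarrow> 'b::real_normed_vector) \<Rightarrow> bool" where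
  "C_poly_growth 0 f \<longleftrightarrow> continuous_on UNIV f \<and> poly_growth f"
| "C_poly_growth (Suc k) f \<longleftrightarrow> continuous_on UNIV f \<and> poly_growth f \<and>
     (\<forall>x. f differentiable (at x)) \<and>
     (\<forall>b\<in>Basis. C_poly_growth k (\<lambda>x. frechet_derivative f (at x) b))"

definition condition_A ::
  "'w measure \<Rightarrow> real \<Rightarrow> (real ^ 'k::finite \<Rightarrow> real ^ 'k) \<Rightarrow> (real \<Rightarrow> 'w \<Rightarrow> real ^ 'k) \<Rightarrow> bool" where
  "condition_A P T B Z \<longleftrightarrow>
     (\<exists>L. L-lipschitz_on UNIV B) \<and>
     (\<forall>l>0. (SUP t\<in>{0..T}. \<integral>\<^sup>+ \<omega>. ennreal (norm (Z t \<omega>) powr l) \<partial>P) < \<infinity>) \<and>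
     C_poly_growth 4 B"


section \<open>Structural equation models\<close>

record ('k1, 'k2, 'p1, 'p2, 'r1, 'r2, 'r3, 'r4) sem =
  Lambda1 :: "real ^ 'k1::finite ^ 'p1::finite"
  Lambda2 :: "real ^ 'k2::finite ^ 'p2::finite"
  Bmat :: "real ^ 'k2::finite ^ 'k2::finite"
  Gam :: "real ^ 'k1::finite ^ 'k2::finite"
  S1 :: "real ^ 'r1::finite ^ 'k1::finite"
  S2 :: "real ^ 'r2::finite ^ 'p1::finite"
  S3 :: "real ^ 'r3::finite ^ 'p2::finite"
  S4 :: "real ^ 'r4::finite ^ 'k2::finite"

definition gram :: "real ^ 'n::finite ^ 'm::finite \<Rightarrow> real ^ 'm ^ 'm" where
  "gram A = A ** transpose A"

text \<open>Only applied to symmetric matrices.\<close>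

definition pos_def :: "real ^ 'n::finite ^ 'n \<Rightarrow> bool" where
  "pos_def A \<longleftrightarrow> (\<forall>x. x \<noteq> 0 \<longrightarrow> 0 < x \<bullet> (A *v x))"

definition Psi ::
  "('k1::finite, 'k2::finite, 'p1::finite, 'p2::finite, 'r1::finite, 'r2::finite, 'r3::finite, 'r4::finite) sem
   \<Rightarrow> real ^ 'k2 ^ 'k2" where
  "Psi s = mat 1 - Bmat s"

definition regular_sem ::
  "('k1::finite, 'k2::finite, 'p1::finite, 'p2::finite, 'r1::finite, 'r2::finite, 'r3::finite, 'r4::finite) sem
   \<Rightarrow> bool" where
  "regular_sem s \<longleftrightarrow>
     (\<forall>i. Bmat s $ i $ i = 0) \<and>
     rank (Lambda1 s) = CARD('k1) \<and>
     invertible (Psi s) \<and>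
     pos_def (gram (S2 s)) \<and> pos_def (gram (S3 s))"

definition Sigma11 ::
  "('k1::finite, 'k2::finite, 'p1::finite, 'p2::finite, 'r1::finite, 'r2::finite, 'r3::finite, 'r4::finite) sem
   \<Rightarrow> real ^ 'p1 ^ 'p1" where
  "Sigma11 s = Lambda1 s ** gram (S1 s) ** transpose (Lambda1 s) + gram (S2 s)"

definition Sigma12 ::
  "('k1::finite, 'k2::finite, 'p1::finite, 'p2::finite, 'r1::finite, 'r2::finite, 'r3::finite, 'r4::finite) sem
   \<Rightarrow> real ^ 'p2 ^ 'p1" where
  "Sigma12 s = Lambda1 s ** gram (S1 s) ** transpose (Gam s) **
     transpose (matrix_inv (Psi s)) ** transpose (Lambda2 s)"

definition Sigma22 ::
  "('k1::finite, 'k2::finite, 'p1::finite, 'p2::finite, 'r1::finite, 'r2::finite, 'r3::finite, 'r4::finite) sem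
   \<Rightarrow> real ^ 'p2 ^ 'p2" where
  "Sigma22 s = Lambda2 s ** matrix_inv (Psi s) **
     (Gam s ** gram (S1 s) ** transpose (Gam s) + gram (S4 s)) **
     transpose (matrix_inv (Psi s)) ** transpose (Lambda2 s) + gram (S3 s)"

definition sem_Sigma ::
  "('k1::finite, 'k2::finite, 'p1::finite, 'p2::finite, 'r1::finite, 'r2::finite, 'r3::finite, 'r4::finite) sem
   \<Rightarrow> real ^ ('p1 + 'p2) ^ ('p1 + 'p2)" where
  "sem_Sigma s = (\<chi> a b. case a of
       Inl i \<Rightarrow> (case b of Inl j \<Rightarrow> Sigma11 s $ i $ j | Inr j \<Rightarrow> Sigma12 s $ i $ j)
     | Inr i \<Rightarrow> (case b of Inl j \<Rightarrow> transpose (Sigma12 s) $ i $ j | Inr j \<Rightarrow> Sigma22 s $ i $ j))"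

definition stack :: "real ^ 'p1::finite \<Rightarrow> real ^ 'p2::finite \<Rightarrow> real ^ ('p1 + 'p2)" where
  "stack x y = (\<chi> a. case a of Inl i \<Rightarrow> x $ i | Inr j \<Rightarrow> y $ j)"


section \<open>The parameter spaces\<close>

abbreviation Rn :: "nat \<Rightarrow> (nat \<Rightarrow> real) set" where
  "Rn q \<equiv> topspace (Euclidean_space q)"

definition dot :: "nat \<Rightarrow> (nat \<Rightarrow> real) \<Rightarrow> (nat \<Rightarrow> real) \<Rightarrow> real" where
  "dot q x y = (\<Sum>i<q. x i * y i)"

definition nrm :: "nat \<Rightarrow> (nat \<Rightarrow> real) \<Rightarrow> real" where
  "nrm q x = sqrt (dot q x x)"

definition convex_Rn :: "(nat \<Rightarrow> real) set \<Rightarrow> bool" where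
  "convex_Rn A \<longleftrightarrow> (\<forall>x\<in>A. \<forall>y\<in>A. \<forall>a\<in>{0..1}. (\<lambda>i. (1 - a) * x i + a * y i) \<in> A)"

text \<open>Near each boundary point the set is, in a rotated orthonormal frame with last axis \<open>e\<close>, the
  epigraph of a Lipschitz function \<open>g\<close> on the hyperplane orthogonal to \<open>e\<close>.\<close>

definition lipschitz_boundary :: "nat \<Rightarrow> (nat \<Rightarrow> real) set \<Rightarrow> bool" where
  "lipschitz_boundary q A \<longleftrightarrow>
     (\<forall>x \<in> Euclidean_space q frontier_of A. \<exists>e\<in>Rn q. \<exists>r>0. \<exists>g L.
        nrm q e = 1 \<and>
        (\<forall>y\<in>Rn q. \<forall>z\<in>Rn q. dot q y e = 0 \<and> dot q z e = 0 \<longrightarrow>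
           \<bar>g y - g z\<bar> \<le> L * nrm q (\<lambda>i. y i - z i)) \<and>
        (\<forall>y\<in>Rn q. nrm q (\<lambda>i. y i - x i) < r \<longrightarrow>
           (y \<in> A \<longleftrightarrow> g (\<lambda>i. y i - dot q y e * e i) \<le> dot q y e)))"

definition parameter_space :: "nat \<Rightarrow> (nat \<Rightarrow> real) set \<Rightarrow> bool" where
  "parameter_space q A \<longleftrightarrow>
     convex_Rn A \<and> compactin (Euclidean_space q) A \<and> lipschitz_boundary q A"

definition partial :: "nat \<Rightarrow> ((nat \<Rightarrow> real) \<Rightarrow> real) \<Rightarrow> (nat \<Rightarrow> real) \<Rightarrow> real" where
  "partial i f x = deriv (\<lambda>s. f (x(i := s))) (x i)"

primrec C_on :: "nat \<Rightarrow> nat \<Rightarrow> (nat \<Rightarrow> real) set \<Rightarrow> ((nat \<Rightarrow> real) \<Rightarrow> real) \<Rightarrow> bool" where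
  "C_on 0 q U f \<longleftrightarrow> continuous_map (subtopology (Euclidean_space q) U) euclideanreal f"
| "C_on (Suc k) q U f \<longleftrightarrow>
     continuous_map (subtopology (Euclidean_space q) U) euclideanreal f \<and>
     (\<forall>i<q. (\<forall>x\<in>U. (\<lambda>s. f (x(i := s))) field_differentiable at (x i)) \<and>
            C_on k q U (partial i f))"

text \<open>Twice continuous differentiability up to the boundary, as a \<open>C\<^sup>2\<close> function on an open
  neighbourhood. It gives meaning to the Hessian of the quasi-log-likelihood at estimators lying on
  the boundary of the parameter space.\<close>

definition C2_near :: "nat \<Rightarrow> (nat \<Rightarrow> real) set \<Rightarrow> ((nat \<Rightarrow> real) \<Rightarrow> real ^ 'n::finite ^ 'n) \<Rightarrow> bool" where
  "C2_near q A S \<longleftrightarrow>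
     (\<exists>U. openin (Euclidean_space q) U \<and> A \<subseteq> U \<and> (\<forall>a b. C_on 2 q U (\<lambda>x. S x $ a $ b)))"

definition hessian :: "nat \<Rightarrow> ((nat \<Rightarrow> real) \<Rightarrow> real) \<Rightarrow> (nat \<Rightarrow> real) \<Rightarrow> real Matrix.mat" where
  "hessian q f x = Matrix.mat q q (\<lambda>(i, j). partial i (partial j f) x)"

text \<open>Only applied to Hessians of \<open>C\<^sup>2\<close> functions, which are symmetric.\<close>

definition pos_def_mat :: "nat \<Rightarrow> real Matrix.mat \<Rightarrow> bool" where
  "pos_def_mat q A \<longleftrightarrow> (\<forall>v\<in>carrier_vec q. v \<noteq> 0\<^sub>v q \<longrightarrow> 0 < v \<bullet> (A *\<^sub>v v))"


section \<open>Quasi-likelihood and information criteria\<close>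

definition mat_dot :: "real ^ 'n::finite ^ 'n \<Rightarrow> real ^ 'n ^ 'n \<Rightarrow> real" where
  "mat_dot A B = trace (A ** transpose B)"

definition outer :: "real ^ 'n::finite \<Rightarrow> real ^ 'n ^ 'n" where
  "outer v = (\<chi> a b. v $ a * v $ b)"

definition increment :: "real \<Rightarrow> nat \<Rightarrow> (real \<Rightarrow> 'w \<Rightarrow> real ^ 'n::finite) \<Rightarrow> 'w \<Rightarrow> nat \<Rightarrow> real ^ 'n" where
  "increment T n X \<omega> i = X (real i * (T / real n)) \<omega> - X ((real i - 1) * (T / real n)) \<omega>"

definition quasi_lik ::
  "real \<Rightarrow> (real \<Rightarrow> 'w \<Rightarrow> real ^ 'n::finite) \<Rightarrow> ((nat \<Rightarrow> real) \<Rightarrow> real ^ 'n ^ 'n) \<Rightarrow>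
   nat \<Rightarrow> 'w \<Rightarrow> (nat \<Rightarrow> real) \<Rightarrow> real" where
  "quasi_lik T X S n \<omega> \<theta> =
     (\<Prod>i=1..n. 1 / ((2 * pi * (T / real n)) powr (real CARD('n) / 2) * det (S \<theta>) powr (1 / 2)) *
        exp (- (1 / (2 * (T / real n))) *
          mat_dot (matrix_inv (S \<theta>)) (outer (increment T n X \<omega> i))))"

definition quasi_loglik ::
  "real \<Rightarrow> (real \<Rightarrow> 'w \<Rightarrow> real ^ 'n::finite) \<Rightarrow> ((nat \<Rightarrow> real) \<Rightarrow> real ^ 'n ^ 'n) \<Rightarrow>
   nat \<Rightarrow> 'w \<Rightarrow> (nat \<Rightarrow> real) \<Rightarrow> real" where
  "quasi_loglik T X S n \<omega> \<theta> =
     ln ((2 * pi * (T / real n)) powr (real n * real CARD('n) / 2) * quasi_lik T X S n \<omega> \<theta>)"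

definition qmle ::
  "'w measure \<Rightarrow> real \<Rightarrow> (real \<Rightarrow> 'w \<Rightarrow> real ^ 'n::finite) \<Rightarrow> nat \<Rightarrow> (nat \<Rightarrow> real) set \<Rightarrow>
   ((nat \<Rightarrow> real) \<Rightarrow> real ^ 'n ^ 'n) \<Rightarrow> nat \<Rightarrow> ('w \<Rightarrow> nat \<Rightarrow> real) \<Rightarrow> bool" where
  "qmle P T X q A S n est \<longleftrightarrow>
     (\<forall>i<q. (\<lambda>\<omega>. est \<omega> i) \<in> borel_measurable P) \<and>
     (\<forall>\<omega>\<in>space P. est \<omega> \<in> A \<and>
        quasi_lik T X S n \<omega> (est \<omega>) = (SUP \<theta>\<in>A. quasi_lik T X S n \<omega> \<theta>))"

definition obs_information ::
  "real \<Rightarrow> (real \<Rightarrow> 'w \<Rightarrow> real ^ 'n::finite) \<Rightarrow> nat \<Rightarrow> ((nat \<Rightarrow> real) \<Rightarrow> real ^ 'n ^ 'n) \<Rightarrow>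
   nat \<Rightarrow> 'w \<Rightarrow> (nat \<Rightarrow> real) \<Rightarrow> real Matrix.mat" where
  "obs_information T X q S n \<omega> \<theta> =
     (let I = (- (1 / real n)) \<cdot>\<^sub>m hessian q (quasi_loglik T X S n \<omega>) \<theta>
      in if pos_def_mat q I then I else 1\<^sub>m q)"

definition QBIC1 ::
  "real \<Rightarrow> (real \<Rightarrow> 'w \<Rightarrow> real ^ 'n::finite) \<Rightarrow> nat \<Rightarrow> ((nat \<Rightarrow> real) \<Rightarrow> real ^ 'n ^ 'n) \<Rightarrow>
   ('w \<Rightarrow> nat \<Rightarrow> real) \<Rightarrow> nat \<Rightarrow> 'w \<Rightarrow> real" where
  "QBIC1 T X q S est n \<omega> =
     - 2 * quasi_loglik T X S n \<omega> (est \<omega>) +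
     ln (Determinant.det (real n \<cdot>\<^sub>m obs_information T X q S n \<omega> (est \<omega>)))"

definition QBIC2 ::
  "real \<Rightarrow> (real \<Rightarrow> 'w \<Rightarrow> real ^ 'n::finite) \<Rightarrow> nat \<Rightarrow> ((nat \<Rightarrow> real) \<Rightarrow> real ^ 'n ^ 'n) \<Rightarrow>
   ('w \<Rightarrow> nat \<Rightarrow> real) \<Rightarrow> nat \<Rightarrow> 'w \<Rightarrow> real" where
  "QBIC2 T X q S est n \<omega> =
     - 2 * quasi_loglik T X S n \<omega> (est \<omega>) + real q * ln (real n)"


section \<open>Correct specification, nesting, conditions on the models\<close>

definition correct_models ::
  "nat \<Rightarrow> (nat \<Rightarrow> (nat \<Rightarrow> real) set) \<Rightarrow> (nat \<Rightarrow> (nat \<Rightarrow> real) \<Rightarrow> real ^ 'n::finite ^ 'n) \<Rightarrow>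
   real ^ 'n ^ 'n \<Rightarrow> nat set" where
  "correct_models M \<Theta> S S0 = {m \<in> {1..M}. \<exists>\<theta>\<in>\<Theta> m. S0 = S m \<theta>}"

definition affine_Rn :: "real Matrix.mat \<Rightarrow> (nat \<Rightarrow> real) \<Rightarrow> (nat \<Rightarrow> real) \<Rightarrow> nat \<Rightarrow> real" where
  "affine_Rn F c \<theta> a =
     (if a < dim_row F then (\<Sum>b<dim_col F. F $$ (a, b) * \<theta> b) + c a else 0)"

definition nested ::
  "'w set \<Rightarrow> real \<Rightarrow> (real \<Rightarrow> 'w \<Rightarrow> real ^ 'n::finite) \<Rightarrow> (nat \<Rightarrow> nat) \<Rightarrow>
   (nat \<Rightarrow> (nat \<Rightarrow> real) set) \<Rightarrow> (nat \<Rightarrow> (nat \<Rightarrow> real) \<Rightarrow> real ^ 'n ^ 'n) \<Rightarrow>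
   nat \<Rightarrow> nat \<Rightarrow> bool" where
  "nested \<Omega> T X q \<Theta> S i j \<longleftrightarrow> q i < q j \<and>
     (\<exists>F \<in> carrier_mat (q j) (q i). \<exists>c \<in> Rn (q j).
        transpose_mat F * F = 1\<^sub>m (q i) \<and>
        (\<forall>\<theta>\<in>\<Theta> i. affine_Rn F c \<theta> \<in> \<Theta> j \<and>
           (\<forall>n\<ge>1. \<forall>\<omega>\<in>\<Omega>. quasi_loglik T X (S i) n \<omega> \<theta> =
                            quasi_loglik T X (S j) n \<omega> (affine_Rn F c \<theta>))))"

text \<open>\<open>\<Pi>\<^sub>M i\<in>{..<q}. lborel\<close> is Lebesgue measure on extensional functions; its points are made to
  vanish outside \<open>{..<q}\<close> before they are used as parameters.\<close>

definition prior_density :: "nat \<Rightarrow> (nat \<Rightarrow> real) set \<Rightarrow> ((nat \<Rightarrow> real) \<Rightarrow> real) \<Rightarrow> bool" where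
  "prior_density q A f \<longleftrightarrow> (\<forall>\<theta>\<in>A. 0 \<le> f \<theta>) \<and>
     has_bochner_integral (\<Pi>\<^sub>M i\<in>{..<q}. lborel)
       (\<lambda>x. let \<theta> = (\<lambda>i. if i < q then x i else 0) in indicator A \<theta> * f \<theta>) 1"

definition condition_B ::
  "nat \<Rightarrow> (nat \<Rightarrow> real) set \<Rightarrow> (nat \<Rightarrow> (nat \<Rightarrow> real) \<Rightarrow> real) \<Rightarrow> (nat \<Rightarrow> real) \<Rightarrow> bool" where
  "condition_B q A \<pi> \<theta>0 \<longleftrightarrow>
     0 < (INF n\<in>{1..}. \<pi> n \<theta>0) \<and>
     bdd_above ((\<lambda>(n, \<theta>). \<pi> n \<theta>) ` ({1..} \<times> A)) \<and>
     (\<forall>L>0. (\<lambda>n. SUP u\<in>{u \<in> Rn q. nrm q u < L \<and> (\<lambda>i. \<theta>0 i + u i / sqrt (real n)) \<in> A}.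
          \<bar>\<pi> n (\<lambda>i. \<theta>0 i + u i / sqrt (real n)) - \<pi> n \<theta>0\<bar>) \<longlonglongrightarrow> 0)"

definition Y_limit ::
  "((nat \<Rightarrow> real) \<Rightarrow> real ^ 'n::finite ^ 'n) \<Rightarrow> (nat \<Rightarrow> real) \<Rightarrow> (nat \<Rightarrow> real) \<Rightarrow> real" where
  "Y_limit S \<theta>0 \<theta> =
     - (1 / 2) * mat_dot (matrix_inv (S \<theta>) - matrix_inv (S \<theta>0)) (S \<theta>0)
     - (1 / 2) * ln (det (S \<theta>) / det (S \<theta>0))"

text \<open>Lower triangular part, column by column. On \<open>'p1 + 'p2\<close> the enumeration lists the left
  summand first, in accordance with the block structure above.\<close>

definition vech :: "real ^ 'n::enum ^ 'n::enum \<Rightarrow> real list" where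
  "vech A = concat (map (\<lambda>b. map (\<lambda>a. A $ (Enum.enum ! a) $ (Enum.enum ! b)) [b..<CARD('n)])
     [0..<CARD('n)])"

definition Delta_matrix ::
  "nat \<Rightarrow> ((nat \<Rightarrow> real) \<Rightarrow> real ^ 'n::enum ^ 'n::enum) \<Rightarrow> (nat \<Rightarrow> real) \<Rightarrow> real Matrix.mat" where
  "Delta_matrix q S \<theta> =
     Matrix.mat (CARD('n) * (CARD('n) + 1) div 2) q
       (\<lambda>(r, j). partial j (\<lambda>x. vech (S x) ! r) \<theta>)"

definition condition_C1 ::
  "nat \<Rightarrow> (nat \<Rightarrow> real) set \<Rightarrow> ((nat \<Rightarrow> real) \<Rightarrow> real ^ 'n::enum ^ 'n::enum) \<Rightarrow> (nat \<Rightarrow> real) \<Rightarrow> bool" where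
  "condition_C1 q A S \<theta>0 \<longleftrightarrow>
     (\<exists>\<kappa>>0. \<forall>\<theta>\<in>A. Y_limit S \<theta>0 \<theta> \<le> - \<kappa> * (nrm q (\<lambda>i. \<theta> i - \<theta>0 i))\<^sup>2) \<and>
     vec_space.rank (CARD('n) * (CARD('n) + 1) div 2) (Delta_matrix q S \<theta>0) = q"

end

theory Submission
  imports Defs "HOL-Real_Asymp.Real_Asymp"
begin

text \<open>
  The quasi-log-likelihood is \<open>- n * cost S Q\<^sub>n \<theta>\<close>, a smooth function of \<open>\<theta>\<close> and, linearly, of the
  realized covariance \<open>Q\<^sub>n\<close>. An increment of \<open>X\<close> is a fixed linear image of Wiener increments plus a
  drift term of order \<open>1 / n\<close>, so orthogonality of the products of Wiener increments and
  Cauchy-Schwarz give \<open>Q\<^sub>n - \<Sigma>\<^sub>0 = o(sqrt (ln n / n))\<close> in probability. The identifiability condition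
  makes the limit cost grow quadratically around \<open>\<theta>\<^sub>0\<close>; hence the estimator of a correctly specified
  model is consistent and its log-likelihood exceeds that at \<open>\<theta>\<^sub>0\<close> by only \<open>o(ln n)\<close>, while the
  observed information converges to a positive definite matrix. Correctly specified models have the
  same likelihood at their true parameters, so the difference of the penalties, at
  least \<open>ln n\<close>, decides.
\<close>

section \<open>Functions of class \<open>C\<^sup>k\<close> on open subsets of \<open>Rn q\<close>\<close>

text \<open>No central limit theorem and no tightness enter; two devices replace them. First, the
  cost is affine in \<open>Q\<close> with coefficients that are \<open>C\<^sup>2\<close> in
  \<open>\<theta>\<close>. The data thus enter through finitely many scalars: uniformity over the
  compact parameter space reduces to a Lipschitz bound for the coefficients, and convergence at the
  random estimator to their continuity at \<open>\<theta>0\<close>. Second, the statements that hold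
  on events of probability tending to 1 form a filter \<open>whp\<close> on pairs
  \<open>(n, \<omega>)\<close>, so that convergence in probability obeys the ordinary rules for
  limits. The noise is negligible in mean square, with explicit constants; the drift is negligible
  path by path, with a random constant. The comparison of the models is one-sided: an upper bound
  for the gain over the true parameter is required for the larger model alone, because the estimator
  of the smaller one does at least as well as its true parameter.\<close>

lemma openin_Euclidean_iff:
  "openin (Euclidean_space q) U \<longleftrightarrow> (\<exists>V. open V \<and> U = Rn q \<inter> V)"
  by (auto simp: Euclidean_space_def openin_subtopology euclidean_product_topology)

lemma Euclidean_subtopology:
  assumes "U \<subseteq> Rn q"
  shows "subtopology (Euclidean_space q) U = top_of_set U"
  using assms
  by (simp add: Euclidean_space_def euclidean_product_topology subtopology_subtopology
      topspace_Euclidean_space inf_absorb2)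

lemma continuous_map_Euclidean_iff:
  assumes "U \<subseteq> Rn q"
  shows "continuous_map (subtopology (Euclidean_space q) U) euclideanreal f \<longleftrightarrow> continuous_on U f"
  using assms by (simp add: Euclidean_subtopology)

lemma openin_Euclidean_subset: "openin (Euclidean_space q) U \<Longrightarrow> U \<subseteq> Rn q"
  by (rule openin_subset)

text \<open>Points of \<open>Rn q\<close> agree beyond the first \<open>q\<close> coordinates, so
  only finitely many radii count and a common one exists. Boxes serve as neighbourhoods because they
  are adapted to moves of a single coordinate.\<close>

lemma openin_Euclidean_box:
  assumes U: "openin (Euclidean_space q) U" and x: "x \<in> U"
  shows "\<exists>r>0. \<forall>y\<in>Rn q. (\<forall>i<q. \<bar>y i - x i\<bar> < r) \<longrightarrow> y \<in> U"
proof -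
  obtain O' where O: "open O'" "U = Rn q \<inter> O'"
    using U by (auto simp: openin_Euclidean_iff)
  have "openin (powertop_real UNIV) O'" "x \<in> O'"
    using O x by (auto simp: euclidean_product_topology open_openin[symmetric])
  then obtain X where X: "x \<in> (\<Pi>\<^sub>E i\<in>UNIV. X i)" "\<And>i. open (X i)" "(\<Pi>\<^sub>E i\<in>UNIV. X i) \<subseteq> O'"
    using product_topology_open_contains_basis[where T = "\<lambda>_. euclideanreal" and I = UNIV and U = O']
    by (metis open_openin)
  have "\<exists>r>0. \<forall>y. \<bar>y - x i\<bar> < r \<longrightarrow> y \<in> X i" for i
    using X(1) X(2)[of i] by (auto simp: open_dist dist_real_def PiE_iff)
  then obtain r where r: "\<And>i. 0 < r i" "\<And>i y. \<bar>y - x i\<bar> < r i \<Longrightarrow> y \<in> X i" by metis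
  \<comment> \<open>Inserting 1 keeps the minimum over a nonempty set when
    \<open>q = 0\<close>.\<close>
  define R where "R = Min (insert 1 (r ` {..<q}))"
  have "0 < R" using r(1) by (auto simp: R_def)
  moreover have Rr: "R \<le> r i" if "i < q" for i
    using that by (auto simp: R_def intro!: Min_le)
  moreover have "x \<in> Rn q" using x O by auto
  ultimately have "y \<in> U" if "y \<in> Rn q" "\<forall>i<q. \<bar>y i - x i\<bar> < R" for y
  proof -
    have "y i \<in> X i" for i
    proof (cases "i < q")
      case True then show ?thesis using that Rr[OF True] r(2) by force
    next
      case False
      then have "y i = x i" using that \<open>x \<in> Rn q\<close> by (auto simp: topspace_Euclidean_space)
      then show ?thesis using r by simp
    qed
    then show ?thesis using X(3) that O by auto
  qed
  then show ?thesis using \<open>0 < R\<close> by blast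
qed

lemma continuous_on_openin_box:
  fixes f :: "(nat \<Rightarrow> real) \<Rightarrow> real"
  assumes U: "openin (Euclidean_space q) U" and f: "continuous_on U f" and x: "x \<in> U" and e: "0 < e"
  shows "\<exists>r>0. \<forall>y\<in>Rn q. (\<forall>i<q. \<bar>y i - x i\<bar> < r) \<longrightarrow> y \<in> U \<and> \<bar>f y - f x\<bar> < e"
proof -
  have "openin (top_of_set U) (U \<inter> f -` ball (f x) e)"
    using f by (simp add: continuous_on_open_invariant continuous_openin_preimage_gen)
  then have "openin (Euclidean_space q) (U \<inter> f -` ball (f x) e)"
    using U openin_trans_full Euclidean_subtopology[OF openin_Euclidean_subset[OF U]] by metis
  from openin_Euclidean_box[OF this, of x] x e show ?thesis
    by (auto simp: dist_real_def abs_minus_commute)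
qed

lemma fun_upd_Rn: "x \<in> Rn q \<Longrightarrow> i < q \<Longrightarrow> x(i := s) \<in> Rn q"
  by (auto simp: topspace_Euclidean_space)

lemma openin_fun_upd:
  assumes U: "openin (Euclidean_space q) U" and x: "x \<in> U" and i: "i < q"
  shows "\<forall>\<^sub>F s in nhds (x i). x(i := s) \<in> U"
proof -
  obtain r where r: "r > 0" "\<And>y. y\<in>Rn q \<Longrightarrow> (\<forall>i<q. \<bar>y i - x i\<bar> < r) \<Longrightarrow> y \<in> U"
    using openin_Euclidean_box[OF U x] by auto
  have "x \<in> Rn q" using U x openin_Euclidean_subset by blast
  then show ?thesis unfolding eventually_nhds_metric using r i
    by (intro exI[of _ r] conjI allI impI r(2)) (auto simp: dist_real_def fun_upd_Rn)
qed

lemma partial_cong: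
  assumes U: "openin (Euclidean_space q) U" and x: "x \<in> U" and i: "i < q"
    and fg: "\<And>y. y \<in> U \<Longrightarrow> f y = g y"
  shows "partial i f x = partial i g x"
  unfolding partial_def
  by (rule deriv_cong_ev) (use openin_fun_upd[OF U x i] fg in \<open>auto elim: eventually_mono\<close>)

lemma partial_DERIV:
  assumes "(\<lambda>s. f (x(i := s))) field_differentiable at (x i)"
  shows "((\<lambda>s. f (x(i := s))) has_real_derivative partial i f x) (at (x i))"
  unfolding partial_def using assms field_differentiable_derivI by blast

lemma partialI:
  "((\<lambda>s. f (x(i := s))) has_real_derivative D) (at (x i)) \<Longrightarrow> partial i f x = D"
  unfolding partial_def by (rule DERIV_imp_deriv)

lemma C_on_continuous:
  "C_on k q U f \<Longrightarrow> U \<subseteq> Rn q \<Longrightarrow> continuous_on U f"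
  by (cases k) (simp_all add: continuous_map_Euclidean_iff)

lemma C_on_lower: "C_on (Suc k) q U f \<Longrightarrow> C_on k q U f"
  by (induction k arbitrary: f) auto

lemma C_on_Suc_partial: "C_on (Suc k) q U f \<Longrightarrow> i < q \<Longrightarrow> C_on k q U (partial i f)"
  by simp

lemma C_on_Suc_DERIV:
  "C_on (Suc k) q U f \<Longrightarrow> i < q \<Longrightarrow> x \<in> U \<Longrightarrow>
    ((\<lambda>s. f (x(i := s))) has_real_derivative partial i f x) (at (x i))"
  by (rule partial_DERIV) simp

lemma C_on_SucI:
  assumes "continuous_on U f" "U \<subseteq> Rn q"
    "\<And>i x. i < q \<Longrightarrow> x \<in> U \<Longrightarrow> ((\<lambda>s. f (x(i := s))) has_real_derivative partial i f x) (at (x i))"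
    "\<And>i. i < q \<Longrightarrow> C_on k q U (partial i f)"
  shows "C_on (Suc k) q U f"
  using assms by (auto simp: continuous_map_Euclidean_iff field_differentiable_def)

lemma C_on_subset: "C_on k q U f \<Longrightarrow> V \<subseteq> U \<Longrightarrow> U \<subseteq> Rn q \<Longrightarrow> C_on k q V f"
  by (induction k arbitrary: f)
    (auto simp: continuous_map_Euclidean_iff dest: continuous_on_subset)

text \<open>Openness makes this work: a small change of one coordinate stays in \<open>U\<close>, so
  agreement on \<open>U\<close> passes to the partial derivatives.\<close>

lemma C_on_cong:
  assumes U: "openin (Euclidean_space q) U"
  shows "C_on k q U f \<Longrightarrow> (\<And>y. y \<in> U \<Longrightarrow> f y = g y) \<Longrightarrow> C_on k q U g"
proof (induction k arbitrary: f g)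
  case 0
  then show ?case
    using openin_Euclidean_subset[OF U]
    by (auto simp: continuous_map_Euclidean_iff cong: continuous_on_cong)
next
  case (Suc k)
  note sub = openin_Euclidean_subset[OF U]
  have p: "partial i f x = partial i g x" if "i < q" "x \<in> U" for i x
    using partial_cong[OF U that(2,1)] Suc.prems by blast
  show ?case
  proof (rule C_on_SucI[OF _ sub])
    show "continuous_on U g"
      using C_on_continuous[OF Suc.prems(1) sub] Suc.prems(2) by (auto cong: continuous_on_cong)
    show "C_on k q U (partial i g)" if "i < q" for i
      using Suc.IH[OF C_on_Suc_partial[OF Suc.prems(1) that]] p that by blast
    show "((\<lambda>s. g (x(i := s))) has_real_derivative partial i g x) (at (x i))"
      if "i < q" "x \<in> U" for i x
      using has_field_derivative_transform_within_open
        C_on_Suc_DERIV[OF Suc.prems(1) that] openin_fun_upd[OF U that(2,1)] Suc.prems(2)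
      unfolding p[OF that, symmetric]
      by (smt (verit) DERIV_cong_ev eventually_mono)
  qed
qed

section \<open>Closure properties of the classes \<open>C_on k q U\<close>\<close>

lemma C_on_const: "U \<subseteq> Rn q \<Longrightarrow> C_on k q U (\<lambda>_. c)"
proof (induction k arbitrary: c)
  case (Suc k)
  have "partial i (\<lambda>_. c) = (\<lambda>_. 0)" for i by (auto simp: partial_def)
  then show ?case using Suc by (simp add: continuous_map_Euclidean_iff)
qed (simp add: continuous_map_Euclidean_iff)

text \<open>A derivative formula \<open>D\<close> agrees with \<open>partial\<close> on
  \<open>U\<close> only, where differentiability is known; \<open>C_on_cong\<close> transfers its
  regularity. The closure rules below feed in the usual formulas of calculus.\<close>

lemma C_on_DERIV_I:
  assumes U: "openin (Euclidean_space q) U"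
    and c: "continuous_on U f"
    and D: "\<And>i x. i < q \<Longrightarrow> x \<in> U \<Longrightarrow> ((\<lambda>s. f (x(i := s))) has_real_derivative D i x) (at (x i))"
    and "\<And>i. i < q \<Longrightarrow> C_on k q U (D i)"
  shows "C_on (Suc k) q U f"
proof (rule C_on_SucI[OF c openin_Euclidean_subset[OF U]])
  show "((\<lambda>s. f (x(i := s))) has_real_derivative partial i f x) (at (x i))" if "i < q" "x \<in> U" for i x
    using D[OF that] partialI[OF D[OF that]] by simp
  show "C_on k q U (partial i f)" if "i < q" for i
    by (rule C_on_cong[OF U assms(4)[OF that]]) (simp add: partialI[OF D[OF that]])
qed

lemma C_on_add:
  assumes U: "openin (Euclidean_space q) U"
  shows "C_on k q U f \<Longrightarrow> C_on k q U g \<Longrightarrow> C_on k q U (\<lambda>x. f x + g x)"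
proof (induction k arbitrary: f g)
  case 0
  then show ?case using openin_Euclidean_subset[OF U]
    by (auto simp: continuous_map_Euclidean_iff intro!: continuous_intros)
next
  case (Suc k)
  note c = C_on_continuous[OF _ openin_Euclidean_subset[OF U]]
  show ?case
  proof (rule C_on_DERIV_I[OF U, where D = "\<lambda>i x. partial i f x + partial i g x"])
    show "continuous_on U (\<lambda>x. f x + g x)"
      by (intro continuous_intros c[OF Suc.prems(1)] c[OF Suc.prems(2)])
    show "((\<lambda>s. f (x(i := s)) + g (x(i := s))) has_real_derivative
        partial i f x + partial i g x) (at (x i))" if "i < q" "x \<in> U" for i x
      by (rule DERIV_add[OF C_on_Suc_DERIV[OF Suc.prems(1) that] C_on_Suc_DERIV[OF Suc.prems(2) that]])
    show "C_on k q U (\<lambda>x. partial i f x + partial i g x)" if "i < q" for i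
      using Suc that by (intro Suc.IH) (auto dest: C_on_Suc_partial simp del: C_on.simps)
  qed
qed

lemma C_on_mult:
  assumes U: "openin (Euclidean_space q) U"
  shows "C_on k q U f \<Longrightarrow> C_on k q U g \<Longrightarrow> C_on k q U (\<lambda>x. f x * g x)"
proof (induction k arbitrary: f g)
  case 0
  then show ?case using openin_Euclidean_subset[OF U]
    by (auto simp: continuous_map_Euclidean_iff intro!: continuous_intros)
next
  case (Suc k)
  note c = C_on_continuous[OF _ openin_Euclidean_subset[OF U]]
  show ?case
  proof (rule C_on_DERIV_I[OF U, where D = "\<lambda>i x. f x * partial i g x + partial i f x * g x"])
    show "continuous_on U (\<lambda>x. f x * g x)"
      by (intro continuous_intros c[OF Suc.prems(1)] c[OF Suc.prems(2)])
    show "((\<lambda>s. f (x(i := s)) * g (x(i := s))) has_real_derivative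
        f x * partial i g x + partial i f x * g x) (at (x i))" if "i < q" "x \<in> U" for i x
      using DERIV_mult'[OF C_on_Suc_DERIV[OF Suc.prems(1) that] C_on_Suc_DERIV[OF Suc.prems(2) that]]
      by (simp del: fun_upd_apply)
    show "C_on k q U (\<lambda>x. f x * partial i g x + partial i f x * g x)" if "i < q" for i
      using Suc that by (intro C_on_add[OF U] Suc.IH) (auto intro: C_on_lower dest: C_on_Suc_partial simp del: C_on.simps)
  qed
qed

lemma C_on_cmult: "openin (Euclidean_space q) U \<Longrightarrow> C_on k q U f \<Longrightarrow> C_on k q U (\<lambda>x. c * f x)"
  by (intro C_on_mult C_on_const openin_Euclidean_subset)

lemma C_on_sum:
  assumes U: "openin (Euclidean_space q) U" and "\<And>a. a \<in> I \<Longrightarrow> C_on k q U (f a)"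
  shows "C_on k q U (\<lambda>x. \<Sum>a\<in>I. f a x)"
  using assms(2) by (induction I rule: infinite_finite_induct)
    (auto intro!: C_on_add[OF U] C_on_const openin_Euclidean_subset[OF U] simp del: C_on.simps)

lemma C_on_prod:
  assumes U: "openin (Euclidean_space q) U" and "\<And>a. a \<in> I \<Longrightarrow> C_on k q U (f a)"
  shows "C_on k q U (\<lambda>x. \<Prod>a\<in>I. f a x)"
  using assms(2) by (induction I rule: infinite_finite_induct)
    (auto intro!: C_on_mult[OF U] C_on_const openin_Euclidean_subset[OF U] simp del: C_on.simps)

lemma C_on_inverse:
  assumes U: "openin (Euclidean_space q) U" and nz: "\<And>x. x \<in> U \<Longrightarrow> f x \<noteq> 0"
  shows "C_on k q U f \<Longrightarrow> C_on k q U (\<lambda>x. inverse (f x))"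
proof (induction k)
  case 0
  then show ?case using openin_Euclidean_subset[OF U] nz
    by (auto simp: continuous_map_Euclidean_iff intro!: continuous_intros)
next
  case (Suc k)
  note c = C_on_continuous[OF Suc.prems openin_Euclidean_subset[OF U]]
  show ?case
  proof (rule C_on_DERIV_I[OF U, where D = "\<lambda>i x. - 1 * (inverse (f x) * partial i f x * inverse (f x))"])
    show "continuous_on U (\<lambda>x. inverse (f x))" using c nz by (auto intro!: continuous_intros)
    show "((\<lambda>s. inverse (f (x(i := s)))) has_real_derivative
        - 1 * (inverse (f x) * partial i f x * inverse (f x))) (at (x i))" if "i < q" "x \<in> U" for i x
      using DERIV_inverse'[OF C_on_Suc_DERIV[OF Suc.prems that]] nz[OF that(2)]
      by (simp del: fun_upd_apply)
    show "C_on k q U (\<lambda>x. - 1 * (inverse (f x) * partial i f x * inverse (f x)))" if "i < q" for i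
      using Suc that by (intro C_on_cmult[OF U] C_on_mult[OF U]) (auto intro: C_on_lower simp del: C_on.simps dest: C_on_Suc_partial)
  qed
qed

lemma C_on_ln:
  assumes U: "openin (Euclidean_space q) U" and pos: "\<And>x. x \<in> U \<Longrightarrow> (0::real) < f x"
    and f: "C_on k q U f"
  shows "C_on k q U (\<lambda>x. ln (f x))"
proof (cases k)
  case 0
  then show ?thesis using f openin_Euclidean_subset[OF U] pos
    by (force simp: continuous_map_Euclidean_iff intro!: continuous_intros)
next
  case (Suc l)
  note f = f[unfolded Suc]
  note c = C_on_continuous[OF f openin_Euclidean_subset[OF U]]
  show ?thesis unfolding Suc
  proof (rule C_on_DERIV_I[OF U, where D = "\<lambda>i x. inverse (f x) * partial i f x"])
    show "continuous_on U (\<lambda>x. ln (f x))" using c pos by (force intro!: continuous_intros)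
    show "((\<lambda>s. ln (f (x(i := s)))) has_real_derivative inverse (f x) * partial i f x) (at (x i))"
      if "i < q" "x \<in> U" for i x
      using DERIV_chain2[OF DERIV_ln C_on_Suc_DERIV[OF f that]] pos that by simp
    show "C_on l q U (\<lambda>x. inverse (f x) * partial i f x)" if "i < q" for i
      using f that pos by (intro C_on_mult[OF U] C_on_inverse[OF U])
        (auto intro: C_on_lower simp del: C_on.simps dest: C_on_Suc_partial pos)
  qed
qed


text \<open>Strict differentiability at \<open>x0\<close>, with both endpoints free. The path from
  \<open>x\<close> to \<open>y\<close> changes one coordinate at a time and stays in a box where all
  partial derivatives are within \<open>e\<close> of their values at \<open>x0\<close>; the mean
  value inequality is applied on each leg.\<close>

lemma C_on_difference:
  assumes U: "openin (Euclidean_space q) U" and f: "C_on (Suc k) q U f"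
    and x0: "x0 \<in> U" and e: "0 < e"
  shows "\<exists>r>0. \<forall>x\<in>Rn q. \<forall>y\<in>Rn q. (\<forall>i<q. \<bar>x i - x0 i\<bar> < r \<and> \<bar>y i - x0 i\<bar> < r) \<longrightarrow>
    \<bar>f y - f x - (\<Sum>i<q. (y i - x i) * partial i f x0)\<bar> \<le> e * (\<Sum>i<q. \<bar>y i - x i\<bar>)"
proof -
  have "\<exists>r>0. \<forall>y\<in>Rn q. (\<forall>j<q. \<bar>y j - x0 j\<bar> < r) \<longrightarrow> y \<in> U \<and> \<bar>partial i f y - partial i f x0\<bar> < e"
    if "i < q" for i
    using continuous_on_openin_box[OF U C_on_continuous[OF C_on_Suc_partial[OF f that]
      openin_Euclidean_subset[OF U]] x0 e] .
  then obtain r where r: "\<And>i. i < q \<Longrightarrow> 0 < r i"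
      "\<And>i y. i < q \<Longrightarrow> y \<in> Rn q \<Longrightarrow> (\<And>j. j < q \<Longrightarrow> \<bar>y j - x0 j\<bar> < r i) \<Longrightarrow>
        y \<in> U \<and> \<bar>partial i f y - partial i f x0\<bar> < e" by metis
  define R where "R = Min (insert 1 (r ` {..<q}))"
  have R: "0 < R" "\<And>i. i < q \<Longrightarrow> R \<le> r i"
    using r(1) by (auto simp: R_def intro!: Min_le)
  have "\<bar>f y - f x - (\<Sum>i<q. (y i - x i) * partial i f x0)\<bar> \<le> e * (\<Sum>i<q. \<bar>y i - x i\<bar>)"
    if x: "x \<in> Rn q" and y: "y \<in> Rn q"
      and box: "\<And>i. i < q \<Longrightarrow> \<bar>x i - x0 i\<bar> < R \<and> \<bar>y i - x0 i\<bar> < R" for x y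
  proof -
    \<comment> \<open>\<open>z k\<close> has its first \<open>k\<close> coordinates already moved to
      those of \<open>y\<close>; it runs from \<open>x\<close> at \<open>k = 0\<close> to
      \<open>y\<close> at \<open>k = q\<close>.\<close>
    define z where "z k i = (if i < k then y i else x i)" for k i :: nat
    have step: "\<bar>f (z (Suc k)) - f (z k) - (y k - x k) * partial k f x0\<bar> \<le> e * \<bar>y k - x k\<bar>"
      if k: "k < q" for k
    proof -
      let ?S = "closed_segment (x k) (y k)"
      let ?h = "\<lambda>s. f ((z k)(k := s)) - s * partial k f x0"
      have z: "(z k)(k := s) \<in> U \<and> \<bar>partial k f ((z k)(k := s)) - partial k f x0\<bar> < e" if "s \<in> ?S" for s
      proof (rule r(2)[OF k])
        show "(z k)(k := s) \<in> Rn q"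
          using x y k by (auto simp: z_def topspace_Euclidean_space)
        have "?S \<subseteq> ball (x0 k) R"
          by (rule closed_segment_subset) (use box[OF k] in \<open>auto simp: dist_real_def\<close>)
        then have "\<bar>s - x0 k\<bar> < R" using that by (auto simp: dist_real_def subset_iff abs_minus_commute)
        then show "\<bar>((z k)(k := s)) j - x0 j\<bar> < r k" if "j < q" for j
          using R(2)[OF k] box[OF that] by (auto simp: z_def)
      qed
      have "norm (?h (y k) - ?h (x k)) \<le> e * norm (y k - x k)"
      proof (rule field_differentiable_bound[where S = ?S and f = ?h])
        fix s assume s: "s \<in> ?S"
        show "norm (partial k f ((z k)(k := s)) - partial k f x0) \<le> e" using z[OF s] by simp
        have "((\<lambda>s'. f ((z k)(k := s, k := s'))) has_real_derivative partial k f ((z k)(k := s)))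
          (at (((z k)(k := s)) k))"
          using C_on_Suc_DERIV[OF f k] z[OF s] by blast
        then have "((\<lambda>s'. f ((z k)(k := s'))) has_real_derivative partial k f ((z k)(k := s))) (at s)"
          by (simp only: fun_upd_upd fun_upd_same)
        then have "(?h has_real_derivative (partial k f ((z k)(k := s)) - partial k f x0)) (at s)"
          by (auto intro!: derivative_eq_intros simp del: fun_upd_apply)
        then show "(?h has_real_derivative (partial k f ((z k)(k := s)) - partial k f x0)) (at s within ?S)"
          by (rule has_field_derivative_at_within)
      qed auto
      moreover have "(z k)(k := y k) = z (Suc k)" "(z k)(k := x k) = z k"
        by (auto simp: z_def fun_eq_iff)
      ultimately show ?thesis by (simp add: algebra_simps del: fun_upd_apply)
    qed
    have "z q = y" "z 0 = x"
      using x y by (auto simp: z_def fun_eq_iff topspace_Euclidean_space)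
    then have "f y - f x = (\<Sum>k<q. f (z (Suc k)) - f (z k))"
      using sum_lessThan_telescope[of "\<lambda>k. f (z k)" q] by simp
    then have "\<bar>f y - f x - (\<Sum>i<q. (y i - x i) * partial i f x0)\<bar> =
      \<bar>\<Sum>k<q. f (z (Suc k)) - f (z k) - (y k - x k) * partial k f x0\<bar>"
      by (simp add: sum_subtractf)
    also have "\<dots> \<le> (\<Sum>k<q. e * \<bar>y k - x k\<bar>)"
      by (rule order_trans[OF sum_abs sum_mono]) (use step in auto)
    finally show ?thesis by (simp add: sum_distrib_left)
  qed
  then show ?thesis using R(1) by (intro exI[of _ R]) auto
qed

section \<open>Derivatives along straight lines\<close>

lemma line_Rn: "x \<in> Rn q \<Longrightarrow> v \<in> Rn q \<Longrightarrow> (\<lambda>i. x i + t * v i) \<in> Rn q"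
  by (auto simp: topspace_Euclidean_space)

lemma C_on_line_DERIV:
  assumes U: "openin (Euclidean_space q) U" and f: "C_on (Suc k) q U f"
    and x: "x \<in> Rn q" and v: "v \<in> Rn q" and t: "(\<lambda>i. x i + t * v i) \<in> U"
  shows "((\<lambda>t. f (\<lambda>i. x i + t * v i)) has_real_derivative
    (\<Sum>i<q. v i * partial i f (\<lambda>i. x i + t * v i))) (at t)"
  unfolding has_field_derivative_def has_derivative_at_alt
proof (intro conjI allI impI)
  fix e :: real assume e: "0 < e"
  let ?p = "\<lambda>t i. x i + t * v i"
  \<comment> \<open>The error is measured by the sum of all \<open>\<bar>v i\<bar>\<close>, hence
    the precision \<open>e / V\<close>; the 1 keeps \<open>V\<close> positive when \<open>v\<close>
    vanishes.\<close>
  define V where "V = (\<Sum>i<q. \<bar>v i\<bar>) + 1"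
  have V: "0 < V" "\<And>i. i < q \<Longrightarrow> \<bar>v i\<bar> < V"
    unfolding V_def by (auto intro!: add_nonneg_pos sum_nonneg)
      (meson finite_lessThan lessThan_iff member_le_sum abs_ge_zero less_add_one le_less_trans)
  obtain r where r: "0 < r" "\<And>y z. y \<in> Rn q \<Longrightarrow> z \<in> Rn q \<Longrightarrow>
      (\<forall>i<q. \<bar>y i - ?p t i\<bar> < r \<and> \<bar>z i - ?p t i\<bar> < r) \<Longrightarrow>
    \<bar>f z - f y - (\<Sum>i<q. (z i - y i) * partial i f (?p t))\<bar> \<le> e / V * (\<Sum>i<q. \<bar>z i - y i\<bar>)"
    using C_on_difference[OF U f t, of "e / V"] e V by auto
  have "norm (f (?p s) - f (?p t) - (\<Sum>i<q. v i * partial i f (?p t)) * (s - t)) \<le> e * norm (s - t)"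
    if s: "norm (s - t) < r / V" for s
  proof -
    have d: "?p s i - ?p t i = (s - t) * v i" for i by (simp add: algebra_simps)
    have "\<bar>s - t\<bar> * \<bar>v i\<bar> < r" if "i < q" for i
    proof -
      have "\<bar>s - t\<bar> * \<bar>v i\<bar> \<le> \<bar>s - t\<bar> * V" using V(2)[OF that] by (intro mult_left_mono) auto
      also have "\<dots> < r" using s V(1) by (simp add: field_simps)
      finally show ?thesis .
    qed
    then have "\<bar>f (?p s) - f (?p t) - (\<Sum>i<q. (?p s i - ?p t i) * partial i f (?p t))\<bar>
        \<le> e / V * (\<Sum>i<q. \<bar>?p s i - ?p t i\<bar>)"
      using r(1) by (intro r(2) line_Rn x v) (simp_all only: d abs_mult, simp_all)
    also have "(\<Sum>i<q. (?p s i - ?p t i) * partial i f (?p t)) = (\<Sum>i<q. v i * partial i f (?p t)) * (s - t)"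
      unfolding d by (simp add: sum_distrib_right sum_distrib_left mult_ac)
    also have "e / V * (\<Sum>i<q. \<bar>?p s i - ?p t i\<bar>) = (\<bar>s - t\<bar> * e) * ((\<Sum>i<q. \<bar>v i\<bar>) / V)"
      unfolding d by (simp add: abs_mult sum_distrib_left sum_divide_distrib mult_ac)
    also have "\<dots> \<le> (\<bar>s - t\<bar> * e) * 1"
      using e V(1) by (intro mult_left_mono) (auto simp: V_def)
    finally show ?thesis by (simp add: mult_ac)
  qed
  then show "\<exists>d>0. \<forall>s. norm (s - t) < d \<longrightarrow>
      norm (f (?p s) - f (?p t) - (\<Sum>i<q. v i * partial i f (?p t)) * (s - t)) \<le> e * norm (s - t)"
    using r(1) V(1) by (intro exI[of _ "r / V"]) auto
qed (rule bounded_linear_mult_right)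

lemma nrm_squared: "(nrm q x)\<^sup>2 = dot q x x"
  unfolding nrm_def dot_def by (rule real_sqrt_pow2) (simp add: sum_nonneg)

lemma nrm_nonneg: "0 \<le> nrm q x"
  unfolding nrm_def dot_def by (simp add: sum_nonneg)

lemma abs_le_nrm: "i < q \<Longrightarrow> \<bar>x i\<bar> \<le> nrm q x"
  unfolding nrm_def dot_def
  by (rule real_le_rsqrt) (auto simp: power2_eq_square intro: member_le_sum[of i "{..<q}" "\<lambda>i. x i * x i"])

text \<open>Along the line through \<open>x\<close> in direction \<open>v\<close>, subtracting
  \<open>c * N * t^2\<close> with \<open>N = dot q v v\<close> still leaves a local minimum at 0.
  The second derivative there is nonnegative, which bounds the Hessian form below by
  \<open>2 * c * N\<close>.\<close>

lemma C_on_quadratic_minimum: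
  assumes U: "openin (Euclidean_space q) U" and f: "C_on (Suc (Suc 0)) q U f" and x: "x \<in> U"
    and c: "0 < c" and min: "\<And>y. y \<in> U \<Longrightarrow> f x + c * (nrm q (\<lambda>i. y i - x i))\<^sup>2 \<le> f y"
    and v: "v \<in> Rn q" "v \<noteq> (\<lambda>_. 0)"
  shows "0 < (\<Sum>i<q. \<Sum>j<q. v i * v j * partial i (partial j f) x)"
proof -
  let ?p = "\<lambda>t i. x i + t * v i"
  have xR: "x \<in> Rn q" using U x openin_Euclidean_subset by blast
  obtain i0 where i0: "i0 < q" "v i0 \<noteq> 0"
    using v by (auto simp: topspace_Euclidean_space fun_eq_iff) (meson not_le)
  define N where "N = dot q v v"
  have N: "0 < N"
    unfolding N_def dot_def by (rule sum_pos2[of _ i0]) (use i0 in \<open>auto simp: zero_less_mult_iff\<close>)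
  define V where "V = nrm q v + 1"
  have V: "0 < V" "\<And>i. i < q \<Longrightarrow> \<bar>v i\<bar> < V"
    using nrm_nonneg[of q v] abs_le_nrm[of _ q v] by (force simp: V_def)+
  obtain r where r: "0 < r" "\<And>y. y\<in>Rn q \<Longrightarrow> (\<forall>i<q. \<bar>y i - x i\<bar> < r) \<Longrightarrow> y \<in> U"
    using openin_Euclidean_box[OF U x] by auto
  have inU: "?p t \<in> U" if "\<bar>t\<bar> < r / V" for t
  proof (intro r(2) line_Rn xR v allI impI)
    fix i assume "i < q"
    have "\<bar>t\<bar> * \<bar>v i\<bar> \<le> \<bar>t\<bar> * V" using V(2)[OF \<open>i < q\<close>] by (intro mult_left_mono) auto
    also have "\<dots> < r" using that V(1) by (simp add: field_simps)
    finally show "\<bar>?p t i - x i\<bar> < r" by (simp add: abs_mult)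
  qed
  define \<phi> where "\<phi> t = f (?p t) - c * N * t\<^sup>2" for t
  define \<phi>' where "\<phi>' t = (\<Sum>j<q. v j * partial j f (?p t)) - 2 * c * N * t" for t
  have D1: "(\<phi> has_real_derivative \<phi>' t) (at t)" if "\<bar>t\<bar> < r / V" for t
    unfolding \<phi>_def \<phi>'_def
    by (rule derivative_eq_intros C_on_line_DERIV[OF U f xR v(1) inU[OF that]] refl | simp)+
  let ?H = "\<Sum>j<q. v j * (\<Sum>i<q. v i * partial i (partial j f) (?p 0))"
  have rV: "0 < r / V" using r V by simp
  have D2: "(\<phi>' has_real_derivative ?H - 2 * c * N) (at 0)"
    unfolding \<phi>'_def using rV
    by (auto intro!: derivative_eq_intros DERIV_sum C_on_line_DERIV[OF U C_on_Suc_partial[OF f] xR v(1) inU]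
      simp: mult.commute simp del: C_on.simps)
  have ge: "\<phi> 0 \<le> \<phi> t" if "\<bar>t\<bar> < r / V" for t
  proof -
    have "(nrm q (\<lambda>i. ?p t i - x i))\<^sup>2 = t\<^sup>2 * N"
      unfolding nrm_squared dot_def N_def sum_distrib_left
      by (simp add: power2_eq_square mult_ac)
    then show ?thesis using min[OF inU[OF that]] by (simp add: \<phi>_def mult_ac)
  qed
  have D0: "\<phi>' 0 = 0"
    by (rule DERIV_local_min[OF D1 rV]) (use rV ge in auto)
  \<comment> \<open>As \<open>\<phi>' 0 = 0\<close>, a negative derivative of \<open>\<phi>'\<close>
    at 0 would make \<open>\<phi>'\<close> negative just to the right of 0, and
    \<open>\<phi>\<close> would drop below \<open>\<phi> 0\<close>.\<close>
  have "2 * c * N \<le> ?H"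
  proof (rule ccontr)
    assume "\<not> 2 * c * N \<le> ?H"
    then have "?H - 2 * c * N < 0" by simp
    from DERIV_neg_dec_right[OF D2 this] obtain d where d: "0 < d" "\<And>h. 0 < h \<Longrightarrow> h < d \<Longrightarrow> \<phi>' h < 0"
      by (auto simp: D0)
    obtain t where t: "0 < t" "t < d" "t < r / V"
      using dense[of 0 "min d (r / V)"] d(1) rV by auto
    then obtain z where "0 < z" "z < t" "\<phi> t - \<phi> 0 = (t - 0) * \<phi>' z"
      using MVT2[of 0 t \<phi> \<phi>'] D1 by auto
    with t d(2)[of z] have "\<phi> t - \<phi> 0 < 0" by (simp add: mult_pos_neg)
    then show False using ge[of t] t by auto
  qed
  moreover have "0 < 2 * c * N" using c N by simp
  moreover have "?H = (\<Sum>i<q. \<Sum>j<q. v i * v j * partial i (partial j f) x)"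
    unfolding sum_distrib_left by (subst sum.swap) (simp add: mult_ac)
  ultimately show ?thesis by linarith
qed

text \<open>Convexity keeps the segment inside \<open>A\<close>, and compactness bounds the partial
  derivatives on it.\<close>

lemma C_on_lipschitz:
  assumes U: "openin (Euclidean_space q) U" and f: "C_on (Suc k) q U f"
    and A: "compact A" "convex_Rn A" "A \<subseteq> U"
  shows "\<exists>K\<ge>0. \<forall>x\<in>A. \<forall>y\<in>A. \<bar>f y - f x\<bar> \<le> K * nrm q (\<lambda>i. y i - x i)"
proof -
  note sub = openin_Euclidean_subset[OF U]
  have "\<exists>B. \<forall>x\<in>A. \<bar>partial i f x\<bar> \<le> B" if "i < q" for i
  proof -
    have "continuous_on A (partial i f)"
      using C_on_continuous[OF C_on_Suc_partial[OF f that] sub] A(3) continuous_on_subset by blast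
    then have "bounded (partial i f ` A)" using A(1) compact_continuous_image compact_imp_bounded by blast
    then show ?thesis by (auto simp: bounded_iff)
  qed
  then obtain B where B: "\<And>i x. i < q \<Longrightarrow> x \<in> A \<Longrightarrow> \<bar>partial i f x\<bar> \<le> B i" by metis
  define K where "K = (\<Sum>i<q. \<bar>B i\<bar>)"
  have "\<bar>f y - f x\<bar> \<le> K * nrm q (\<lambda>i. y i - x i)" if x: "x \<in> A" and y: "y \<in> A" for x y
  proof -
    define v where "v i = y i - x i" for i
    let ?p = "\<lambda>t i. x i + t * v i"
    have xR: "x \<in> Rn q" using x A(3) sub by blast
    moreover have "y \<in> Rn q" using y A(3) sub by blast
    ultimately have vR: "v \<in> Rn q" by (auto simp: v_def topspace_Euclidean_space)
    have inA: "?p t \<in> A" if "t \<in> {0..1}" for t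
    proof -
      have "?p t = (\<lambda>i. (1 - t) * x i + t * y i)" by (auto simp: v_def algebra_simps)
      then show ?thesis using A(2) x y that by (auto simp: convex_Rn_def)
    qed
    have "norm (f (?p 1) - f (?p 0)) \<le> (K * nrm q v) * norm (1 - 0 :: real)"
    proof (rule field_differentiable_bound[where S = "{0..1}" and f = "\<lambda>t. f (?p t)"])
      fix t :: real assume t: "t \<in> {0..1}"
      show "((\<lambda>t. f (?p t)) has_real_derivative (\<Sum>i<q. v i * partial i f (?p t))) (at t within {0..1})"
        by (rule has_field_derivative_at_within[OF C_on_line_DERIV[OF U f xR vR]]) (use inA[OF t] A in auto)
      have "norm (\<Sum>i<q. v i * partial i f (?p t)) \<le> (\<Sum>i<q. \<bar>B i\<bar> * nrm q v)"
      proof (rule order_trans[OF norm_sum sum_mono])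
        fix i assume "i \<in> {..<q}"
        then have "i < q" by simp
        have "\<bar>v i\<bar> * \<bar>partial i f (?p t)\<bar> \<le> nrm q v * \<bar>B i\<bar>"
          using abs_le_nrm[OF \<open>i < q\<close>] B[OF \<open>i < q\<close> inA[OF t]] nrm_nonneg
          by (intro mult_mono) (auto intro: order_trans)
        then show "norm (v i * partial i f (?p t)) \<le> \<bar>B i\<bar> * nrm q v" by (simp add: abs_mult mult_ac)
      qed
      then show "norm (\<Sum>i<q. v i * partial i f (?p t)) \<le> K * nrm q v"
        by (simp add: K_def sum_distrib_right)
    qed auto
    then show ?thesis by (simp add: v_def[abs_def])
  qed
  moreover have "0 \<le> K" by (simp add: K_def sum_nonneg)
  ultimately show ?thesis by blast
qed

section \<open>Positive definite matrices\<close>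

lemma continuous_on_det:
  fixes A :: "'a::topological_space \<Rightarrow> real ^ 'n::finite ^ 'n"
  assumes "\<And>i j. continuous_on S (\<lambda>x. A x $ i $ j)"
  shows "continuous_on S (\<lambda>x. det (A x))"
  unfolding Determinants.det_def by (intro continuous_intros assms)

text \<open>The segment from the identity to \<open>A\<close> consists of positive definite, hence
  invertible matrices, so the determinant cannot change sign on it. \<open>pos_def\<close> does not
  record symmetry; this argument avoids eigenvalues.\<close>

lemma pos_def_imp_det_pos:
  fixes A :: "real ^ 'n::finite ^ 'n"
  assumes "pos_def A"
  shows "0 < det A"
proof -
  define M :: "real \<Rightarrow> real ^ 'n ^ 'n" where
    "M t = (\<chi> i j. (1 - t) * (mat 1 $ i $ j) + t * A $ i $ j)" for t
  have nz: "det (M t) \<noteq> 0" if t: "0 \<le> t" "t \<le> 1" for t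
  proof
    assume "det (M t) = 0"
    then have "\<not> invertible (M t)" by (simp add: invertible_det_nz)
    then obtain x where x: "M t *v x = 0" "x \<noteq> 0"
      unfolding invertible_left_inverse matrix_left_invertible_ker by auto
    have "M t = (1 - t) *\<^sub>R mat 1 + t *\<^sub>R A" by (simp add: M_def Finite_Cartesian_Product.vec_eq_iff)
    then have "M t *v x = (1 - t) *\<^sub>R x + t *\<^sub>R (A *v x)"
      by (simp add: matrix_vector_mult_add_rdistrib scaleR_matrix_vector_assoc[symmetric])
    then have "0 = inner x ((1 - t) *\<^sub>R x + t *\<^sub>R (A *v x))" using x by simp
    also have "\<dots> = (1 - t) * inner x x + t * inner x (A *v x)" by (simp add: inner_add_right)
    finally have *: "(1 - t) * inner x x + t * inner x (A *v x) = 0" by simp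
    have "0 < inner x x" "0 < inner x (A *v x)" using x assms by (auto simp: pos_def_def)
    then have "0 < (1 - t) * inner x x + t * inner x (A *v x)"
      using t by (cases "t = 0") (auto intro!: add_nonneg_pos)
    then show False using * by simp
  qed
  have cont: "continuous_on {0..1} (\<lambda>t. det (M t))"
    by (rule continuous_on_det) (auto simp: M_def intro!: continuous_intros)
  have M01: "M 0 = mat 1" "M 1 = A" by (simp_all add: M_def Finite_Cartesian_Product.vec_eq_iff)
  show ?thesis
  proof (rule ccontr)
    assume "\<not> 0 < det A"
    then have "\<exists>t\<ge>0. t \<le> 1 \<and> det (M t) = 0"
      by (intro IVT2' cont) (auto simp: M01)
    then show False using nz by blast
  qed
qed

text \<open>Cramer's rule writes the entries of the inverse as quotients of polynomials in the
  entries of \<open>A\<close>, so that smoothness of the inverse follows from the closure rules for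
  \<open>C_on\<close>.\<close>

lemma matrix_inv_entry:
  fixes A :: "real ^ 'n::finite ^ 'n"
  assumes "det A \<noteq> 0"
  shows "matrix_inv A $ a $ b = det (\<chi> i j. if j = a then axis b 1 $ i else A $ i $ j) / det A"
proof -
  have "A ** matrix_inv A = mat 1"
    using assms someI_ex[of "\<lambda>B. A ** B = mat 1 \<and> B ** A = mat 1"]
    by (auto simp: invertible_det_nz[symmetric] invertible_def matrix_inv_def)
  then have "A *v (matrix_inv A *v axis b 1) = axis b 1"
    by (simp add: matrix_vector_mul_assoc)
  then have "matrix_inv A *v axis b 1 =
      (\<chi> k. det (\<chi> i j. if j = k then axis b 1 $ i else A $ i $ j) / det A)"
    using cramer[OF assms] by blast
  moreover have "(matrix_inv A *v axis b 1) $ a = matrix_inv A $ a $ b"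
    by (simp add: matrix_vector_mult_basis column_def)
  ultimately show ?thesis by simp
qed

subsection \<open>Matrices of variable size\<close>

lemma tendsto_det_mat:
  fixes A :: "'a \<Rightarrow> real Matrix.mat"
  assumes "\<And>x. A x \<in> carrier_mat n n" "B \<in> carrier_mat n n"
    and "\<And>i j. i < n \<Longrightarrow> j < n \<Longrightarrow> ((\<lambda>x. A x $$ (i, j)) \<longlongrightarrow> B $$ (i, j)) F"
  shows "((\<lambda>x. Determinant.det (A x)) \<longlongrightarrow> Determinant.det B) F"
  unfolding Determinant.det_def'[OF assms(1)] Determinant.det_def'[OF assms(2)]
  by (intro tendsto_sum tendsto_mult tendsto_prod tendsto_const assms(3)) (auto dest: permutes_in_image)

lemma borel_measurable_det_mat:
  fixes A :: "'a \<Rightarrow> real Matrix.mat"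
  assumes "\<And>x. A x \<in> carrier_mat n n"
    and "\<And>i j. i < n \<Longrightarrow> j < n \<Longrightarrow> (\<lambda>x. A x $$ (i, j)) \<in> borel_measurable M"
  shows "(\<lambda>x. Determinant.det (A x)) \<in> borel_measurable M"
  unfolding Determinant.det_def'[OF assms(1)]
  by (intro borel_measurable_sum borel_measurable_times borel_measurable_prod
      borel_measurable_const assms(2)) (auto dest: permutes_in_image)

text \<open>The form of \<open>pos_def_mat\<close>, moved to the function encoding used for
  parameters, where compactness and coordinatewise limits are at hand.\<close>

definition quad_form :: "nat \<Rightarrow> real Matrix.mat \<Rightarrow> (nat \<Rightarrow> real) \<Rightarrow> real" where
  "quad_form n A x = (\<Sum>i<n. \<Sum>j<n. x i * x j * A $$ (i, j))"

lemma scalar_prod_quad_form: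
  assumes "A \<in> carrier_mat n n"
  shows "scalar_prod (Matrix.vec n x) (A *\<^sub>v Matrix.vec n x) = quad_form n A x"
  using assms by (simp add: quad_form_def scalar_prod_def sum_distrib_left mult_ac lessThan_atLeast0)

lemma pos_def_mat_iff_quad_form:
  assumes A: "A \<in> carrier_mat n n"
  shows "pos_def_mat n A \<longleftrightarrow> (\<forall>x\<in>Rn n. x \<noteq> (\<lambda>_. 0) \<longrightarrow> 0 < quad_form n A x)"
proof (intro iffI ballI impI)
  fix x assume "pos_def_mat n A" and x: "x \<in> Rn n" "x \<noteq> (\<lambda>_. 0)"
  then obtain i where "i < n" "x i \<noteq> 0"
    by (auto simp: topspace_Euclidean_space fun_eq_iff) (meson not_le)
  then have "Matrix.vec n x \<noteq> 0\<^sub>v n" by (metis index_vec index_zero_vec(1))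
  then show "0 < quad_form n A x"
    using \<open>pos_def_mat n A\<close> scalar_prod_quad_form[OF A] by (auto simp: pos_def_mat_def)
next
  assume *: "\<forall>x\<in>Rn n. x \<noteq> (\<lambda>_. 0) \<longrightarrow> 0 < quad_form n A x"
  show "pos_def_mat n A" unfolding pos_def_mat_def
  proof (intro ballI impI)
    fix v :: "real Matrix.vec" assume v: "v \<in> carrier_vec n" "v \<noteq> 0\<^sub>v n"
    define x where "x i = (if i < n then vec_index v i else 0)" for i
    have vx: "v = Matrix.vec n x" using v by (auto simp: x_def)
    have "x \<noteq> (\<lambda>_. 0)"
    proof
      assume "x = (\<lambda>_. 0)"
      then have "v = 0\<^sub>v n" using vx by (auto simp: zero_vec_def)
      then show False using v by simp
    qed
    moreover have "x \<in> Rn n" by (auto simp: x_def topspace_Euclidean_space)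
    ultimately show "0 < scalar_prod v (A *\<^sub>v v)"
      using * scalar_prod_quad_form[OF A, of x] by (simp add: vx)
  qed
qed

text \<open>The homotopy argument of \<open>pos_def_imp_det_pos\<close>, for matrices of variable
  size.\<close>

lemma pos_def_mat_imp_det_pos:
  assumes A: "A \<in> carrier_mat n n" and pd: "pos_def_mat n A"
  shows "0 < Determinant.det A"
proof -
  define M where "M t = (1 - t) \<cdot>\<^sub>m 1\<^sub>m n + t \<cdot>\<^sub>m A" for t :: real
  have M: "M t \<in> carrier_mat n n" for t using A by (simp add: M_def)
  have nz: "Determinant.det (M t) \<noteq> 0" if t: "0 \<le> t" "t \<le> 1" for t
  proof
    assume "Determinant.det (M t) = 0"
    then obtain v where v: "v \<in> carrier_vec n" "v \<noteq> 0\<^sub>v n" "M t *\<^sub>v v = 0\<^sub>v n"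
      unfolding det_0_iff_vec_prod_zero_field[OF M] by auto
    have "M t *\<^sub>v v = (1 - t) \<cdot>\<^sub>v v + t \<cdot>\<^sub>v (A *\<^sub>v v)"
      unfolding M_def using v A
      by (subst add_mult_distrib_mat_vec[where nr = n and nc = n])
        (auto simp: scalar_prod_def sum_distrib_left mult_ac if_distrib[where f = "\<lambda>x. _ * x"]
          intro!: eq_vecI cong: if_cong)
    then have "0 = scalar_prod v ((1 - t) \<cdot>\<^sub>v v + t \<cdot>\<^sub>v (A *\<^sub>v v))"
      using scalar_prod_right_zero[OF v(1)] v(3) by metis
    also have "\<dots> = (1 - t) * scalar_prod v v + t * scalar_prod v (A *\<^sub>v v)"
      using v A by (simp add: scalar_prod_add_distrib[where n = n])
    finally have *: "(1 - t) * scalar_prod v v + t * scalar_prod v (A *\<^sub>v v) = 0" by simp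
    have "0 \<le> scalar_prod v v" by (auto simp: scalar_prod_def sum_nonneg)
    moreover have "scalar_prod v v \<noteq> 0"
    proof
      assume "scalar_prod v v = 0"
      then have "vec_index v i = 0" if "i < n" for i
        using that v by (auto simp: scalar_prod_def sum_nonneg_eq_0_iff)
      then have "v = 0\<^sub>v n" using v by (intro eq_vecI) auto
      then show False using v by simp
    qed
    moreover have "0 < scalar_prod v (A *\<^sub>v v)" using v pd by (auto simp: pos_def_mat_def)
    ultimately have "0 < (1 - t) * scalar_prod v v + t * scalar_prod v (A *\<^sub>v v)"
      using t by (cases "t = 0") (auto intro!: add_nonneg_pos)
    then show False using * by simp
  qed
  have cont: "continuous_on {0..1} (\<lambda>t. Determinant.det (M t))"
    unfolding continuous_on_def
  proof (intro ballI tendsto_det_mat)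
    fix t i j assume "i < n" "j < n"
    then have *: "(\<lambda>t. M t $$ (i, j)) = (\<lambda>t. (1 - t) * (1\<^sub>m n) $$ (i, j) + t * A $$ (i, j))"
      using A by (auto simp: M_def)
    show "((\<lambda>t. M t $$ (i, j)) \<longlongrightarrow> M t $$ (i, j)) (at t within {0..1})"
      unfolding fun_cong[OF *, of t] unfolding * by (intro tendsto_intros)
  qed (simp_all add: M)
  have M01: "M 0 = 1\<^sub>m n" "M 1 = A" using A by (auto simp: M_def)
  show ?thesis
  proof (rule ccontr)
    assume "\<not> 0 < Determinant.det A"
    then have "\<exists>t\<ge>0. t \<le> 1 \<and> Determinant.det (M t) = 0"
      by (intro IVT2' cont) (auto simp: M01)
    then show False using nz by blast
  qed
qed

text \<open>A closed subset of a product of compact sets, with factor \<open>{0}\<close> from index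
  \<open>n\<close> on, so that Tychonoff's theorem applies.\<close>

lemma compact_unit_sphere_Rn: "compact {x \<in> Rn n. dot n x x = 1}"
proof -
  let ?C = "\<lambda>i. if i < n then {-1..1} else {0::real}"
  have "compactin (product_topology (\<lambda>_. euclideanreal) UNIV) (\<Pi>\<^sub>E i\<in>UNIV. ?C i)"
    unfolding compactin_PiE by auto
  then have "compact (\<Pi>\<^sub>E i\<in>UNIV. ?C i)" by (simp add: euclidean_product_topology)
  moreover have "closed {x. dot n x x = 1}"
    unfolding dot_def by (intro closed_Collect_eq continuous_intros continuous_on_product_coordinates)
  ultimately have "compact ((\<Pi>\<^sub>E i\<in>UNIV. ?C i) \<inter> {x. dot n x x = 1})"
    by (rule compact_Int_closed)
  also have "(\<Pi>\<^sub>E i\<in>UNIV. ?C i) \<inter> {x. dot n x x = 1} = {x \<in> Rn n. dot n x x = 1}"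
  proof -
    have "\<bar>x i\<bar> \<le> 1" if "dot n x x = 1" "i < n" for x i
    proof -
      have "x i * x i \<le> dot n x x"
        unfolding dot_def using that by (intro member_le_sum[of i "{..<n}" "\<lambda>i. x i * x i"]) auto
      then show ?thesis using that by (simp add: abs_square_le_1 power2_eq_square[symmetric])
    qed
    then show ?thesis
      by (auto simp: PiE_iff topspace_Euclidean_space abs_le_iff Ball_def split: if_splits)
  qed
  finally show ?thesis .
qed

text \<open>Ranging over the countable type \<open>rat list\<close> makes quantification over this
  set countable. A list shorter than \<open>n\<close> is harmless, because its missing entries still
  denote rationals.\<close>

definition rational_vectors :: "nat \<Rightarrow> (nat \<Rightarrow> real) set" where
  "rational_vectors n = range (\<lambda>xs :: rat list. \<lambda>i. if i < n then of_rat (xs ! i) else 0)"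

lemma rational_vectors_dense:
  assumes "x \<in> Rn n"
  shows "\<exists>y. (\<forall>k. y k \<in> rational_vectors n) \<and> (\<forall>i. (\<lambda>k::nat. y k i) \<longlonglongrightarrow> x i)"
proof -
  have "\<exists>r. \<bar>of_rat r - x i\<bar> < inverse (real (Suc k))" for i k
    
  proof -
    have "x i < x i + inverse (real (Suc k))" by simp
    then obtain r where "x i < of_rat r" "of_rat r < x i + inverse (real (Suc k))"
      using of_rat_dense by blast
    then have "\<bar>of_rat r - x i\<bar> < inverse (real (Suc k))" by linarith
    then show ?thesis ..
  qed
  then obtain r where r: "\<And>i k. \<bar>of_rat (r i k) - x i\<bar> < inverse (real (Suc k))" by metis
  define y where "y k i = (if i < n then of_rat (map (\<lambda>i. r i k) [0..<n] ! i) else 0 :: real)" for k i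
  have "y k \<in> rational_vectors n" for k
    unfolding rational_vectors_def y_def by (rule rangeI)
  moreover have "(\<lambda>k. y k i) \<longlonglongrightarrow> x i" for i
  proof (cases "i < n")
    case True
    have "(\<lambda>k. of_rat (r i k) - x i) \<longlonglongrightarrow> 0"
      by (rule Lim_null_comparison[OF _ LIMSEQ_inverse_real_of_nat])
        (use r in \<open>auto intro!: always_eventually less_imp_le simp del: of_nat_Suc\<close>)
    then show ?thesis using True by (simp add: y_def LIM_zero_iff)
  next
    case False
    then show ?thesis using assms by (simp add: y_def topspace_Euclidean_space)
  qed
  ultimately show ?thesis by blast
qed

text \<open>By homogeneity and compactness of the unit sphere, positive definiteness is a countable
  condition.\<close>

lemma pos_def_mat_iff_countable:
  assumes A: "A \<in> carrier_mat n n"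
  shows "pos_def_mat n A \<longleftrightarrow>
    (\<exists>k. \<forall>x\<in>rational_vectors n. inverse (real (Suc k)) * dot n x x \<le> quad_form n A x)"
proof
  assume pd: "pos_def_mat n A"
  let ?K = "{x \<in> Rn n. dot n x x = 1}"
  have "\<exists>k. \<forall>x\<in>?K. inverse (real (Suc k)) \<le> quad_form n A x"
  proof (cases "?K = {}")
    case False
    have "continuous_on ?K (quad_form n A)"
      unfolding quad_form_def 
      by (intro continuous_intros continuous_on_subset[OF continuous_on_product_coordinates]) auto
    then obtain z where z: "z \<in> ?K" "\<And>x. x \<in> ?K \<Longrightarrow> quad_form n A z \<le> quad_form n A x"
      using continuous_attains_inf[OF compact_unit_sphere_Rn False] by blast
    then have "z \<noteq> (\<lambda>_. 0)" by (auto simp: dot_def)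
    then have "0 < quad_form n A z" using z pd pos_def_mat_iff_quad_form[OF A] by auto
    then obtain k where "inverse (real (Suc k)) < quad_form n A z" using reals_Archimedean by blast
    then show ?thesis using z(2) by (intro exI[of _ k]) force
  qed auto
  then obtain k where k: "\<And>x. x \<in> ?K \<Longrightarrow> inverse (real (Suc k)) \<le> quad_form n A x" by auto
  have "inverse (real (Suc k)) * dot n x x \<le> quad_form n A x" if x: "x \<in> Rn n" for x
  proof (cases "dot n x x = 0")
    case True
    then have "x i = 0" if "i < n" for i
      using that by (auto simp: dot_def sum_nonneg_eq_0_iff)
    then show ?thesis by (simp add: quad_form_def True)
  next
    case False
    then have pos: "0 < dot n x x" by (auto simp: dot_def order.strict_iff_order sum_nonneg)
    define c where "c = sqrt (dot n x x)"
    have c: "0 < c" "c * c = dot n x x" using pos by (auto simp: c_def)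
    have "(\<lambda>i. x i / c) \<in> ?K"
      using x c pos by (auto simp: topspace_Euclidean_space dot_def sum_divide_distrib[symmetric] c(2)[symmetric])
    from k[OF this] have "inverse (real (Suc k)) \<le> quad_form n A x / (c * c)"
      by (simp add: quad_form_def sum_divide_distrib)
    then show ?thesis using c pos by (simp add: field_simps)
  qed
  then show "\<exists>k. \<forall>x\<in>rational_vectors n. inverse (real (Suc k)) * dot n x x \<le> quad_form n A x"
    by (intro exI[of _ k]) (auto simp: rational_vectors_def topspace_Euclidean_space)
next
  assume "\<exists>k. \<forall>x\<in>rational_vectors n. inverse (real (Suc k)) * dot n x x \<le> quad_form n A x"
  then obtain k where k: "\<And>x. x\<in>rational_vectors n \<Longrightarrow> inverse (real (Suc k)) * dot n x x \<le> quad_form n A x"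
    by auto
  show "pos_def_mat n A" unfolding pos_def_mat_iff_quad_form[OF A]
  proof (intro ballI impI)
    fix x assume x: "x \<in> Rn n" "x \<noteq> (\<lambda>_. 0)"
    obtain y where y: "\<And>k. y k \<in> rational_vectors n" "\<And>i. (\<lambda>k::nat. y k i) \<longlonglongrightarrow> x i"
      using rational_vectors_dense[OF x(1)] by auto
    \<comment> \<open>The margin proportional to \<open>dot n x x\<close> survives the limit along
      rational vectors; a bare strict inequality would become weak.\<close>
    have "(\<lambda>l. inverse (real (Suc k)) * dot n (y l) (y l)) \<longlonglongrightarrow> inverse (real (Suc k)) * dot n x x"
      unfolding dot_def by (intro tendsto_intros y)
    moreover have "(\<lambda>l. quad_form n A (y l)) \<longlonglongrightarrow> quad_form n A x"
      unfolding quad_form_def by (intro tendsto_intros y)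
    ultimately have "inverse (real (Suc k)) * dot n x x \<le> quad_form n A x"
      by (rule LIMSEQ_le) (use k y in auto)
    moreover obtain i where "i < n" "x i \<noteq> 0"
      using x by (auto simp: topspace_Euclidean_space fun_eq_iff) (meson not_le)
    then have "0 < dot n x x"
      unfolding dot_def by (intro sum_pos2[of _ i]) (auto simp: zero_less_mult_iff)
    ultimately show "0 < quad_form n A x"
      by (smt (verit) inverse_positive_iff_positive mult_pos_pos of_nat_0_less_iff zero_less_Suc)
  qed
qed

lemma sets_pos_def_mat:
  assumes A: "\<And>x. A x \<in> carrier_mat n n"
    and [measurable]: "\<And>i j. i < n \<Longrightarrow> j < n \<Longrightarrow> (\<lambda>x. A x $$ (i, j)) \<in> borel_measurable M"
  shows "{x \<in> space M. pos_def_mat n (A x)} \<in> sets M"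
proof -
  have [measurable]: "(\<lambda>x. quad_form n (A x) v) \<in> borel_measurable M" for v
    unfolding quad_form_def by (intro borel_measurable_sum borel_measurable_times) auto
  have "Measurable.pred M (\<lambda>x. pos_def_mat n (A x))" 
    unfolding pos_def_mat_iff_countable[OF A] rational_vectors_def ball_simps
    by (intro pred_intros_countable) measurable
  then show ?thesis by (simp add: pred_def)
qed

section \<open>Convergence in probability as convergence along a filter\<close>

text \<open>A property holds eventually if it holds on measurable events \<open>E n\<close> of
  probability tending to 1. Asking only for events inside the property frees intermediate claims
  from measurability proofs.\<close>

definition whp :: "'w measure \<Rightarrow> (nat \<times> 'w) filter" where
  "whp P = Abs_filter (\<lambda>\<Phi>. \<exists>E. (\<forall>n. E n \<in> sets P) \<and> (\<lambda>n. measure P (E n)) \<longlonglongrightarrow> 1 \<and>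
     (\<forall>n. \<forall>\<omega>\<in>E n. \<Phi> (n, \<omega>)))"

context prob_space
begin

text \<open>Closure under conjunction holds because \<open>prob (E \<inter> G)\<close> is at least
  \<open>prob E + prob G - 1\<close>.\<close>

lemma eventually_whp:
  "eventually \<Phi> (whp M) \<longleftrightarrow>
    (\<exists>E. (\<forall>n. E n \<in> events) \<and> (\<lambda>n. prob (E n)) \<longlonglongrightarrow> 1 \<and> (\<forall>n. \<forall>\<omega>\<in>E n. \<Phi> (n, \<omega>)))"
  unfolding whp_def
proof (rule eventually_Abs_filter, rule is_filter.intro)
  show "\<exists>E. (\<forall>n. E n \<in> events) \<and> (\<lambda>n. prob (E n)) \<longlonglongrightarrow> 1 \<and> (\<forall>n. \<forall>\<omega>\<in>E n. True)"
    by (intro exI[of _ "\<lambda>_. space M"]) (simp add: prob_space)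
next
  fix \<Phi> \<Psi> :: "nat \<times> 'a \<Rightarrow> bool"
  assume "\<exists>E. (\<forall>n. E n \<in> events) \<and> (\<lambda>n. prob (E n)) \<longlonglongrightarrow> 1 \<and> (\<forall>n. \<forall>\<omega>\<in>E n. \<Phi> (n, \<omega>))"
    and "\<exists>E. (\<forall>n. E n \<in> events) \<and> (\<lambda>n. prob (E n)) \<longlonglongrightarrow> 1 \<and> (\<forall>n. \<forall>\<omega>\<in>E n. \<Psi> (n, \<omega>))"
  then obtain E G where E: "\<And>n. E n \<in> events" "(\<lambda>n. prob (E n)) \<longlonglongrightarrow> 1" "\<And>n \<omega>. \<omega>\<in>E n \<Longrightarrow> \<Phi> (n, \<omega>)"
    and G: "\<And>n. G n \<in> events" "(\<lambda>n. prob (G n)) \<longlonglongrightarrow> 1" "\<And>n \<omega>. \<omega>\<in>G n \<Longrightarrow> \<Psi> (n, \<omega>)"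
    by blast
  have "(\<lambda>n. prob (E n \<inter> G n)) \<longlonglongrightarrow> 1"
  proof (rule tendsto_sandwich[OF _ _ _ tendsto_const])
    have "prob (E n) + prob (G n) - 1 \<le> prob (E n \<inter> G n)" for n
      using measure_Un3[of "E n" M "G n"] prob_le_1[of "E n \<union> G n"] E G by (simp add: fmeasurable_eq_sets)
    then show "\<forall>\<^sub>F n in sequentially. prob (E n) + prob (G n) - 1 \<le> prob (E n \<inter> G n)" by simp
    show "(\<lambda>n. prob (E n) + prob (G n) - 1) \<longlonglongrightarrow> 1"
      using tendsto_diff[OF tendsto_add[OF E(2) G(2)] tendsto_const[of 1]] by simp
  qed simp
  then show "\<exists>E. (\<forall>n. E n \<in> events) \<and> (\<lambda>n. prob (E n)) \<longlonglongrightarrow> 1 \<and> (\<forall>n. \<forall>\<omega>\<in>E n. \<Phi> (n, \<omega>) \<and> \<Psi> (n, \<omega>))"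
    using E G by (intro exI[of _ "\<lambda>n. E n \<inter> G n"]) auto
next
  fix \<Phi> \<Psi> :: "nat \<times> 'a \<Rightarrow> bool"
  assume "\<forall>x. \<Phi> x \<longrightarrow> \<Psi> x" "\<exists>E. (\<forall>n. E n \<in> events) \<and> (\<lambda>n. prob (E n)) \<longlonglongrightarrow> 1 \<and> (\<forall>n. \<forall>\<omega>\<in>E n. \<Phi> (n, \<omega>))"
  then show "\<exists>E. (\<forall>n. E n \<in> events) \<and> (\<lambda>n. prob (E n)) \<longlonglongrightarrow> 1 \<and> (\<forall>n. \<forall>\<omega>\<in>E n. \<Psi> (n, \<omega>))"
    by blast
qed

lemma eventually_whpI:
  assumes "\<And>n. {\<omega>\<in>space M. \<Phi> (n, \<omega>)} \<in> events" "(\<lambda>n. prob {\<omega>\<in>space M. \<Phi> (n, \<omega>)}) \<longlonglongrightarrow> 1"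
  shows "eventually \<Phi> (whp M)"
  unfolding eventually_whp using assms by (intro exI[of _ "\<lambda>n. {\<omega>\<in>space M. \<Phi> (n, \<omega>)}"]) auto

text \<open>The way back to probabilities, which does require measurability, though only from some
  \<open>n\<close> on.\<close>

lemma eventually_whpD:
  assumes "eventually \<Phi> (whp M)" "\<forall>\<^sub>F n in sequentially. {\<omega>\<in>space M. \<Phi> (n, \<omega>)} \<in> events"
  shows "(\<lambda>n. prob {\<omega>\<in>space M. \<Phi> (n, \<omega>)}) \<longlonglongrightarrow> 1"
proof -
  obtain E where E: "\<And>n. E n \<in> events" "(\<lambda>n. prob (E n)) \<longlonglongrightarrow> 1" "\<And>n \<omega>. \<omega>\<in>E n \<Longrightarrow> \<Phi> (n, \<omega>)"
    using assms(1) unfolding eventually_whp by blast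
  show ?thesis
  proof (rule tendsto_sandwich[OF _ _ E(2) tendsto_const])
    show "\<forall>\<^sub>F n in sequentially. prob (E n) \<le> prob {\<omega>\<in>space M. \<Phi> (n, \<omega>)}"
      using assms(2)
      by (rule eventually_mono)
        (use E(3) sets.sets_into_space[OF E(1)] in \<open>auto intro!: finite_measure_mono\<close>)
  qed simp
qed

lemma filterlim_fst_whp: "filterlim fst sequentially (whp M)"
  unfolding filterlim_iff
proof (intro allI impI)
  fix P :: "nat \<Rightarrow> bool" assume P: "eventually P sequentially"
  show "eventually (\<lambda>x. P (fst x)) (whp M)"
  proof (rule eventually_whpI)
    show "(\<lambda>n. prob {\<omega> \<in> space M. P (fst (n, \<omega>))}) \<longlonglongrightarrow> 1"
      by (rule tendsto_eventually) (use P in \<open>eventually_elim; simp add: prob_space\<close>)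
  qed simp
qed

lemma eventually_whp_sequentially: "eventually P sequentially \<Longrightarrow> \<forall>\<^sub>F x in whp M. P (fst x)"
  using filterlim_fst_whp by (auto simp: filterlim_iff)

lemma eventually_whp_ge: "\<forall>\<^sub>F x in whp M. k \<le> fst x \<and> snd x \<in> space M"
  by (intro eventually_conj eventually_whp_sequentially eventually_ge_at_top eventually_whpI)
    (simp_all add: prob_space)

lemma tendsto_whp_0I:
  fixes f :: "nat \<Rightarrow> 'a \<Rightarrow> real"
  assumes [measurable]: "\<And>n. f n \<in> borel_measurable M"
    and lim: "\<And>e. 0 < e \<Longrightarrow> (\<lambda>n. prob {\<omega>\<in>space M. e \<le> \<bar>f n \<omega>\<bar>}) \<longlonglongrightarrow> 0"
  shows "((\<lambda>x. f (fst x) (snd x)) \<longlongrightarrow> 0) (whp M)"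
  unfolding tendsto_iff
proof (intro allI impI eventually_whpI)
  fix e :: real assume e: "0 < e"
  show "{\<omega> \<in> space M. dist (f (fst (n, \<omega>)) (snd (n, \<omega>))) 0 < e} \<in> events" for n by simp
  have "prob {\<omega> \<in> space M. dist (f (fst (n, \<omega>)) (snd (n, \<omega>))) 0 < e} =
      1 - prob {\<omega>\<in>space M. e \<le> \<bar>f n \<omega>\<bar>}" for n
    by (subst prob_compl[symmetric]) (auto intro!: arg_cong[where f = prob])
  then show "(\<lambda>n. prob {\<omega> \<in> space M. dist (f (fst (n, \<omega>)) (snd (n, \<omega>))) 0 < e}) \<longlonglongrightarrow> 1"
    using tendsto_diff[OF tendsto_const[of 1] lim[OF e]] by simp
qed

text \<open>Markov's inequality; meant for the noise, whose second moments are explicit.\<close>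

lemma tendsto_whp_0_expectation:
  fixes f :: "nat \<Rightarrow> 'a \<Rightarrow> real"
  assumes int: "\<And>n. integrable M (f n)" and nonneg: "\<And>n \<omega>. 0 \<le> f n \<omega>"
    and lim: "(\<lambda>n. expectation (f n)) \<longlonglongrightarrow> 0"
  shows "((\<lambda>x. f (fst x) (snd x)) \<longlongrightarrow> 0) (whp M)"
proof (rule tendsto_whp_0I)
  show "f n \<in> borel_measurable M" for n using int by simp
  fix e :: real assume e: "0 < e"
  show "(\<lambda>n. prob {\<omega> \<in> space M. e \<le> \<bar>f n \<omega>\<bar>}) \<longlonglongrightarrow> 0"
  proof (rule tendsto_sandwich[OF _ _ tendsto_const])
    have "prob {\<omega> \<in> space M. e \<le> \<bar>f n \<omega>\<bar>} \<le> expectation (f n) / e" for n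
      using integral_Markov_inequality_measure[OF int[of n], of "{}" e] nonneg e by simp
    then show "\<forall>\<^sub>F n in sequentially. prob {\<omega> \<in> space M. e \<le> \<bar>f n \<omega>\<bar>} \<le> expectation (f n) / e" by simp
    show "(\<lambda>n. expectation (f n) / e) \<longlonglongrightarrow> 0" using tendsto_divide[OF lim tendsto_const[of e]] e by simp
  qed simp
qed

text \<open>Dominated convergence of the indicators of the exceptional events; meant for the drift,
  whose bound has a random constant.\<close>

lemma tendsto_whp_0_AE:
  fixes f :: "nat \<Rightarrow> 'a \<Rightarrow> real"
  assumes [measurable]: "\<And>n. f n \<in> borel_measurable M"
    and lim: "AE \<omega> in M. (\<lambda>n. f n \<omega>) \<longlonglongrightarrow> 0"
  shows "((\<lambda>x. f (fst x) (snd x)) \<longlongrightarrow> 0) (whp M)"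
proof (rule tendsto_whp_0I)
  fix e :: real assume e: "0 < e"
  let ?A = "\<lambda>n. {\<omega> \<in> space M. e \<le> \<bar>f n \<omega>\<bar>}"
  have "(\<lambda>n. \<integral>\<omega>. indicator (?A n) \<omega> \<partial>M) \<longlonglongrightarrow> (\<integral>\<omega>. (0::real) \<partial>M)"
  proof (rule integral_dominated_convergence[where w = "\<lambda>_. 1"])
    show "AE \<omega> in M. (\<lambda>n. indicator (?A n) \<omega>) \<longlonglongrightarrow> (0::real)"
      using lim
    proof eventually_elim
      case (elim \<omega>)
      then have "\<forall>\<^sub>F n in sequentially. \<bar>f n \<omega>\<bar> < e" using e by (auto simp: tendsto_iff)
      then show ?case by (intro tendsto_eventually) (auto elim!: eventually_mono)
    qed
  qed (auto simp: indicator_def)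
  then show "(\<lambda>n. prob (?A n)) \<longlonglongrightarrow> 0" by simp
qed simp

end

section \<open>Moments of Wiener increments\<close>

text \<open>Fubini's theorem: \<open>lborel\<close> is the image of a product measure indexed by
  \<open>Basis\<close>, and the basis vectors \<open>axis i 1\<close> carry this index set over to
  the components.\<close>

lemma lborel_vec_prod:
  fixes g :: "'r::finite \<Rightarrow> real \<Rightarrow> real"
  assumes g: "\<And>i. integrable lborel (g i)"
  shows "has_bochner_integral lborel (\<lambda>x::real^'r. \<Prod>i\<in>UNIV. g i (x $ i)) (\<Prod>i\<in>UNIV. integral\<^sup>L lborel (g i))"
proof -
  interpret product_sigma_finite "\<lambda>_::real^'r. lborel :: real measure" ..
  define h where "h b = g (axis_index b)" for b :: "real^'r"
  have lb: "lborel = distr (\<Pi>\<^sub>M b\<in>(Basis :: (real^'r) set). lborel :: real measure) borel (\<lambda>f. \<Sum>b\<in>Basis. f b *\<^sub>R b)"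
    by (rule lborel_eq)
  have bij: "bij_betw (\<lambda>i. axis i (1::real)) UNIV (Basis :: (real^'r) set)"
    unfolding bij_betw_def by (auto simp: inj_on_def axis_eq_axis Basis_vec_def)
  have coord: "(\<Sum>b\<in>Basis. f b *\<^sub>R b) $ i = f (axis i 1)" for f :: "real^'r \<Rightarrow> real" and i
  proof -
    have "(\<Sum>b\<in>Basis. f b *\<^sub>R b) $ i = inner (\<Sum>b\<in>Basis. f b *\<^sub>R b) (axis i 1)"
      by (simp add: inner_axis)
    also have "\<dots> = f (axis i 1)"
      by (rule inner_sum_left_Basis) (auto simp: Basis_vec_def)
    finally show ?thesis .
  qed
  have prod: "(\<Prod>i\<in>UNIV. F i (axis i 1)) = (\<Prod>b\<in>Basis. F (axis_index b) b)" for F :: "'r \<Rightarrow> real^'r \<Rightarrow> real"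
    by (subst prod.reindex_bij_betw[OF bij, symmetric]) (simp add: axis_index_axis)
  have int: "integrable lborel (h b)" for b by (simp add: h_def g)
  have gm[measurable]: "g i \<in> borel_measurable borel" for i using g[of i] by simp
  have "integrable (\<Pi>\<^sub>M b\<in>Basis. lborel) (\<lambda>f. \<Prod>b\<in>Basis. h b (f b))"
    by (rule product_integrable_prod[OF finite_Basis int])
  moreover have "(\<integral>f. (\<Prod>b\<in>Basis. h b (f b)) \<partial>(\<Pi>\<^sub>M b\<in>Basis. lborel)) = (\<Prod>b\<in>Basis. integral\<^sup>L lborel (h b))"
    by (rule product_integral_prod[OF finite_Basis int])
  moreover have "(\<lambda>f. \<Prod>b\<in>Basis. h b (f b)) = (\<lambda>f. \<Prod>i\<in>UNIV. g i ((\<Sum>b\<in>Basis. f b *\<^sub>R b) $ i))"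
    unfolding coord h_def using prod[of "\<lambda>i b. g i (f b)" for f] by (simp add: fun_eq_iff)
  moreover have "(\<Prod>b\<in>Basis. integral\<^sup>L lborel (h b)) = (\<Prod>i\<in>UNIV. integral\<^sup>L lborel (g i))"
    unfolding h_def using prod[of "\<lambda>i b. integral\<^sup>L lborel (g i)"] by simp
  ultimately show ?thesis
    unfolding has_bochner_integral_iff
    by (subst (1 2) lb) (simp add: integrable_distr_eq integral_distr)
qed

context prob_space
begin

text \<open>The preimages of Borel sets under a function are stable under intersection, so
  independence passes to the generated sigma-algebras. This is \<open>indep_var\<close>, for which
  the product rule is available.\<close>

lemma indep_set_expectation:
  fixes f g :: "'a \<Rightarrow> real"
  assumes indep: "indep_set A B"
    and f: "\<And>S. S \<in> sets borel \<Longrightarrow> f -` S \<inter> space M \<in> A" "integrable M f"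
    and g: "\<And>S. S \<in> sets borel \<Longrightarrow> g -` S \<inter> space M \<in> B" "integrable M g"
  shows "integrable M (\<lambda>\<omega>. f \<omega> * g \<omega>)"
    and "expectation (\<lambda>\<omega>. f \<omega> * g \<omega>) = expectation f * expectation g"
proof -
  let ?G = "\<lambda>f. {f -` S \<inter> space M | S. S \<in> sets (borel :: real measure)}"
  have stable: "Int_stable (?G f)" for f :: "'a \<Rightarrow> real"
  proof (rule Int_stableI)
    fix a b assume "a \<in> ?G f" "b \<in> ?G f"
    then obtain S S' where "a = f -` S \<inter> space M" "S \<in> sets borel" "b = f -` S' \<inter> space M" "S' \<in> sets borel"
      by auto
    then have "a \<inter> b = f -` (S \<inter> S') \<inter> space M" "S \<inter> S' \<in> sets borel" by auto
    then show "a \<inter> b \<in> ?G f" by blast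
  qed
  have "indep_set (?G f) (?G g)"
  proof (rule indep_setI)
    show "?G f \<subseteq> events" using f indep_setD_ev1[OF indep] by blast
    show "?G g \<subseteq> events" using g indep_setD_ev2[OF indep] by blast
    show "prob (a \<inter> b) = prob a * prob b" if "a \<in> ?G f" "b \<in> ?G g" for a b
      using that f(1) g(1) by (intro indep_setD[OF indep]) auto
  qed
  then have "indep_var borel f borel g"
    unfolding indep_var_eq using f g indep_set_sigma_sets[OF _ stable stable] by auto
  then show "integrable M (\<lambda>\<omega>. f \<omega> * g \<omega>)"
    and "expectation (\<lambda>\<omega>. f \<omega> * g \<omega>) = expectation f * expectation g"
    using f g by (auto intro: indep_var_integrable simp: indep_var_lebesgue_integral)
qed

lemma expectation_orthogonal_sum:
  fixes \<zeta> :: "'i \<Rightarrow> 'a \<Rightarrow> real"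
  assumes int: "\<And>i j. i \<in> I \<Longrightarrow> j \<in> I \<Longrightarrow> integrable M (\<lambda>\<omega>. \<zeta> i \<omega> * \<zeta> j \<omega>)"
    and orth: "\<And>i j. i \<in> I \<Longrightarrow> j \<in> I \<Longrightarrow> i \<noteq> j \<Longrightarrow> expectation (\<lambda>\<omega>. \<zeta> i \<omega> * \<zeta> j \<omega>) = 0"
    and le: "\<And>i. i \<in> I \<Longrightarrow> expectation (\<lambda>\<omega>. \<zeta> i \<omega> * \<zeta> i \<omega>) \<le> c"
    and fin: "finite I"
  shows "integrable M (\<lambda>\<omega>. (\<Sum>i\<in>I. \<zeta> i \<omega>)\<^sup>2)"
    and "expectation (\<lambda>\<omega>. (\<Sum>i\<in>I. \<zeta> i \<omega>)\<^sup>2) \<le> real (card I) * c"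
proof -
  have eq: "(\<Sum>i\<in>I. \<zeta> i \<omega>)\<^sup>2 = (\<Sum>i\<in>I. \<Sum>j\<in>I. \<zeta> i \<omega> * \<zeta> j \<omega>)" for \<omega>
    by (simp add: power2_eq_square sum_product)
  show "integrable M (\<lambda>\<omega>. (\<Sum>i\<in>I. \<zeta> i \<omega>)\<^sup>2)"
    unfolding eq by (intro Bochner_Integration.integrable_sum int)
  have "expectation (\<lambda>\<omega>. (\<Sum>i\<in>I. \<zeta> i \<omega>)\<^sup>2) = (\<Sum>i\<in>I. \<Sum>j\<in>I. expectation (\<lambda>\<omega>. \<zeta> i \<omega> * \<zeta> j \<omega>))"
    unfolding eq by (simp add: int Bochner_Integration.integrable_sum)
  also have "\<dots> = (\<Sum>i\<in>I. \<Sum>j\<in>I. if j = i then expectation (\<lambda>\<omega>. \<zeta> i \<omega> * \<zeta> i \<omega>) else 0)"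
    by (intro sum.cong refl) (use orth in auto)
  also have "\<dots> = (\<Sum>i\<in>I. expectation (\<lambda>\<omega>. \<zeta> i \<omega> * \<zeta> i \<omega>))" using fin by simp
  also have "\<dots> \<le> real (card I) * c" using le by (intro sum_bounded_above)
  finally show "expectation (\<lambda>\<omega>. (\<Sum>i\<in>I. \<zeta> i \<omega>)\<^sup>2) \<le> real (card I) * c" .
qed

end

definition normal_moment :: "real \<Rightarrow> nat \<Rightarrow> real" where
  "normal_moment \<sigma> k = (\<integral>x. normal_density 0 \<sigma> x * x ^ k \<partial>lborel)"

lemma normal_moment_values:
  assumes "0 < \<sigma>"
  shows "normal_moment \<sigma> 0 = 1" "normal_moment \<sigma> 1 = 0" "normal_moment \<sigma> 2 = \<sigma>\<^sup>2"
    "normal_moment \<sigma> 4 = 3 * \<sigma> ^ 4"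
  using integral_normal_moment_even[OF assms, of 0 0] integral_normal_moment_odd[OF assms, of 0 0]
    integral_normal_moment_even[OF assms, of 0 1] integral_normal_moment_even[OF assms, of 0 2] assms
  by (simp_all add: normal_moment_def fact_numeral power_divide divide_simps)

section \<open>Increments of a Wiener process\<close>

lemma
  assumes "stochastic_basis P F"
  shows stochastic_basis_prob_space: "prob_space P"
    and stochastic_basis_subalgebra: "0 \<le> t \<Longrightarrow> subalgebra P (F t)"
    and stochastic_basis_mono: "0 \<le> s \<Longrightarrow> s \<le> t \<Longrightarrow> sets (F s) \<subseteq> sets (F t)"
proof -
  note b = assms[unfolded stochastic_basis_def]
  show "prob_space P" using b by (rule conjunct1)
  show "subalgebra P (F t)" if "0 \<le> t"
    using conjunct1[OF conjunct2[OF b]] that by meson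
  show "sets (F s) \<subseteq> sets (F t)" if "0 \<le> s" "s \<le> t"
    using conjunct1[OF conjunct2[OF conjunct2[OF b]]] that by meson
qed

lemma adapted_measurable:
  "stochastic_basis P F \<Longrightarrow> 0 \<le> t \<Longrightarrow> Z \<in> measurable (F t) N \<Longrightarrow> Z \<in> measurable P N"
  by (rule measurable_from_subalg[OF stochastic_basis_subalgebra])

lemma adapted_measurable_mono:
  assumes "stochastic_basis P F" "0 \<le> s" "s \<le> t" "Z \<in> measurable (F s) N"
  shows "Z \<in> measurable (F t) N"
proof -
  have "subalgebra (F t) (F s)"
    using stochastic_basis_subalgebra[OF assms(1), of s] stochastic_basis_subalgebra[OF assms(1), of t]
      stochastic_basis_mono[OF assms(1-3)] assms(2,3) by (simp add: subalgebra_def)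
  then show ?thesis using assms(4) by (rule measurable_from_subalg)
qed

lemma wiener_measurable:
  "stochastic_basis P F \<Longrightarrow> wiener_process P F W \<Longrightarrow> 0 \<le> t \<Longrightarrow> W t \<in> borel_measurable P"
  by (rule adapted_measurable) (auto simp: wiener_process_def)

lemma wiener_moment:
  fixes W :: "real \<Rightarrow> 'w \<Rightarrow> real ^ 'r::finite"
  assumes W: "wiener_process P F W" and st: "0 \<le> s" "s < t"
  shows "has_bochner_integral P (\<lambda>\<omega>. \<Prod>i\<in>UNIV. ((W t \<omega> - W s \<omega>) $ i) ^ k i)
    (\<Prod>i\<in>UNIV. normal_moment (sqrt (t - s)) (k i))"
proof -
  let ?f = "\<lambda>x::real^'r. \<Prod>i\<in>UNIV. normal_density 0 (sqrt (t - s)) (x $ i)"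
  let ?g = "\<lambda>x::real^'r. \<Prod>i\<in>UNIV. (x $ i) ^ k i"
  have D: "distributed P lborel (\<lambda>\<omega>. W t \<omega> - W s \<omega>) (\<lambda>x. ennreal (?f x))"
    using W st by (auto simp: wiener_process_def)
  have f: "0 \<le> ?f x" for x by (intro prod_nonneg) simp
  have g: "?g \<in> borel_measurable lborel" by measurable
  have "integrable lborel (\<lambda>x. normal_density 0 (sqrt (t - s)) x * x ^ k i)" for i
    using integrable_normal_moment[of "sqrt (t - s)" 0 "k i"] st by simp
  then have "has_bochner_integral lborel (\<lambda>x. ?f x * ?g x) (\<Prod>i\<in>UNIV. normal_moment (sqrt (t - s)) (k i))"
    unfolding prod.distrib[symmetric] normal_moment_def
    by (rule lborel_vec_prod[where g = "\<lambda>i x. normal_density 0 (sqrt (t - s)) x * x ^ k i"])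
  then show ?thesis
    using distributed_integrable[OF D g f] distributed_integral[OF D g f]
    by (simp add: has_bochner_integral_iff)
qed

text \<open>A coordinate is singled out by an exponent vector supported at \<open>r\<close>; adding
  two such vectors gives the products of two coordinates.\<close>

lemma prod_power_single: "(\<Prod>i\<in>UNIV. (x i :: real) ^ (if i = r then m else 0)) = x (r::'r::finite) ^ m"
  by (simp add: if_distrib[where f = "\<lambda>m. _ ^ m"] cong: if_cong)

lemma wiener_moment_single:
  fixes W :: "real \<Rightarrow> 'w \<Rightarrow> real ^ 'r::finite"
  assumes W: "wiener_process P F W" and st: "0 \<le> s" "s < t"
  shows "has_bochner_integral P (\<lambda>\<omega>. ((W t \<omega> - W s \<omega>) $ r) ^ m) (normal_moment (sqrt (t - s)) m)"
proof -
  have "(\<Prod>i\<in>UNIV. normal_moment (sqrt (t - s)) (if i = r then m else 0)) = normal_moment (sqrt (t - s)) m"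
    using st by (simp add: if_distrib normal_moment_values cong: if_cong)
  then show ?thesis
    using wiener_moment[OF W st, of "\<lambda>i. if i = r then m else 0"] unfolding prod_power_single by simp
qed

lemma wiener_covariance:
  fixes W :: "real \<Rightarrow> 'w \<Rightarrow> real ^ 'r::finite"
  assumes W: "wiener_process P F W" and st: "0 \<le> s" "s < t"
  shows "has_bochner_integral P (\<lambda>\<omega>. (W t \<omega> - W s \<omega>) $ r * (W t \<omega> - W s \<omega>) $ u) (if r = u then t - s else 0)"
proof (cases "r = u")
  case True
  then show ?thesis
    using wiener_moment_single[OF assms, of r 2] st by (simp add: normal_moment_values power2_eq_square)
next
  case False
  let ?k = "\<lambda>i. (if i = r then 1 else 0) + (if i = u then 1 else 0 :: nat)"
  have z: "(\<Prod>i\<in>UNIV. normal_moment (sqrt (t - s)) (?k i)) = 0"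
  proof (rule prod_zero)
    have "normal_moment (sqrt (t - s)) (?k r) = 0" using False st normal_moment_values[of "sqrt (t - s)"] by simp
    then show "\<exists>i\<in>UNIV. normal_moment (sqrt (t - s)) (?k i) = 0" by blast
  qed simp
  then show ?thesis
    using wiener_moment[OF assms, of ?k, unfolded z power_add prod.distrib prod_power_single] False by simp
qed

text \<open>The inequality between \<open>(x * y)^2\<close> and the mean of \<open>x^4\<close> and
  \<open>y^4\<close> treats equal and distinct components at once. The constant 3 is the fourth
  moment of the standard normal distribution.\<close>

lemma wiener_fourth_moment:
  fixes W :: "real \<Rightarrow> 'w \<Rightarrow> real ^ 'r::finite"
  assumes W: "wiener_process P F W" and st: "0 \<le> s" "s < t"
  shows "integrable P (\<lambda>\<omega>. ((W t \<omega> - W s \<omega>) $ r * (W t \<omega> - W s \<omega>) $ u)\<^sup>2)" (is "integrable P ?f")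
    and "(\<integral>\<omega>. ((W t \<omega> - W s \<omega>) $ r * (W t \<omega> - W s \<omega>) $ u)\<^sup>2 \<partial>P) \<le> 3 * (t - s)\<^sup>2"
proof -
  note m = wiener_moment_single[OF assms, of _ 4]
  have 4: "normal_moment (sqrt (t - s)) 4 = 3 * (t - s)\<^sup>2"
    using st normal_moment_values(4)[of "sqrt (t - s)"] by (simp add: power4_eq_xxxx power2_eq_square)
  let ?k = "\<lambda>i. (if i = r then 2 else 0) + (if i = u then 2 else 0 :: nat)"
  show int: "integrable P ?f"
    using wiener_moment[OF assms, of ?k]
    unfolding power_add prod.distrib prod_power_single has_bochner_integral_iff by (simp add: power_mult_distrib)
  have le: "(x * y)\<^sup>2 \<le> (x ^ 4 + y ^ 4) / 2" for x y :: real
    using sum_squares_bound[of "x\<^sup>2" "y\<^sup>2"] by (simp add: power_mult_distrib)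
  have "(\<integral>\<omega>. ?f \<omega> \<partial>P) \<le> (\<integral>\<omega>. (((W t \<omega> - W s \<omega>) $ r) ^ 4 + ((W t \<omega> - W s \<omega>) $ u) ^ 4) / 2 \<partial>P)"
    using m by (intro integral_mono int le) (auto simp: has_bochner_integral_iff)
  also have "\<dots> = 3 * (t - s)\<^sup>2" using m 4 by (simp add: has_bochner_integral_iff)
  finally show "(\<integral>\<omega>. ?f \<omega> \<partial>P) \<le> 3 * (t - s)\<^sup>2" .
qed

text \<open>The earlier increment is measurable with respect to \<open>F u\<close>, and the later
  one is independent of \<open>F u\<close>.\<close>

lemma wiener_independent_increments:
  fixes W :: "real \<Rightarrow> 'w \<Rightarrow> real ^ 'r::finite"
  assumes basis: "stochastic_basis P F" and W: "wiener_process P F W"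
    and tm: "0 \<le> s" "s < t" "t \<le> u" "u < v"
    and f[measurable]: "f \<in> borel_measurable borel" and g[measurable]: "g \<in> borel_measurable borel"
    and int: "integrable P (\<lambda>\<omega>. f (W t \<omega> - W s \<omega>) :: real)" "integrable P (\<lambda>\<omega>. g (W v \<omega> - W u \<omega>) :: real)"
  shows "integrable P (\<lambda>\<omega>. f (W t \<omega> - W s \<omega>) * g (W v \<omega> - W u \<omega>))"
    and "(\<integral>\<omega>. f (W t \<omega> - W s \<omega>) * g (W v \<omega> - W u \<omega>) \<partial>P) =
      (\<integral>\<omega>. f (W t \<omega> - W s \<omega>) \<partial>P) * (\<integral>\<omega>. g (W v \<omega> - W u \<omega>) \<partial>P)"
proof -
  interpret prob_space P using basis by (rule stochastic_basis_prob_space)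
  let ?V = "vimage_algebra (space P) (\<lambda>\<omega>. W v \<omega> - W u \<omega>) borel"
  have ind: "indep_set (sets (F u)) (sets ?V)"
    using W tm by (auto simp: wiener_process_def)
  have [measurable]: "W t \<in> borel_measurable (F u)" "W s \<in> borel_measurable (F u)"
    using W tm adapted_measurable_mono[OF basis, of t u "W t" borel]
      adapted_measurable_mono[OF basis, of s u "W s" borel] by (auto simp: wiener_process_def)
  have sp: "space (F u) = space P" using stochastic_basis_subalgebra[OF basis, of u] tm by (simp add: subalgebra_def)
  have *: "(\<lambda>\<omega>. f (W t \<omega> - W s \<omega>)) \<in> borel_measurable (F u)" by measurable
  have "(\<lambda>\<omega>. W v \<omega> - W u \<omega>) \<in> measurable ?V borel" by (rule measurable_vimage_algebra1) simp
  from measurable_compose[OF this g]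
  have **: "(\<lambda>\<omega>. g (W v \<omega> - W u \<omega>)) \<in> borel_measurable ?V" .
  have "(\<lambda>\<omega>. f (W t \<omega> - W s \<omega>)) -` S \<inter> space P \<in> sets (F u)" if "S \<in> sets borel" for S
    using measurable_sets[OF * that] sp by simp
  moreover have "(\<lambda>\<omega>. g (W v \<omega> - W u \<omega>)) -` S \<inter> space P \<in> sets ?V" if "S \<in> sets borel" for S
    using measurable_sets[OF ** that] by simp
  ultimately show "integrable P (\<lambda>\<omega>. f (W t \<omega> - W s \<omega>) * g (W v \<omega> - W u \<omega>))"
    and "(\<integral>\<omega>. f (W t \<omega> - W s \<omega>) * g (W v \<omega> - W u \<omega>) \<partial>P) =
      (\<integral>\<omega>. f (W t \<omega> - W s \<omega>) \<partial>P) * (\<integral>\<omega>. g (W v \<omega> - W u \<omega>) \<partial>P)"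
    using indep_set_expectation[OF ind _ int(1) _ int(2)] by blast+
qed

lemma grid:
  assumes "0 < T" "1 \<le> n" "i \<in> {1..n}"
  shows "0 \<le> (real i - 1) * (T / real n)" "(real i - 1) * (T / real n) < real i * (T / real n)"
    "real i * (T / real n) - (real i - 1) * (T / real n) = T / real n"
    "real i * (T / real n) \<le> T" "0 \<le> real i * (T / real n)"
    "j \<in> {1..n} \<Longrightarrow> i < j \<Longrightarrow> real i * (T / real n) \<le> (real j - 1) * (T / real n)"
proof -
  have "a * h - (a - 1) * h = h" for a h :: real by (simp add: algebra_simps)
  then show "real i * (T / real n) - (real i - 1) * (T / real n) = T / real n" .
  show "real i * (T / real n) \<le> (real j - 1) * (T / real n)" if "j \<in> {1..n}" "i < j"
    using that assms by (intro mult_right_mono) auto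
qed (use assms in \<open>auto intro!: mult_nonneg_nonneg mult_right_mono simp: field_simps\<close>)

text \<open>The centred products over different intervals are orthogonal, so the second moment of
  the sum consists of \<open>n\<close> terms of order \<open>(T / n)^2\<close>, of order
  \<open>1 / n\<close> in total.\<close>

lemma wiener_quadratic_variation:
  fixes W :: "real \<Rightarrow> 'w \<Rightarrow> real ^ 'r::finite" and r u :: 'r
  assumes basis: "stochastic_basis P F" and W: "wiener_process P F W" and T: "0 < T" and n: "1 \<le> n"
  defines "\<zeta> \<equiv> \<lambda>i \<omega>. increment T n W \<omega> i $ r * increment T n W \<omega> i $ u - (if r = u then T / real n else 0)"
  shows "integrable P (\<lambda>\<omega>. (\<Sum>i\<in>{1..n}. \<zeta> i \<omega>)\<^sup>2)"
    and "(\<integral>\<omega>. (\<Sum>i\<in>{1..n}. \<zeta> i \<omega>)\<^sup>2 \<partial>P) \<le> real n * (3 * (T / real n)\<^sup>2)"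
proof -
  interpret prob_space P using basis by (rule stochastic_basis_prob_space)
  let ?h = "T / real n"
  let ?d = "if r = u then ?h else 0"
  let ?f = "\<lambda>x::real^'r. x $ r * x $ u - ?d"
  note g = grid[OF T n]
  have \<zeta>: "\<zeta> i \<omega> = ?f (W (real i * ?h) \<omega> - W ((real i - 1) * ?h) \<omega>)" for i \<omega>
    by (simp add: \<zeta>_def increment_def)
  have f[measurable]: "?f \<in> borel_measurable borel" by measurable
  have cov: "has_bochner_integral P (\<lambda>\<omega>. increment T n W \<omega> i $ r * increment T n W \<omega> i $ u) ?d"
    if "i \<in> {1..n}" for i
    using wiener_covariance[OF W g(1,2)[OF that], of r u] unfolding increment_def g(3)[OF that] .
  have int1: "integrable P (\<zeta> i)" and e0: "expectation (\<zeta> i) = 0" if "i \<in> {1..n}" for i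
    using cov[OF that] by (auto simp: \<zeta>_def has_bochner_integral_iff prob_space)
  have sq: "integrable P (\<lambda>\<omega>. (increment T n W \<omega> i $ r * increment T n W \<omega> i $ u)\<^sup>2)"
    "expectation (\<lambda>\<omega>. (increment T n W \<omega> i $ r * increment T n W \<omega> i $ u)\<^sup>2) \<le> 3 * ?h\<^sup>2" if "i \<in> {1..n}" for i
    using wiener_fourth_moment[OF W g(1,2)[OF that], of r u] unfolding increment_def g(3)[OF that] .
  \<comment> \<open>In expectation this is the second moment of the product minus the square of its
    mean: centring can only lower it.\<close>
  have \<zeta>2: "\<zeta> i \<omega> * \<zeta> i \<omega> = (increment T n W \<omega> i $ r * increment T n W \<omega> i $ u)\<^sup>2
      - 2 * ?d * (increment T n W \<omega> i $ r * increment T n W \<omega> i $ u) + ?d\<^sup>2" for i \<omega>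
    by (simp add: \<zeta>_def power2_eq_square algebra_simps)
  have cross: "integrable P (\<lambda>\<omega>. \<zeta> i \<omega> * \<zeta> j \<omega>)" "expectation (\<lambda>\<omega>. \<zeta> i \<omega> * \<zeta> j \<omega>) = 0"
    if ij: "i \<in> {1..n}" "j \<in> {1..n}" "i < j" for i j
  proof -
    note w = wiener_independent_increments[OF basis W g(1,2)[OF ij(1)] g(6)[OF ij] g(2)[OF ij(2)] f f,
      folded \<zeta>, OF int1[OF ij(1)] int1[OF ij(2)]]
    show "integrable P (\<lambda>\<omega>. \<zeta> i \<omega> * \<zeta> j \<omega>)" "expectation (\<lambda>\<omega>. \<zeta> i \<omega> * \<zeta> j \<omega>) = 0"
      using w e0[OF ij(1)] by auto
  qed
  have diag: "integrable P (\<lambda>\<omega>. \<zeta> i \<omega> * \<zeta> i \<omega>)" "expectation (\<lambda>\<omega>. \<zeta> i \<omega> * \<zeta> i \<omega>) \<le> 3 * ?h\<^sup>2"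
    if i: "i \<in> {1..n}" for i
  proof -
    show "integrable P (\<lambda>\<omega>. \<zeta> i \<omega> * \<zeta> i \<omega>)"
      unfolding \<zeta>2 using sq[OF i] cov[OF i] by (auto simp: has_bochner_integral_iff)
    have "expectation (\<lambda>\<omega>. \<zeta> i \<omega> * \<zeta> i \<omega>) =
      expectation (\<lambda>\<omega>. (increment T n W \<omega> i $ r * increment T n W \<omega> i $ u)\<^sup>2) - ?d\<^sup>2"
      unfolding \<zeta>2 using sq[OF i] cov[OF i]
      by (auto simp: has_bochner_integral_iff prob_space power2_eq_square)
    then show "expectation (\<lambda>\<omega>. \<zeta> i \<omega> * \<zeta> i \<omega>) \<le> 3 * ?h\<^sup>2"
      using sq(2)[OF i] by (smt (verit) zero_le_power2)
  qed
  have all: "integrable P (\<lambda>\<omega>. \<zeta> i \<omega> * \<zeta> j \<omega>)" "i \<noteq> j \<Longrightarrow> expectation (\<lambda>\<omega>. \<zeta> i \<omega> * \<zeta> j \<omega>) = 0"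
    if "i \<in> {1..n}" "j \<in> {1..n}" for i j
    using cross[of i j] cross[of j i] diag(1)[of i] that by (cases i j rule: linorder_cases; simp add: mult.commute)+
  show "integrable P (\<lambda>\<omega>. (\<Sum>i\<in>{1..n}. \<zeta> i \<omega>)\<^sup>2)"
    by (rule expectation_orthogonal_sum(1)[OF all(1) all(2) diag(2)]) auto
  have "expectation (\<lambda>\<omega>. (\<Sum>i\<in>{1..n}. \<zeta> i \<omega>)\<^sup>2) \<le> real (card {1..n}) * (3 * ?h\<^sup>2)"
    by (rule expectation_orthogonal_sum(2)[OF all(1) all(2) diag(2)]) auto
  then show "expectation (\<lambda>\<omega>. (\<Sum>i\<in>{1..n}. \<zeta> i \<omega>)\<^sup>2) \<le> real n * (3 * ?h\<^sup>2)" by simp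
qed

lemma process_eventsI:
  fixes W :: "real \<Rightarrow> 'w \<Rightarrow> real ^ 'r::finite"
  assumes "f \<in> borel_measurable (sigma (space P) {W t -` A \<inter> space P | t A. 0 \<le> t \<and> A \<in> sets borel})"
    "S \<in> sets borel"
  shows "f -` S \<inter> space P \<in> process_events P W"
proof -
  let ?G = "{W t -` A \<inter> space P | t A. 0 \<le> t \<and> A \<in> sets borel}"
  have "?G \<subseteq> Pow (space P)" by auto
  then show ?thesis
    using measurable_sets[OF assms] by (simp add: process_events_def sets_measure_of space_measure_of)
qed

text \<open>Once the four factors are regrouped by process, independence of the two whole processes
  factorizes the expectation, and each factor vanishes unless \<open>i = j\<close>. The diagonal
  value is exactly \<open>(T / n)^2\<close>; the constant 3 is there to match
  \<open>wiener_quadratic_variation\<close>.\<close>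

lemma wiener_cross_variation:
  fixes W :: "real \<Rightarrow> 'w \<Rightarrow> real ^ 'r::finite" and W' :: "real \<Rightarrow> 'w \<Rightarrow> real ^ 's::finite"
    and r :: 'r and u :: 's
  assumes basis: "stochastic_basis P F" and W: "wiener_process P F W" and W': "wiener_process P F W'"
    and ind: "prob_space.indep_set P (process_events P W) (process_events P W')"
    and T: "0 < T" and n: "1 \<le> n"
  defines "\<zeta> \<equiv> \<lambda>i \<omega>. increment T n W \<omega> i $ r * increment T n W' \<omega> i $ u"
  shows "integrable P (\<lambda>\<omega>. (\<Sum>i\<in>{1..n}. \<zeta> i \<omega>)\<^sup>2)"
    and "(\<integral>\<omega>. (\<Sum>i\<in>{1..n}. \<zeta> i \<omega>)\<^sup>2 \<partial>P) \<le> real n * (3 * (T / real n)\<^sup>2)"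
proof -
  interpret prob_space P using basis by (rule stochastic_basis_prob_space)
  let ?h = "T / real n"
  note g = grid[OF T n]
  have one: "integrable P (\<lambda>\<omega>. increment T n V \<omega> i $ k * increment T n V \<omega> j $ k)"
      "expectation (\<lambda>\<omega>. increment T n V \<omega> i $ k * increment T n V \<omega> j $ k) = (if i = j then ?h else 0)"
    if V: "wiener_process P F V" and ij: "i \<in> {1..n}" "j \<in> {1..n}"
    for V :: "real \<Rightarrow> 'w \<Rightarrow> real ^ 'q::finite" and k i j
  proof -
    let ?f = "\<lambda>x::real^'q. x $ k"
    have f: "?f \<in> borel_measurable borel" by measurable
    have "0 < ?h" using T n by simp
    then have nm: "normal_moment (sqrt ?h) (Suc 0) = 0"
      using normal_moment_values(2)[of "sqrt ?h"] by simp
    have i0: "integrable P (\<lambda>\<omega>. (V (real i * ?h) \<omega> - V ((real i - 1) * ?h) \<omega>) $ k)"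
      "expectation (\<lambda>\<omega>. (V (real i * ?h) \<omega> - V ((real i - 1) * ?h) \<omega>) $ k) = 0" if "i \<in> {1..n}" for i
      using wiener_moment_single[OF V g(1,2)[OF that], of k 1, unfolded g(3)[OF that]]
      unfolding has_bochner_integral_iff by (simp_all add: nm)
    have lt: "integrable P (\<lambda>\<omega>. increment T n V \<omega> i $ k * increment T n V \<omega> j $ k) \<and>
      expectation (\<lambda>\<omega>. increment T n V \<omega> i $ k * increment T n V \<omega> j $ k) = 0"
      if ij: "i \<in> {1..n}" "j \<in> {1..n}" "i < j" for i j
      using wiener_independent_increments[OF basis V g(1,2)[OF ij(1)] g(6)[OF ij] g(2)[OF ij(2)] f f
          i0(1)[OF ij(1)] i0(1)[OF ij(2)]] i0(2)[OF ij(1)]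
      by (simp add: increment_def)
    have eq: "has_bochner_integral P (\<lambda>\<omega>. increment T n V \<omega> i $ k * increment T n V \<omega> i $ k) ?h"
      if "i \<in> {1..n}" for i
      using wiener_covariance[OF V g(1,2)[OF that], of k k] unfolding increment_def g(3)[OF that] by simp
    show "integrable P (\<lambda>\<omega>. increment T n V \<omega> i $ k * increment T n V \<omega> j $ k)"
      "expectation (\<lambda>\<omega>. increment T n V \<omega> i $ k * increment T n V \<omega> j $ k) = (if i = j then ?h else 0)"
      using lt[of i j] lt[of j i] eq[of i] ij
      by (cases i j rule: linorder_cases; simp add: mult.commute has_bochner_integral_iff)+
  qed
  have meas: "(\<lambda>\<omega>. increment T n V \<omega> i $ k * increment T n V \<omega> j $ k) -` S \<inter> space P \<in> process_events P V"
    if S: "S \<in> sets borel" and ij: "i \<in> {1..n}" "j \<in> {1..n}"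
    for V :: "real \<Rightarrow> 'w \<Rightarrow> real ^ 'q::finite" and k i j S
  proof (rule process_eventsI[OF _ S])
    let ?N = "sigma (space P) {V t -` A \<inter> space P | t A. 0 \<le> t \<and> A \<in> sets borel}"
    have V: "V t \<in> borel_measurable ?N" if "0 \<le> t" for t
      by (rule measurableI) (use that in \<open>auto simp: space_measure_of_conv intro!: in_measure_of\<close>)
    have Vk: "(\<lambda>\<omega>. V t \<omega> $ k) \<in> borel_measurable ?N" if "0 \<le> t" for t
      by (rule measurable_compose[OF V[OF that]]) simp
    show "(\<lambda>\<omega>. increment T n V \<omega> i $ k * increment T n V \<omega> j $ k) \<in> borel_measurable ?N"
      unfolding increment_def vector_minus_component
      by (intro borel_measurable_times borel_measurable_diff Vk g(1,5)[OF ij(1)] g(1,5)[OF ij(2)])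
  qed
  have eq: "\<zeta> i \<omega> * \<zeta> j \<omega> = (increment T n W \<omega> i $ r * increment T n W \<omega> j $ r) *
      (increment T n W' \<omega> i $ u * increment T n W' \<omega> j $ u)" for i j \<omega>
    by (simp add: \<zeta>_def mult_ac)
  note E = indep_set_expectation[OF ind meas one(1)[OF W] meas one(1)[OF W']]
  have int: "integrable P (\<lambda>\<omega>. \<zeta> i \<omega> * \<zeta> j \<omega>)" if "i \<in> {1..n}" "j \<in> {1..n}" for i j
    unfolding eq using that by (intro E(1)) auto
  have val: "expectation (\<lambda>\<omega>. \<zeta> i \<omega> * \<zeta> j \<omega>) = (if i = j then ?h\<^sup>2 else 0)"
    if "i \<in> {1..n}" "j \<in> {1..n}" for i j
    unfolding eq using that one(2)[OF W that, of r] one(2)[OF W' that, of u]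
    by (subst E(2)) (auto simp: power2_eq_square)
  show "integrable P (\<lambda>\<omega>. (\<Sum>i\<in>{1..n}. \<zeta> i \<omega>)\<^sup>2)"
    by (rule expectation_orthogonal_sum(1)[OF int, where c = "3 * ?h\<^sup>2"]) (auto simp: val)
  have "expectation (\<lambda>\<omega>. (\<Sum>i\<in>{1..n}. \<zeta> i \<omega>)\<^sup>2) \<le> real (card {1..n}) * (3 * ?h\<^sup>2)"
    by (rule expectation_orthogonal_sum(2)[OF int]) (auto simp: val)
  then show "expectation (\<lambda>\<omega>. (\<Sum>i\<in>{1..n}. \<zeta> i \<omega>)\<^sup>2) \<le> real n * (3 * ?h\<^sup>2)" by simp
qed

section \<open>The covariance structure of the model\<close>

lemma sum_UNIV_Plus:
  "(\<Sum>a\<in>(UNIV :: ('a::finite + 'b::finite) set). f a) = (\<Sum>i\<in>UNIV. f (Inl i)) + (\<Sum>j\<in>UNIV. f (Inr j))"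
  by (subst UNIV_Plus_UNIV[symmetric], subst sum.Plus) auto

text \<open>Coefficient of the \<open>u\<close>-th of all components of the four Wiener processes in the \<open>a\<close>-th
  observed component.\<close>

definition loading ::
  "('k1::finite, 'k2::finite, 'p1::finite, 'p2::finite, 'r1::finite, 'r2::finite, 'r3::finite, 'r4::finite) sem
   \<Rightarrow> 'r1 + ('r2 + ('r3 + 'r4)) \<Rightarrow> 'p1 + 'p2 \<Rightarrow> real" where
  "loading s u a = (case u of
     Inl r \<Rightarrow> (case a of Inl i \<Rightarrow> (Lambda1 s ** S1 s) $ i $ r
       | Inr j \<Rightarrow> (Lambda2 s ** matrix_inv (Psi s) ** Gam s ** S1 s) $ j $ r)
   | Inr (Inl r) \<Rightarrow> (case a of Inl i \<Rightarrow> S2 s $ i $ r | Inr j \<Rightarrow> 0)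
   | Inr (Inr (Inl r)) \<Rightarrow> (case a of Inl i \<Rightarrow> 0 | Inr j \<Rightarrow> S3 s $ j $ r)
   | Inr (Inr (Inr r)) \<Rightarrow> (case a of Inl i \<Rightarrow> 0 | Inr j \<Rightarrow> (Lambda2 s ** matrix_inv (Psi s) ** S4 s) $ j $ r))"

lemma transpose_entry: "transpose A $ i $ j = A $ j $ i"
  by (simp add: transpose_def)

lemma matrix_mult_transpose_entry:
  fixes A :: "real ^ 'n::finite ^ 'm::finite" and B :: "real ^ 'n ^ 'l::finite"
  shows "(A ** transpose B) $ i $ j = (\<Sum>r\<in>UNIV. A $ i $ r * B $ j $ r)"
  by (simp add: matrix_matrix_mult_def transpose_def)

lemma matrix_add_rdistrib:
  fixes A B :: "real ^ 'n::finite ^ 'm::finite" and C :: "real ^ 'l::finite ^ 'n"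
  shows "(A + B) ** C = A ** C + B ** C"
  by (simp add: matrix_matrix_mult_def Finite_Cartesian_Product.vec_eq_iff distrib_right sum.distrib)

lemma gram_entry: "gram A $ i $ j = (\<Sum>r\<in>UNIV. A $ i $ r * A $ j $ r)"
  unfolding gram_def by (rule matrix_mult_transpose_entry)

text \<open>Each block is a sum of products of coefficient matrices with transposed ones, so
  \<open>sem_Sigma\<close> is the Gram matrix of the loadings: the covariance per unit of time of
  the noise in the observations.\<close>

lemma sem_Sigma_eq_loading:
  "sem_Sigma s $ a $ b = (\<Sum>u\<in>UNIV. loading s u a * loading s u b)"
proof -
  let ?P = "Lambda1 s ** S1 s" and ?R = "Lambda2 s ** matrix_inv (Psi s) ** Gam s ** S1 s"
    and ?R4 = "Lambda2 s ** matrix_inv (Psi s) ** S4 s"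
  have 11: "Sigma11 s = ?P ** transpose ?P + gram (S2 s)"
    by (simp add: Sigma11_def gram_def matrix_transpose_mul matrix_mul_assoc)
  have 12: "Sigma12 s = ?P ** transpose ?R"
    by (simp add: Sigma12_def gram_def matrix_transpose_mul matrix_mul_assoc)
  have 22: "Sigma22 s = ?R ** transpose ?R + ?R4 ** transpose ?R4 + gram (S3 s)"
    by (simp add: Sigma22_def gram_def matrix_transpose_mul matrix_mul_assoc
        matrix_add_ldistrib matrix_add_rdistrib)
  show ?thesis
    unfolding sem_Sigma_def 11 12 22
    by (cases a; cases b) (simp_all add: loading_def sum_UNIV_Plus matrix_mult_transpose_entry gram_entry
      transpose_entry mult.commute)
qed

lemma pos_def_gram_imp_eq_0:
  fixes A :: "real ^ 'r::finite ^ 'n::finite"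
  assumes "pos_def (gram A)" "\<And>r. (\<Sum>i\<in>UNIV. A $ i $ r * x $ i) = 0"
  shows "x = 0"
proof (rule ccontr)
  assume "x \<noteq> 0"
  have "transpose A *v x = 0"
    using assms(2) by (simp add: Finite_Cartesian_Product.vec_eq_iff matrix_vector_mult_def transpose_def)
  then have "gram A *v x = 0"
    by (simp add: gram_def matrix_vector_mul_assoc[symmetric])
  then show False using assms(1) \<open>x \<noteq> 0\<close> by (auto simp: pos_def_def)
qed

text \<open>The quadratic form is a sum of squares over all noise sources. If it vanishes, the
  sources of the two measurement errors alone force both blocks of \<open>x\<close> to be 0, as
  their covariances are positive definite.\<close>

lemma pos_def_sem_Sigma:
  assumes "regular_sem s"
  shows "pos_def (sem_Sigma s)"
  unfolding pos_def_def
proof (intro allI impI)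
  fix x :: "real ^ ('c + 'd)" assume "x \<noteq> 0"
  define y where "y u = (\<Sum>a\<in>UNIV. loading s u a * x $ a)" for u
  have "inner x (sem_Sigma s *v x) = (\<Sum>a\<in>UNIV. \<Sum>b\<in>UNIV. \<Sum>u\<in>UNIV. (loading s u a * x $ a) * (loading s u b * x $ b))"
    by (simp add: inner_vec_def matrix_vector_mult_def sem_Sigma_eq_loading sum_distrib_left sum_distrib_right mult_ac)
  also have "\<dots> = (\<Sum>u\<in>UNIV. \<Sum>a\<in>UNIV. \<Sum>b\<in>UNIV. (loading s u a * x $ a) * (loading s u b * x $ b))"
    by (subst (2) sum.swap, subst sum.swap) simp
  also have "\<dots> = (\<Sum>u\<in>UNIV. y u * y u)"
    by (simp add: y_def sum_product)
  finally have eq: "inner x (sem_Sigma s *v x) = (\<Sum>u\<in>UNIV. y u * y u)" .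
  have "\<exists>u. y u \<noteq> 0"
  proof (rule ccontr)
    assume "\<not> (\<exists>u. y u \<noteq> 0)"
    then have y0: "y u = 0" for u by simp
    have "(\<Sum>i\<in>UNIV. S2 s $ i $ r * (\<chi> i. x $ Inl i) $ i) = 0" for r
      using y0[of "Inr (Inl r)"] by (simp add: y_def loading_def sum_UNIV_Plus)
    then have "(\<chi> i. x $ Inl i) = 0"
      using assms by (intro pos_def_gram_imp_eq_0) (auto simp: regular_sem_def)
    moreover have "(\<Sum>i\<in>UNIV. S3 s $ i $ r * (\<chi> i. x $ Inr i) $ i) = 0" for r
      using y0[of "Inr (Inr (Inl r))"] by (simp add: y_def loading_def sum_UNIV_Plus)
    then have "(\<chi> i. x $ Inr i) = 0"
      using assms by (intro pos_def_gram_imp_eq_0) (auto simp: regular_sem_def)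
    ultimately have "x $ a = 0" for a
      by (cases a) (auto simp: Finite_Cartesian_Product.vec_eq_iff)
    then show False using \<open>x \<noteq> 0\<close> by (simp add: Finite_Cartesian_Product.vec_eq_iff)
  qed
  then obtain u where "y u \<noteq> 0" by blast
  then have "0 < (\<Sum>u\<in>UNIV. y u * y u)"
    by (intro sum_pos2[of _ u]) (auto simp: zero_less_mult_iff)
  then show "0 < inner x (sem_Sigma s *v x)" by (simp add: eq)
qed

lemma det_sem_Sigma_pos: "regular_sem s \<Longrightarrow> 0 < det (sem_Sigma s)"
  by (intro pos_def_imp_det_pos pos_def_sem_Sigma)

section \<open>The drift part of the increments\<close>

text \<open>\<open>f s t\<close> stands for the contribution of the interval from \<open>s\<close>
  to \<open>t\<close> along one fixed path; the constant may depend on the path.\<close>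

definition drift_bound :: "real \<Rightarrow> (real \<Rightarrow> real \<Rightarrow> 'a::real_normed_vector) \<Rightarrow> bool" where
  "drift_bound T f \<longleftrightarrow> (\<exists>C\<ge>0. \<forall>s t. 0 \<le> s \<and> s \<le> t \<and> t \<le> T \<longrightarrow> norm (f s t) \<le> C * (t - s))"

lemma drift_bound_add: "drift_bound T f \<Longrightarrow> drift_bound T g \<Longrightarrow> drift_bound T (\<lambda>s t. f s t + g s t)"
  unfolding drift_bound_def
proof (elim exE conjE)
  fix C D assume "0 \<le> C" "0 \<le> D"
    and "\<forall>s t. 0 \<le> s \<and> s \<le> t \<and> t \<le> T \<longrightarrow> norm (f s t) \<le> C * (t - s)"
    and "\<forall>s t. 0 \<le> s \<and> s \<le> t \<and> t \<le> T \<longrightarrow> norm (g s t) \<le> D * (t - s)"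
  then show "\<exists>C\<ge>0. \<forall>s t. 0 \<le> s \<and> s \<le> t \<and> t \<le> T \<longrightarrow> norm (f s t + g s t) \<le> C * (t - s)"
    by (intro exI[of _ "C + D"]) (auto simp: distrib_right intro!: norm_triangle_mono)
qed

lemma drift_bound_linear:
  assumes "bounded_linear h" "drift_bound T f"
  shows "drift_bound T (\<lambda>s t. h (f s t))"
proof -
  obtain K where K: "0 \<le> K" "\<And>x. norm (h x) \<le> norm x * K"
    using bounded_linear.nonneg_bounded[OF assms(1)] by blast
  obtain C where C: "0 \<le> C" "\<And>s t. 0 \<le> s \<and> s \<le> t \<and> t \<le> T \<Longrightarrow> norm (f s t) \<le> C * (t - s)"
    using assms(2) by (auto simp: drift_bound_def)
  have "norm (h (f s t)) \<le> (C * K) * (t - s)" if "0 \<le> s \<and> s \<le> t \<and> t \<le> T" for s t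
    using order_trans[OF K(2) mult_right_mono[OF C(2)[OF that] K(1)]] by (simp add: mult_ac)
  then show ?thesis unfolding drift_bound_def using C K by (intro exI[of _ "C * K"]) auto
qed

text \<open>Without its noise the increment is the integral of \<open>B\<close> along the path, and
  a continuous integrand is bounded on \<open>[0, T]\<close>.\<close>

lemma diffusion_drift_bound:
  fixes W :: "real \<Rightarrow> 'w \<Rightarrow> real ^ 'r::finite" and Z :: "real \<Rightarrow> 'w \<Rightarrow> real ^ 'k::finite"
  assumes Z: "diffusion_solution P F W B S c Z" and B: "continuous_on UNIV B"
  shows "AE \<omega> in P. drift_bound T (\<lambda>s t. Z t \<omega> - Z s \<omega> - S *v (W t \<omega> - W s \<omega>))"
proof -
  have "AE \<omega> in P. continuous_on {0..} (\<lambda>t. Z t \<omega>)"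
    "AE \<omega> in P. \<forall>t\<ge>0. ((\<lambda>s. B (Z s \<omega>)) has_integral (Z t \<omega> - c - S *v W t \<omega>)) {0..t}"
    using Z by (auto simp: diffusion_solution_def)
  then show ?thesis
  proof eventually_elim
    case (elim \<omega>)
    let ?f = "\<lambda>r. B (Z r \<omega>)"
    have cont: "continuous_on {0..T} ?f"
      by (rule continuous_on_compose2[OF B]) (auto intro: continuous_on_subset[OF elim(1)])
    then have "bounded (?f ` {0..T})" by (intro compact_imp_bounded compact_continuous_image) auto
    then obtain C where C: "\<And>r. r \<in> {0..T} \<Longrightarrow> norm (?f r) \<le> C" by (force simp: bounded_iff)
    have "norm (Z t \<omega> - Z s \<omega> - S *v (W t \<omega> - W s \<omega>)) \<le> \<bar>C\<bar> * (t - s)"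
      if st: "0 \<le> s" "s \<le> t" "t \<le> T" for s t
    proof -
      have it: "integral {0..r} ?f = Z r \<omega> - c - S *v W r \<omega>" "?f integrable_on {0..r}" if "0 \<le> r" for r
        using elim(2) that by (auto simp: integral_unique has_integral_integrable)
      have "integral {0..s} ?f + integral {s..t} ?f = integral {0..t} ?f"
        using st it by (intro Henstock_Kurzweil_Integration.integral_combine) auto
      then have "Z t \<omega> - Z s \<omega> - S *v (W t \<omega> - W s \<omega>) = integral {s..t} ?f"
        using it st by (simp add: matrix_vector_mult_diff_distrib algebra_simps)
      moreover have "norm (integral {s..t} ?f) \<le> \<bar>C\<bar> * (t - s)"
        using st C by (intro integral_bound continuous_on_subset[OF cont] order_trans[OF C abs_ge_self]) auto
      ultimately show ?thesis by simp
    qed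
    then show ?case unfolding drift_bound_def by (intro exI[of _ "\<bar>C\<bar>"]) auto
  qed
qed

section \<open>Convergence of the realized covariance\<close>

definition noise ::
  "(real \<Rightarrow> 'w \<Rightarrow> real ^ 'r1::finite) \<Rightarrow> (real \<Rightarrow> 'w \<Rightarrow> real ^ 'r2::finite) \<Rightarrow>
   (real \<Rightarrow> 'w \<Rightarrow> real ^ 'r3::finite) \<Rightarrow> (real \<Rightarrow> 'w \<Rightarrow> real ^ 'r4::finite) \<Rightarrow>
   real \<Rightarrow> nat \<Rightarrow> 'w \<Rightarrow> nat \<Rightarrow> 'r1 + ('r2 + ('r3 + 'r4)) \<Rightarrow> real" where
  "noise W1 W2 W3 W4 T n \<omega> i u = (case u of
     Inl r \<Rightarrow> increment T n W1 \<omega> i $ r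
   | Inr (Inl r) \<Rightarrow> increment T n W2 \<omega> i $ r
   | Inr (Inr (Inl r)) \<Rightarrow> increment T n W3 \<omega> i $ r
   | Inr (Inr (Inr r)) \<Rightarrow> increment T n W4 \<omega> i $ r)"

lemma sum4_cases:
  obtains r where "u = Inl r" | r where "u = Inr (Inl r)" | r where "u = Inr (Inr (Inl r))"
    | r where "u = Inr (Inr (Inr r))"
  by (metis sum.exhaust)

lemma (in prob_space) indep_sets_pair:
  assumes "indep_sets E I" "i \<in> I" "j \<in> I" "i \<noteq> j"
  shows "indep_set (E i) (E j)"
proof (rule indep_setI)
  show "E i \<subseteq> events" "E j \<subseteq> events" using assms by (auto simp: indep_sets_def)
  fix a b assume "a \<in> E i" "b \<in> E j"
  then show "prob (a \<inter> b) = prob a * prob b"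
    using indep_setsD[OF assms(1), of "{i, j}" "\<lambda>k. if k = i then a else b"] assms
    by (simp add: Int_commute)
qed

text \<open>Of the sixteen pairs of processes the four diagonal ones are quadratic variations, the
  others pair independent processes. The common bound permits a single statement.\<close>

lemma noise_variation:
  assumes basis: "stochastic_basis P F"
    and W: "wiener_process P F W1" "wiener_process P F W2" "wiener_process P F W3" "wiener_process P F W4"
    and ind: "prob_space.indep_sets P
      (\<lambda>i. [process_events P W1, process_events P W2, process_events P W3, process_events P W4] ! i) {..<4}"
    and T: "0 < T" and n: "1 \<le> n"
  shows "integrable P (\<lambda>\<omega>. (\<Sum>i=1..n. noise W1 W2 W3 W4 T n \<omega> i u * noise W1 W2 W3 W4 T n \<omega> i v
      - (if u = v then T / real n else 0))\<^sup>2) \<and>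
    (\<integral>\<omega>. (\<Sum>i=1..n. noise W1 W2 W3 W4 T n \<omega> i u * noise W1 W2 W3 W4 T n \<omega> i v
      - (if u = v then T / real n else 0))\<^sup>2 \<partial>P) \<le> real n * (3 * (T / real n)\<^sup>2)"
proof -
  interpret prob_space P using basis by (rule stochastic_basis_prob_space)
  note pair = indep_sets_pair[OF ind]
  have i: "indep_set (process_events P W1) (process_events P W2)"
    "indep_set (process_events P W1) (process_events P W3)"
    "indep_set (process_events P W1) (process_events P W4)"
    "indep_set (process_events P W2) (process_events P W1)"
    "indep_set (process_events P W2) (process_events P W3)"
    "indep_set (process_events P W2) (process_events P W4)"
    "indep_set (process_events P W3) (process_events P W1)"
    "indep_set (process_events P W3) (process_events P W2)"
    "indep_set (process_events P W3) (process_events P W4)"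
    "indep_set (process_events P W4) (process_events P W1)"
    "indep_set (process_events P W4) (process_events P W2)"
    "indep_set (process_events P W4) (process_events P W3)"
    using pair[of 0 1] pair[of 0 2] pair[of 0 3] pair[of 1 0] pair[of 1 2] pair[of 1 3]
      pair[of 2 0] pair[of 2 1] pair[of 2 3] pair[of 3 0] pair[of 3 1] pair[of 3 2]
    by (simp_all add: numeral_eq_Suc)
  note cross = wiener_cross_variation[OF basis _ _ _ T n]
  note c = conjI[OF wiener_quadratic_variation(1,2)[OF basis W(1) T n]]
    conjI[OF wiener_quadratic_variation(1,2)[OF basis W(2) T n]]
    conjI[OF wiener_quadratic_variation(1,2)[OF basis W(3) T n]]
    conjI[OF wiener_quadratic_variation(1,2)[OF basis W(4) T n]]
    conjI[OF cross(1,2)[OF W(1,2) i(1)]]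
    conjI[OF cross(1,2)[OF W(1,3) i(2)]]
    conjI[OF cross(1,2)[OF W(1,4) i(3)]]
    conjI[OF cross(1,2)[OF W(2,1) i(4)]]
    conjI[OF cross(1,2)[OF W(2,3) i(5)]]
    conjI[OF cross(1,2)[OF W(2,4) i(6)]]
    conjI[OF cross(1,2)[OF W(3,1) i(7)]]
    conjI[OF cross(1,2)[OF W(3,2) i(8)]]
    conjI[OF cross(1,2)[OF W(3,4) i(9)]]
    conjI[OF cross(1,2)[OF W(4,1) i(10)]]
    conjI[OF cross(1,2)[OF W(4,2) i(11)]]
    conjI[OF cross(1,2)[OF W(4,3) i(12)]]
  show ?thesis
    by (cases u rule: sum4_cases; cases v rule: sum4_cases) (simp_all add: noise_def c
      del: One_nat_def split del: if_split)
qed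

text \<open>Rate \<open>sqrt (n / ln n)\<close>, slightly slower than the true rate \<open>sqrt n\<close>: the logarithm absorbs all
  constants, so that convergence in probability to 0 replaces tightness.\<close>

definition rate :: "nat \<Rightarrow> real" where "rate n = sqrt (real n / ln (real n))"

lemma rate_nonneg: "0 \<le> rate n" by (cases "n = 0") (auto simp: rate_def)

lemma rate_sq: "(rate n)\<^sup>2 = real n / ln (real n)"
  by (cases "n = 0") (auto simp: rate_def)

lemma filterlim_rate: "filterlim rate at_top sequentially"
  unfolding rate_def by real_asymp

lemma tendsto_square_0D: "((\<lambda>x. (f x :: real)\<^sup>2) \<longlongrightarrow> 0) F \<Longrightarrow> (f \<longlongrightarrow> 0) F"
  using tendsto_real_sqrt[of "\<lambda>x. (f x)\<^sup>2" 0 F] by (simp add: tendsto_rabs_zero_iff)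

text \<open>Cauchy-Schwarz with the whole squared weight put on \<open>g\<close>; the unweighted sum
  of squares of \<open>f\<close> only has to converge.\<close>

lemma tendsto_square_product_sum_0:
  fixes f g :: "'x \<Rightarrow> nat \<Rightarrow> real"
  assumes "((\<lambda>x. \<Sum>i=1..n x. (f x i)\<^sup>2) \<longlongrightarrow> l) F" "((\<lambda>x. (r x)\<^sup>2 * (\<Sum>i=1..n x. (g x i)\<^sup>2)) \<longlongrightarrow> 0) F"
  shows "((\<lambda>x. r x * (\<Sum>i=1..n x. f x i * g x i)) \<longlongrightarrow> 0) F"
proof (rule tendsto_square_0D, rule tendsto_sandwich[OF _ _ tendsto_const])
  show "\<forall>\<^sub>F x in F. 0 \<le> (r x * (\<Sum>i=1..n x. f x i * g x i))\<^sup>2" by simp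
  have "(r x * (\<Sum>i=1..n x. f x i * g x i))\<^sup>2 \<le>
      (\<Sum>i=1..n x. (f x i)\<^sup>2) * ((r x)\<^sup>2 * (\<Sum>i=1..n x. (g x i)\<^sup>2))" for x
    using mult_left_mono[OF Cauchy_Schwarz_ineq_sum[of "f x" "g x" "{1..n x}"], of "(r x)\<^sup>2"]
    by (simp add: power_mult_distrib mult_ac)
  then show "\<forall>\<^sub>F x in F. (r x * (\<Sum>i=1..n x. f x i * g x i))\<^sup>2 \<le>
      (\<Sum>i=1..n x. (f x i)\<^sup>2) * ((r x)\<^sup>2 * (\<Sum>i=1..n x. (g x i)\<^sup>2))" by simp
  show "((\<lambda>x. (\<Sum>i=1..n x. (f x i)\<^sup>2) * ((r x)\<^sup>2 * (\<Sum>i=1..n x. (g x i)\<^sup>2))) \<longlongrightarrow> 0) F"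
    using tendsto_mult[OF assms] by simp
qed

lemma (in prob_space) tendsto_whp_divide_rate:
  assumes "((\<lambda>x. rate (fst x) * f x) \<longlongrightarrow> l) (whp M)"
  shows "(f \<longlongrightarrow> 0) (whp M)"
proof -
  have "((\<lambda>x. inverse (rate (fst x))) \<longlongrightarrow> 0) (whp M)"
    by (rule tendsto_inverse_0_at_top[OF filterlim_compose[OF filterlim_rate filterlim_fst_whp]])
  from tendsto_mult[OF this assms]
  have "((\<lambda>x. inverse (rate (fst x)) * (rate (fst x) * f x)) \<longlongrightarrow> 0) (whp M)" by simp
  moreover have "\<forall>\<^sub>F n in sequentially. 0 < rate n"
    using filterlim_rate by (simp add: filterlim_at_top_dense)
  from eventually_whp_sequentially[OF this]
  have "\<forall>\<^sub>F x in whp M. inverse (rate (fst x)) * (rate (fst x) * f x) = f x"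
    by (rule eventually_mono) simp
  ultimately show ?thesis by (rule Lim_transform_eventually)
qed

text \<open>The second moment is at most \<open>3 * T^2 / n\<close>; multiplied by the square of
  \<open>rate n / T\<close> it becomes \<open>3 / ln n\<close>. This is where the logarithm in
  \<open>rate\<close> is spent.\<close>

lemma noise_covariation_whp:
  fixes W1 :: "real \<Rightarrow> 'w \<Rightarrow> real ^ 'r1::finite" and W2 :: "real \<Rightarrow> 'w \<Rightarrow> real ^ 'r2::finite"
    and W3 :: "real \<Rightarrow> 'w \<Rightarrow> real ^ 'r3::finite" and W4 :: "real \<Rightarrow> 'w \<Rightarrow> real ^ 'r4::finite"
  assumes basis: "stochastic_basis P F"
    and W: "wiener_process P F W1" "wiener_process P F W2" "wiener_process P F W3" "wiener_process P F W4"
    and ind: "prob_space.indep_sets P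
      (\<lambda>i. [process_events P W1, process_events P W2, process_events P W3, process_events P W4] ! i) {..<4}"
    and T: "0 < T"
  defines "V \<equiv> noise W1 W2 W3 W4 T"
  shows "((\<lambda>x. rate (fst x) * ((1 / T) * (\<Sum>i=1..fst x. V (fst x) (snd x) i u * V (fst x) (snd x) i v)
    - (if u = v then 1 else 0))) \<longlongrightarrow> 0) (whp P)"
proof -
  interpret prob_space P using basis by (rule stochastic_basis_prob_space)
  let ?S = "\<lambda>n \<omega>. (\<Sum>i=1..n. V n \<omega> i u * V n \<omega> i v - (if u = v then T / real n else 0))"
  note nv = noise_variation[OF basis W ind T, of _ u v, folded V_def]
  define f where "f n \<omega> = (rate n)\<^sup>2 / T\<^sup>2 * (?S n \<omega>)\<^sup>2" for n \<omega>
  have lim: "((\<lambda>x. f (fst x) (snd x)) \<longlongrightarrow> 0) (whp P)"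
  proof (rule tendsto_whp_0_expectation)
    show "integrable P (f n)" for n
      using nv[of n] by (cases "n = 0") (auto simp: f_def[abs_def] rate_def simp del: One_nat_def)
    show "0 \<le> f n \<omega>" for n \<omega> by (simp add: f_def)
    show "(\<lambda>n. expectation (f n)) \<longlonglongrightarrow> 0"
    proof (rule tendsto_sandwich[OF _ _ tendsto_const])
      show "\<forall>\<^sub>F n in sequentially. 0 \<le> expectation (f n)"
        by (simp add: f_def)
      have "expectation (f n) \<le> 3 / ln (real n)" if "2 \<le> n" for n
      proof -
        have "expectation (f n) = (rate n)\<^sup>2 / T\<^sup>2 * expectation (\<lambda>\<omega>. (?S n \<omega>)\<^sup>2)"
          unfolding f_def[abs_def] by (rule integral_mult_right_zero)
        also have "\<dots> \<le> (rate n)\<^sup>2 / T\<^sup>2 * (real n * (3 * (T / real n)\<^sup>2))"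
          using nv[of n] that by (intro mult_left_mono) auto
        also have "\<dots> = (real n / ln (real n)) / T\<^sup>2 * (real n * (3 * (T / real n)\<^sup>2))"
          by (simp add: rate_sq)
        also have "\<dots> = 3 / ln (real n)"
          using T that by (simp add: power2_eq_square)
        finally show ?thesis .
      qed
      then show "\<forall>\<^sub>F n in sequentially. expectation (f n) \<le> 3 / ln (real n)"
        unfolding eventually_sequentially by blast
      show "(\<lambda>n. 3 / ln (real n)) \<longlonglongrightarrow> 0" by real_asymp
    qed
  qed
  have eq: "f n \<omega> = (rate n * ((1 / T) * (\<Sum>i=1..n. V n \<omega> i u * V n \<omega> i v) - (if u = v then 1 else 0)))\<^sup>2" for n \<omega>
  proof (cases "n = 0")
    case False
    then have "?S n \<omega> = T * ((1 / T) * (\<Sum>i=1..n. V n \<omega> i u * V n \<omega> i v) - (if u = v then 1 else 0))"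
      using T by (auto simp: sum_subtractf right_diff_distrib)
    then show ?thesis using T by (simp add: f_def power_mult_distrib)
  qed (simp add: f_def rate_def)
  show ?thesis by (rule tendsto_square_0D) (rule lim[unfolded eq])
qed

text \<open>The products split into three kinds. Noise with noise is bilinear in the covariations of
  \<open>V\<close>; the terms with a drift factor follow from Cauchy-Schwarz, because the squared
  drift terms add up to order \<open>1 / n\<close>.\<close>

lemma realized_covariance_whp:
  fixes V :: "nat \<Rightarrow> 'w \<Rightarrow> nat \<Rightarrow> 'u::finite \<Rightarrow> real" and L :: "'u \<Rightarrow> 'a \<Rightarrow> real"
  assumes P: "prob_space P" and T: "0 < T"
    and V: "\<And>u v. ((\<lambda>x. rate (fst x) * ((1 / T) * (\<Sum>i=1..fst x. V (fst x) (snd x) i u * V (fst x) (snd x) i v)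
      - (if u = v then 1 else 0))) \<longlongrightarrow> 0) (whp P)"
    and meas: "\<And>n i a. i \<in> {1..n} \<Longrightarrow> (\<lambda>\<omega>. D n \<omega> i a) \<in> borel_measurable P"
    and drift: "\<And>a. AE \<omega> in P. \<exists>C. \<forall>n. \<forall>i\<in>{1..n}. \<bar>D n \<omega> i a\<bar> \<le> C * (T / real n)"
  defines "Y \<equiv> \<lambda>n \<omega> i a. (\<Sum>u\<in>UNIV. L u a * V n \<omega> i u) + D n \<omega> i a"
  shows "((\<lambda>x. rate (fst x) * ((1 / T) * (\<Sum>i=1..fst x. Y (fst x) (snd x) i a * Y (fst x) (snd x) i b)
    - (\<Sum>u\<in>UNIV. L u a * L u b))) \<longlongrightarrow> 0) (whp P)"
proof -
  interpret prob_space P by (rule P)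
  define N where "N x i a = (\<Sum>u\<in>UNIV. L u a * V (fst x) (snd x) i u)" for x i a
  define E where "E x i a = D (fst x) (snd x) i a" for x i a
  let ?\<Sigma> = "\<lambda>a b. \<Sum>u\<in>UNIV. L u a * L u b"
  let ?r = "\<lambda>x. rate (fst x)"
  have NN: "((\<lambda>x. ?r x * ((1 / T) * (\<Sum>i=1..fst x. N x i a * N x i b) - ?\<Sigma> a b)) \<longlongrightarrow> 0) (whp P)" for a b
  proof -
    have "?r x * ((1 / T) * (\<Sum>i=1..fst x. N x i a * N x i b) - ?\<Sigma> a b) =
      (\<Sum>u\<in>UNIV. \<Sum>v\<in>UNIV. L u a * L v b * (?r x * ((1 / T) *
        (\<Sum>i=1..fst x. V (fst x) (snd x) i u * V (fst x) (snd x) i v) - (if u = v then 1 else 0))))" for x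
    proof -
      have "(\<Sum>i=1..fst x. N x i a * N x i b) =
        (\<Sum>i=1..fst x. \<Sum>u\<in>UNIV. \<Sum>v\<in>UNIV. L u a * L v b * (V (fst x) (snd x) i u * V (fst x) (snd x) i v))"
        by (simp add: N_def sum_product mult_ac)
      also have "\<dots> = (\<Sum>u\<in>UNIV. \<Sum>v\<in>UNIV. L u a * L v b * (\<Sum>i=1..fst x. V (fst x) (snd x) i u * V (fst x) (snd x) i v))"
        by (subst sum.swap, rule sum.cong[OF refl], subst sum.swap) (simp add: sum_distrib_left)
      finally have 1: "(\<Sum>i=1..fst x. N x i a * N x i b) =
        (\<Sum>u\<in>UNIV. \<Sum>v\<in>UNIV. L u a * L v b * (\<Sum>i=1..fst x. V (fst x) (snd x) i u * V (fst x) (snd x) i v))" .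
      have 2: "?\<Sigma> a b = (\<Sum>u\<in>UNIV. \<Sum>v\<in>UNIV. L u a * L v b * (if u = v then 1 else 0))"
        by (simp add: if_distrib cong: if_cong)
      show ?thesis unfolding 1 2
        by (simp add: sum_distrib_left sum_subtractf[symmetric] right_diff_distrib mult_ac)
    qed
    moreover have "((\<lambda>x. \<Sum>u\<in>UNIV. \<Sum>v\<in>UNIV. L u a * L v b * (?r x * ((1 / T) *
        (\<Sum>i=1..fst x. V (fst x) (snd x) i u * V (fst x) (snd x) i v) - (if u = v then 1 else 0)))) \<longlongrightarrow>
        (\<Sum>u\<in>UNIV. \<Sum>v\<in>UNIV. L u a * L v b * 0)) (whp P)"
      by (intro tendsto_sum tendsto_mult[OF tendsto_const V])
    ultimately show ?thesis by simp
  qed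
  have N2: "((\<lambda>x. \<Sum>i=1..fst x. (N x i a)\<^sup>2) \<longlongrightarrow> T * ?\<Sigma> a a) (whp P)" for a
  proof -
    have "((\<lambda>x. (1 / T) * (\<Sum>i=1..fst x. N x i a * N x i a)) \<longlongrightarrow> ?\<Sigma> a a) (whp P)"
      using tendsto_whp_divide_rate[OF NN[of a a]] by (rule LIM_zero_cancel)
    from tendsto_mult_left[OF this, of T] show ?thesis using T by (simp add: power2_eq_square)
  qed
  \<comment> \<open>The constant \<open>C\<close> is random, so almost sure convergence is used in
    place of expectations.\<close>
  have rE: "((\<lambda>x. (?r x)\<^sup>2 * (\<Sum>i=1..fst x. (E x i a)\<^sup>2)) \<longlongrightarrow> 0) (whp P)" for a
  proof -
    define f where "f n \<omega> = (rate n)\<^sup>2 * (\<Sum>i=1..n. (D n \<omega> i a)\<^sup>2)" for n \<omega>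
    have "((\<lambda>x. f (fst x) (snd x)) \<longlongrightarrow> 0) (whp P)"
    proof (rule tendsto_whp_0_AE)
      show "f n \<in> borel_measurable P" for n
        unfolding f_def using meas by (intro borel_measurable_times borel_measurable_sum borel_measurable_power) auto
      show "AE \<omega> in P. (\<lambda>n. f n \<omega>) \<longlonglongrightarrow> 0"
        using drift[of a]
      proof eventually_elim
        case (elim \<omega>)
        then obtain C where C: "\<And>n i. i \<in> {1..n} \<Longrightarrow> \<bar>D n \<omega> i a\<bar> \<le> C * (T / real n)" by blast
        show "(\<lambda>n. f n \<omega>) \<longlonglongrightarrow> 0"
        proof (rule tendsto_sandwich[OF _ _ tendsto_const])
          show "\<forall>\<^sub>F n in sequentially. 0 \<le> f n \<omega>" by (simp add: f_def sum_nonneg)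
          have "f n \<omega> \<le> C\<^sup>2 * T\<^sup>2 / ln (real n)" if "2 \<le> n" for n
          proof -
            have "(\<Sum>i=1..n. (D n \<omega> i a)\<^sup>2) \<le> (\<Sum>i=1..n. (C * (T / real n))\<^sup>2)"
              by (intro sum_mono) (use C in \<open>metis abs_le_square_iff abs_ge_self order_trans power2_abs abs_idempotent\<close>)
            then have "f n \<omega> \<le> (rate n)\<^sup>2 * (\<Sum>i=1..n. (C * (T / real n))\<^sup>2)"
              unfolding f_def by (intro mult_left_mono) auto
            also have "\<dots> = (real n / ln (real n)) * (real n * (C * (T / real n))\<^sup>2)"
              by (simp add: rate_sq)
            also have "\<dots> = C\<^sup>2 * T\<^sup>2 / ln (real n)"
              using that by (simp add: power2_eq_square)
            finally show ?thesis .
          qed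
          then show "\<forall>\<^sub>F n in sequentially. f n \<omega> \<le> C\<^sup>2 * T\<^sup>2 / ln (real n)"
            unfolding eventually_sequentially by blast
          show "(\<lambda>n. C\<^sup>2 * T\<^sup>2 / ln (real n)) \<longlonglongrightarrow> 0" by real_asymp
        qed
      qed
    qed
    then show ?thesis by (simp add: f_def E_def)
  qed
  \<comment> \<open>The square of \<open>rate\<close> is removed by dividing by \<open>rate\<close>
    twice.\<close>
  have E2: "((\<lambda>x. \<Sum>i=1..fst x. (E x i a)\<^sup>2) \<longlongrightarrow> 0) (whp P)" for a
    using tendsto_whp_divide_rate[OF tendsto_whp_divide_rate] rE[of a]
    by (simp add: power2_eq_square mult.assoc)
  note NE = tendsto_square_product_sum_0[OF N2 rE]
  note EE = tendsto_square_product_sum_0[OF E2 rE]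
  have Y: "Y (fst x) (snd x) i a = N x i a + E x i a" for x i a by (simp add: Y_def N_def E_def)
  have "?r x * ((1 / T) * (\<Sum>i=1..fst x. Y (fst x) (snd x) i a * Y (fst x) (snd x) i b) - ?\<Sigma> a b) =
    ?r x * ((1 / T) * (\<Sum>i=1..fst x. N x i a * N x i b) - ?\<Sigma> a b) + (1 / T) *
    (?r x * (\<Sum>i=1..fst x. N x i a * E x i b) + ?r x * (\<Sum>i=1..fst x. N x i b * E x i a)
      + ?r x * (\<Sum>i=1..fst x. E x i a * E x i b))" for x
    unfolding Y by (simp add: algebra_simps sum.distrib)
  moreover have "((\<lambda>x. ?r x * ((1 / T) * (\<Sum>i=1..fst x. N x i a * N x i b) - ?\<Sigma> a b) + (1 / T) *
    (?r x * (\<Sum>i=1..fst x. N x i a * E x i b) + ?r x * (\<Sum>i=1..fst x. N x i b * E x i a)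
      + ?r x * (\<Sum>i=1..fst x. E x i a * E x i b))) \<longlongrightarrow> 0 + (1 / T) * (0 + 0 + 0)) (whp P)"
    by (intro tendsto_add tendsto_mult[OF tendsto_const] NN NE EE)
  ultimately show ?thesis by simp
qed

text \<open>Division by \<open>T\<close> is averaging over the \<open>n\<close> increments after
  scaling by the step, as \<open>n * (T / n) = T\<close>.\<close>

definition realized_cov :: "real \<Rightarrow> nat \<Rightarrow> (real \<Rightarrow> 'w \<Rightarrow> real ^ 'n::finite) \<Rightarrow> 'w \<Rightarrow> real ^ 'n ^ 'n" where
  "realized_cov T n X \<omega> = (\<chi> a b. (1 / T) * (\<Sum>i=1..n. increment T n X \<omega> i $ a * increment T n X \<omega> i $ b))"

section \<open>The observed process\<close>

lemma borel_measurable_matrix_vector: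
  fixes A :: "real ^ 'n::finite ^ 'm::finite"
  shows "f \<in> borel_measurable M \<Longrightarrow> (\<lambda>\<omega>. A *v f \<omega>) \<in> borel_measurable M"
  by (rule measurable_compose[of f])
    (auto intro!: borel_measurable_continuous_onI linear_continuous_on matrix_vector_mul_bounded_linear)

lemma borel_measurable_vec_component:
  fixes f :: "'a \<Rightarrow> real ^ 'n::finite"
  shows "f \<in> borel_measurable M \<Longrightarrow> (\<lambda>\<omega>. f \<omega> $ i) \<in> borel_measurable M"
  by (rule measurable_compose[of f]) auto

lemma invertible_solve:
  fixes B :: "real ^ 'n::finite ^ 'n"
  assumes "invertible (mat 1 - B)" "y = B *v y + z"
  shows "y = matrix_inv (mat 1 - B) *v z"
proof -
  have "matrix_inv (mat 1 - B) ** (mat 1 - B) = mat 1"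
    using assms someI_ex[of "\<lambda>C. (mat 1 - B) ** C = mat 1 \<and> C ** (mat 1 - B) = mat 1"]
    by (auto simp: invertible_def matrix_inv_def)
  moreover have "(mat 1 - B) *v y = z"
    using assms(2) by (metis add_diff_cancel_left' matrix_vector_mul_lid matrix_vector_mult_diff_rdistrib)
  ultimately show ?thesis
    by (metis matrix_vector_mul_assoc matrix_vector_mul_lid)
qed

text \<open>Solved for \<open>\<eta>\<close>, the structural equation shows that \<open>X\<close> is
  a fixed linear image of the four diffusions. Its increments are the loadings applied to the Wiener
  increments, plus a remainder collecting the drifts.\<close>

lemma
  fixes W1 :: "real \<Rightarrow> 'w \<Rightarrow> real ^ 'r1::finite" and W2 :: "real \<Rightarrow> 'w \<Rightarrow> real ^ 'r2::finite"
    and W3 :: "real \<Rightarrow> 'w \<Rightarrow> real ^ 'r3::finite" and W4 :: "real \<Rightarrow> 'w \<Rightarrow> real ^ 'r4::finite"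
    and \<xi> :: "real \<Rightarrow> 'w \<Rightarrow> real ^ 'k1::finite" and \<delta> :: "real \<Rightarrow> 'w \<Rightarrow> real ^ 'p1::finite"
    and \<epsilon> :: "real \<Rightarrow> 'w \<Rightarrow> real ^ 'p2::finite" and \<zeta> \<eta> :: "real \<Rightarrow> 'w \<Rightarrow> real ^ 'k2::finite"
    and sem0 :: "('k1, 'k2, 'p1, 'p2, 'r1, 'r2, 'r3, 'r4) sem"
  assumes basis: "stochastic_basis P F"
    and wiener: "wiener_process P F W1" "wiener_process P F W2"
      "wiener_process P F W3" "wiener_process P F W4"
    and ind: "prob_space.indep_sets P
      (\<lambda>i. [process_events P W1, process_events P W2, process_events P W3, process_events P W4] ! i) {..<4}"
    and Psi: "invertible (Psi sem0)"
    and sde: "diffusion_solution P F W1 B1 (S1 sem0) c1 \<xi>"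
      "diffusion_solution P F W2 B2 (S2 sem0) c2 \<delta>"
      "diffusion_solution P F W3 B3 (S3 sem0) c3 \<epsilon>"
      "diffusion_solution P F W4 B4 (S4 sem0) c4 \<zeta>"
    and cont: "continuous_on UNIV B1" "continuous_on UNIV B2" "continuous_on UNIV B3" "continuous_on UNIV B4"
    and structural: "\<And>t \<omega>. 0 \<le> t \<Longrightarrow> \<omega> \<in> space P \<Longrightarrow>
      \<eta> t \<omega> = Bmat sem0 *v \<eta> t \<omega> + Gam sem0 *v \<xi> t \<omega> + \<zeta> t \<omega>"
    and observed: "\<And>t \<omega>. 0 \<le> t \<Longrightarrow> \<omega> \<in> space P \<Longrightarrow>
      X t \<omega> = stack (Lambda1 sem0 *v \<xi> t \<omega> + \<delta> t \<omega>) (Lambda2 sem0 *v \<eta> t \<omega> + \<epsilon> t \<omega>)"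
    and T: "0 < T"
  shows borel_measurable_observation: "\<And>t a. 0 \<le> t \<Longrightarrow> (\<lambda>\<omega>. X t \<omega> $ a) \<in> borel_measurable P"
    and realized_cov_whp: "\<And>a b. ((\<lambda>x. rate (fst x) *
      (realized_cov T (fst x) X (snd x) $ a $ b - sem_Sigma sem0 $ a $ b)) \<longlongrightarrow> 0) (whp P)"
proof -
  let ?L = "loading sem0" and ?V = "noise W1 W2 W3 W4 T"
  let ?R = "Lambda2 sem0 ** matrix_inv (Psi sem0)"
  have \<eta>: "\<eta> t \<omega> = matrix_inv (Psi sem0) *v (Gam sem0 *v \<xi> t \<omega> + \<zeta> t \<omega>)" if "0 \<le> t" "\<omega> \<in> space P" for t \<omega>
    unfolding Psi_def
    by (rule invertible_solve) (use Psi structural[OF that] in \<open>simp_all add: Psi_def add.assoc\<close>)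
  have X1: "X t \<omega> $ Inl i = (Lambda1 sem0 *v \<xi> t \<omega> + \<delta> t \<omega>) $ i"
    and X2: "X t \<omega> $ Inr j = (?R *v (Gam sem0 *v \<xi> t \<omega> + \<zeta> t \<omega>) + \<epsilon> t \<omega>) $ j"
    if "0 \<le> t" "\<omega> \<in> space P" for t \<omega> i j
    using observed[OF that] \<eta>[OF that] by (simp_all add: stack_def matrix_vector_mul_assoc)
  have m: "\<xi> t \<in> borel_measurable P" "\<delta> t \<in> borel_measurable P" "\<epsilon> t \<in> borel_measurable P"
    "\<zeta> t \<in> borel_measurable P" if "0 \<le> t" for t
    using sde that adapted_measurable[OF basis that] unfolding diffusion_solution_def by blast+
  show Xm: "(\<lambda>\<omega>. X t \<omega> $ a) \<in> borel_measurable P" if t: "0 \<le> t" for t a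
  proof (cases a)
    case (Inl i)
    have "(\<lambda>\<omega>. (Lambda1 sem0 *v \<xi> t \<omega> + \<delta> t \<omega>) $ i) \<in> borel_measurable P"
      using m[OF t] by (intro borel_measurable_vec_component borel_measurable_add borel_measurable_matrix_vector)
    then show ?thesis using X1[OF t] Inl by (simp cong: measurable_cong)
  next
    case (Inr j)
    have "(\<lambda>\<omega>. (?R *v (Gam sem0 *v \<xi> t \<omega> + \<zeta> t \<omega>) + \<epsilon> t \<omega>) $ j) \<in> borel_measurable P"
      using m[OF t] by (intro borel_measurable_vec_component borel_measurable_add borel_measurable_matrix_vector)
    then show ?thesis using X2[OF t] Inr by (simp cong: measurable_cong)
  qed
  have Vm: "(\<lambda>\<omega>. ?V n \<omega> i u) \<in> borel_measurable P" if "i \<in> {1..n}" for n i u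
  proof -
    have g: "0 \<le> real i * (T / real n)" "0 \<le> (real i - 1) * (T / real n)"
      using grid[OF T, of n i] that by auto
    note w = wiener_measurable[OF basis]
    have "(\<lambda>\<omega>. increment T n W1 \<omega> i $ r) \<in> borel_measurable P"
      "(\<lambda>\<omega>. increment T n W2 \<omega> i $ r2) \<in> borel_measurable P"
      "(\<lambda>\<omega>. increment T n W3 \<omega> i $ r3) \<in> borel_measurable P"
      "(\<lambda>\<omega>. increment T n W4 \<omega> i $ r4) \<in> borel_measurable P" for r r2 r3 r4
      unfolding increment_def
      by (intro borel_measurable_vec_component borel_measurable_diff w[OF wiener(1)] w[OF wiener(2)]
        w[OF wiener(3)] w[OF wiener(4)] g)+
    then show ?thesis by (cases u rule: sum4_cases) (simp_all add: noise_def)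
  qed
  \<comment> \<open>Defined as a remainder, so the decomposition holds by construction; what has to
    be shown is its order \<open>T / n\<close>.\<close>
  define D where "D n \<omega> i a = increment T n X \<omega> i $ a - (\<Sum>u\<in>UNIV. ?L u a * ?V n \<omega> i u)" for n \<omega> i a
  have noise1: "(\<Sum>u\<in>UNIV. ?L u (Inl k) * ?V n \<omega> i u) =
      (Lambda1 sem0 *v (S1 sem0 *v increment T n W1 \<omega> i) + S2 sem0 *v increment T n W2 \<omega> i) $ k" for n \<omega> i k
    unfolding matrix_vector_mul_assoc
    by (simp add: sum_UNIV_Plus loading_def noise_def matrix_vector_mult_def)
  have noise2: "(\<Sum>u\<in>UNIV. ?L u (Inr k) * ?V n \<omega> i u) =
      (?R *v (Gam sem0 *v (S1 sem0 *v increment T n W1 \<omega> i) + S4 sem0 *v increment T n W4 \<omega> i)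
        + S3 sem0 *v increment T n W3 \<omega> i) $ k" for n \<omega> i k
    unfolding matrix_vector_right_distrib matrix_vector_mul_assoc
    by (simp add: sum_UNIV_Plus loading_def noise_def matrix_vector_mult_def matrix_mul_assoc)
  have Dm: "(\<lambda>\<omega>. D n \<omega> i a) \<in> borel_measurable P" if "i \<in> {1..n}" for n i a
  proof -
    have "(\<lambda>\<omega>. increment T n X \<omega> i $ a) \<in> borel_measurable P"
      unfolding increment_def vector_minus_component
      using grid[OF T, of n i] that by (intro borel_measurable_diff Xm) auto
    then show ?thesis unfolding D_def using Vm[OF that]
      by (intro borel_measurable_diff borel_measurable_sum borel_measurable_times) auto
  qed
  have drift: "AE \<omega> in P. \<exists>C. \<forall>n. \<forall>i\<in>{1..n}. \<bar>D n \<omega> i a\<bar> \<le> C * (T / real n)" for a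
    using diffusion_drift_bound[OF sde(1) cont(1), of T] diffusion_drift_bound[OF sde(2) cont(2), of T]
      diffusion_drift_bound[OF sde(3) cont(3), of T] diffusion_drift_bound[OF sde(4) cont(4), of T] AE_space
  proof eventually_elim
    case (elim \<omega>)
    let ?f1 = "\<lambda>s t. \<xi> t \<omega> - \<xi> s \<omega> - S1 sem0 *v (W1 t \<omega> - W1 s \<omega>)"
      and ?f2 = "\<lambda>s t. \<delta> t \<omega> - \<delta> s \<omega> - S2 sem0 *v (W2 t \<omega> - W2 s \<omega>)"
      and ?f3 = "\<lambda>s t. \<epsilon> t \<omega> - \<epsilon> s \<omega> - S3 sem0 *v (W3 t \<omega> - W3 s \<omega>)"
      and ?f4 = "\<lambda>s t. \<zeta> t \<omega> - \<zeta> s \<omega> - S4 sem0 *v (W4 t \<omega> - W4 s \<omega>)"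
    note lin = drift_bound_linear[OF matrix_vector_mul_bounded_linear]
    \<comment> \<open>On every grid interval the remainder is the value of one interval function
      \<open>f\<close>, the same for all \<open>n\<close> and \<open>i\<close>, so one constant
      serves all grids.\<close>
    obtain f where f: "drift_bound T f"
      and Df: "\<And>n i :: nat. i \<in> {1..n} \<Longrightarrow> D n \<omega> i a = f ((real i - 1) * (T / real n)) (real i * (T / real n))"
    proof (cases a)
      case (Inl k)
      show thesis
      proof (rule that[of "\<lambda>s t. (Lambda1 sem0 *v ?f1 s t + ?f2 s t) $ k"])
        show "drift_bound T (\<lambda>s t. (Lambda1 sem0 *v ?f1 s t + ?f2 s t) $ k)"
          by (intro drift_bound_linear[OF bounded_linear_vec_nth] drift_bound_add lin elim)
        fix n i :: nat assume "i \<in> {1..n}"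
        then have "0 \<le> real i * (T / real n)" "0 \<le> (real i - 1) * (T / real n)"
          using grid[OF T, of n i] by auto
        then show "D n \<omega> i a = (Lambda1 sem0 *v ?f1 ((real i - 1) * (T / real n)) (real i * (T / real n)) +
            ?f2 ((real i - 1) * (T / real n)) (real i * (T / real n))) $ k"
          unfolding D_def Inl noise1
          by (simp only: increment_def vector_minus_component X1[OF _ elim(5)])
            (simp add: matrix_vector_mult_diff_distrib)
      qed
    next
      case (Inr k)
      show thesis
      proof (rule that[of "\<lambda>s t. (?R *v (Gam sem0 *v ?f1 s t + ?f4 s t) + ?f3 s t) $ k"])
        show "drift_bound T (\<lambda>s t. (?R *v (Gam sem0 *v ?f1 s t + ?f4 s t) + ?f3 s t) $ k)"
          by (intro drift_bound_linear[OF bounded_linear_vec_nth] drift_bound_add lin elim)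
        fix n i :: nat assume "i \<in> {1..n}"
        then have "0 \<le> real i * (T / real n)" "0 \<le> (real i - 1) * (T / real n)"
          using grid[OF T, of n i] by auto
        then show "D n \<omega> i a = (?R *v (Gam sem0 *v ?f1 ((real i - 1) * (T / real n)) (real i * (T / real n)) +
            ?f4 ((real i - 1) * (T / real n)) (real i * (T / real n))) +
            ?f3 ((real i - 1) * (T / real n)) (real i * (T / real n))) $ k"
          unfolding D_def Inr noise2
          by (simp only: increment_def vector_minus_component X2[OF _ elim(5)])
            (simp add: matrix_vector_mult_diff_distrib matrix_vector_right_distrib)
      qed
    qed
    obtain C where C: "\<And>s t. 0 \<le> s \<Longrightarrow> s \<le> t \<Longrightarrow> t \<le> T \<Longrightarrow> norm (f s t) \<le> C * (t - s)"
      using f by (auto simp: drift_bound_def)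
    have "\<bar>D n \<omega> i a\<bar> \<le> C * (T / real n)" if i: "i \<in> {1..n}" for n i :: nat
    proof -
      have n: "1 \<le> n" using i by auto
      note g = grid[OF T n i]
      show ?thesis using C[OF g(1) less_imp_le[OF g(2)] g(4)] unfolding g(3) Df[OF i] by simp
    qed
    then show ?case by blast
  qed
  have P: "prob_space P" using basis by (rule stochastic_basis_prob_space)
  note whp = realized_covariance_whp[where D = D and L = ?L, OF P T noise_covariation_whp[OF basis wiener ind T] Dm drift]
  show "((\<lambda>x. rate (fst x) * (realized_cov T (fst x) X (snd x) $ a $ b - sem_Sigma sem0 $ a $ b)) \<longlongrightarrow> 0) (whp P)"
    for a b
    using whp[where a = a and b = b] by (simp add: D_def realized_cov_def sem_Sigma_eq_loading)
qed

section \<open>The quasi-likelihood as a function of the realized covariance\<close>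

text \<open>The Gaussian negative log-likelihood per observation, without its constant term, of
  covariance \<open>S \<theta>\<close> against empirical covariance \<open>Q\<close>.\<close>

definition cost :: "((nat \<Rightarrow> real) \<Rightarrow> real ^ 'n::finite ^ 'n) \<Rightarrow> real ^ 'n ^ 'n \<Rightarrow> (nat \<Rightarrow> real) \<Rightarrow> real" where
  "cost S Q \<theta> = (1 / 2) * (ln (det (S \<theta>)) + mat_dot (matrix_inv (S \<theta>)) Q)"

lemma mat_dot_sum: "mat_dot A B = (\<Sum>u\<in>UNIV. A $ fst u $ snd u * B $ fst u $ snd u)"
  by (simp add: mat_dot_def trace_def matrix_matrix_mult_def transpose_def sum.cartesian_product
      UNIV_Times_UNIV case_prod_beta)

lemma mat_dot_diff_left: "mat_dot (A - B) C = mat_dot A C - mat_dot B C"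
  by (simp add: mat_dot_sum sum_subtractf algebra_simps)

lemma mat_dot_realized_cov:
  assumes "0 < T"
  shows "(\<Sum>i=1..n. mat_dot A (outer (increment T n X \<omega> i))) = T * mat_dot A (realized_cov T n X \<omega>)"
  using assms unfolding mat_dot_sum
  by (subst sum.swap) (simp add: realized_cov_def outer_def sum_distrib_left)

lemma quasi_lik_pos:
  assumes "0 < T" "1 \<le> n" "0 < det (S \<theta>)"
  shows "0 < quasi_lik T X S n \<omega> \<theta>"
  unfolding quasi_lik_def using assms by (intro prod_pos) auto

text \<open>The power of \<open>2 * pi * h\<close>, with \<open>h = T / n\<close>, in
  \<open>quasi_loglik\<close> cancels the normalizing constants, and \<open>T / (2 * h)\<close> is
  \<open>n / 2\<close>.\<close>

lemma quasi_loglik_eq_cost: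
  fixes X :: "real \<Rightarrow> 'w \<Rightarrow> real ^ 'n::finite"
  assumes T: "0 < T" and n: "1 \<le> n" and S: "0 < det (S \<theta>)"
  shows "quasi_loglik T X S n \<omega> \<theta> = - real n * cost S (realized_cov T n X \<omega>) \<theta>"
proof -
  let ?h = "T / real n" and ?p = "real CARD('n) / 2"
  let ?md = "\<lambda>i. mat_dot (matrix_inv (S \<theta>)) (outer (increment T n X \<omega> i))"
  have h: "0 < 2 * pi * ?h" using T n by simp
  have "quasi_loglik T X S n \<omega> \<theta> = real n * real CARD('n) / 2 * ln (2 * pi * ?h) + ln (quasi_lik T X S n \<omega> \<theta>)"
    unfolding quasi_loglik_def using h quasi_lik_pos[where S = S and \<theta> = \<theta> and X = X and \<omega> = \<omega>, OF T n S] S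
    by (subst ln_mult) (auto simp: ln_powr)
  also have "ln (quasi_lik T X S n \<omega> \<theta>) =
      (\<Sum>i=1..n. ln (1 / ((2 * pi * ?h) powr ?p * det (S \<theta>) powr (1 / 2)) * exp (- (1 / (2 * ?h)) * ?md i)))"
    unfolding quasi_lik_def using h S n by (intro ln_prod) auto
  also have "\<dots> = (\<Sum>i=1..n. - (?p * ln (2 * pi * ?h)) - (1 / 2) * ln (det (S \<theta>)) - 1 / (2 * ?h) * ?md i)"
  proof (intro sum.cong refl)
    fix i
    have pos: "0 < (2 * pi * ?h) powr ?p" "0 < det (S \<theta>) powr (1 / 2)" using T n S by auto
    show "ln (1 / ((2 * pi * ?h) powr ?p * det (S \<theta>) powr (1 / 2)) * exp (- (1 / (2 * ?h)) * ?md i)) =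
      - (?p * ln (2 * pi * ?h)) - (1 / 2) * ln (det (S \<theta>)) - 1 / (2 * ?h) * ?md i"
      using pos T n S by (subst ln_mult) (auto simp: ln_div ln_mult ln_powr)
  qed
  also have "\<dots> = - (real n * ?p * ln (2 * pi * ?h)) - real n * (1 / 2) * ln (det (S \<theta>))
      - 1 / (2 * ?h) * (\<Sum>i=1..n. ?md i)"
    by (simp add: sum_subtractf sum_distrib_left sum_negf mult.assoc right_diff_distrib)
  finally show ?thesis
    unfolding mat_dot_realized_cov[OF T] cost_def using T n by (simp add: field_simps)
qed

lemma quasi_lik_eq_exp:
  fixes X :: "real \<Rightarrow> 'w \<Rightarrow> real ^ 'n::finite"
  assumes T: "0 < T" and n: "1 \<le> n" and S: "0 < det (S \<theta>)"
  shows "quasi_lik T X S n \<omega> \<theta> =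
    exp (quasi_loglik T X S n \<omega> \<theta>) / (2 * pi * (T / real n)) powr (real n * real CARD('n) / 2)"
proof -
  have "0 < (2 * pi * (T / real n)) powr (real n * real CARD('n) / 2) * quasi_lik T X S n \<omega> \<theta>"
    using T n quasi_lik_pos[where S = S and \<theta> = \<theta> and X = X and \<omega> = \<omega>, OF T n S] by auto
  then show ?thesis using T n by (simp add: quasi_loglik_def)
qed

text \<open>Identifiability thereby becomes quadratic growth of the limit cost away from
  \<open>\<theta>0\<close>.\<close>

lemma Y_limit_eq_cost:
  assumes "0 < det (S \<theta>)" "0 < det (S \<theta>0)"
  shows "Y_limit S \<theta>0 \<theta> = cost S (S \<theta>0) \<theta>0 - cost S (S \<theta>0) \<theta>"
  using assms by (simp add: Y_limit_def cost_def mat_dot_diff_left ln_div algebra_simps)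

definition information :: "nat \<Rightarrow> ((nat \<Rightarrow> real) \<Rightarrow> real ^ 'n::finite ^ 'n) \<Rightarrow> real ^ 'n ^ 'n \<Rightarrow> (nat \<Rightarrow> real) \<Rightarrow> real Matrix.mat" where
  "information q S Q \<theta> = hessian q (cost S Q) \<theta>"

lemma information_carrier: "information q S Q \<theta> \<in> carrier_mat q q"
  by (simp add: information_def hessian_def)

lemma information_entry:
  "i < q \<Longrightarrow> j < q \<Longrightarrow> information q S Q \<theta> $$ (i, j) = partial i (partial j (cost S Q)) \<theta>"
  by (simp add: information_def hessian_def)

lemma partial_lincomb:
  assumes "C_on (Suc k) q V f" "\<And>u. u \<in> I \<Longrightarrow> C_on (Suc k) q V (g u)" "x \<in> V" "i < q"
  shows "partial i (\<lambda>x. f x + (\<Sum>u\<in>I. c u * g u x)) x = partial i f x + (\<Sum>u\<in>I. c u * partial i (g u) x)"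
  by (rule partialI) (intro DERIV_add DERIV_sum DERIV_cmult C_on_Suc_DERIV[OF assms(1)]
    C_on_Suc_DERIV[OF assms(2)] assms(3,4))

text \<open>The open set \<open>V\<close> carries the parameter space into a region where the
  determinant is positive, so that the logarithm and the inverse in the cost are smooth even at
  estimators on the boundary.\<close>

locale smooth_model =
  fixes q :: nat and \<Theta> V :: "(nat \<Rightarrow> real) set" and S :: "(nat \<Rightarrow> real) \<Rightarrow> real ^ 'n::finite ^ 'n"
  assumes params: "parameter_space q \<Theta>"
    and V: "openin (Euclidean_space q) V" "\<Theta> \<subseteq> V"
    and C2: "\<And>a b. C_on (Suc (Suc 0)) q V (\<lambda>x. S x $ a $ b)"
    and det_pos: "\<And>x. x \<in> V \<Longrightarrow> 0 < det (S x)"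
begin

lemma V_sub: "V \<subseteq> Rn q"
  using V(1) by (rule openin_Euclidean_subset)

lemma det_nz: "x \<in> V \<Longrightarrow> det (S x) \<noteq> 0"
  using det_pos[of x] by simp

lemma compact_params: "compact \<Theta>"
  using params by (simp add: parameter_space_def Euclidean_space_def compactin_subtopology euclidean_product_topology)

lemma convex_params: "convex_Rn \<Theta>"
  using params by (simp add: parameter_space_def)

abbreviation "half_log_det \<equiv> \<lambda>x. (1 / 2) * ln (det (S x))"
abbreviation "half_inv \<equiv> \<lambda>u x. (1 / 2) * matrix_inv (S x) $ fst u $ snd u"

lemma C_on_det:
  assumes "\<And>a b. C_on k q V (\<lambda>x. A x $ a $ b)"
  shows "C_on k q V (\<lambda>x. det (A x :: real ^ 'n ^ 'n))"
  unfolding Determinants.det_def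
  by (intro C_on_sum[OF V(1)] C_on_mult[OF V(1)] C_on_const[OF V_sub] C_on_prod[OF V(1)] assms)

lemma C_on_half_log_det: "C_on (Suc (Suc 0)) q V half_log_det"
  by (intro C_on_cmult[OF V(1)] C_on_ln[OF V(1)] C_on_det C2 det_pos)

lemma C_on_half_inv: "C_on (Suc (Suc 0)) q V (half_inv u)"
proof -
  let ?M = "\<lambda>x. (\<chi> i j. if j = fst u then axis (snd u) 1 $ i else S x $ i $ j) :: real ^ 'n ^ 'n"
  have "C_on (Suc (Suc 0)) q V (\<lambda>x. ?M x $ a $ b)" for a b
    using C2[of a b] C_on_const[OF V_sub, of "Suc (Suc 0)" "axis (snd u) 1 $ a"]
    by (cases "b = fst u") (simp_all del: C_on.simps)
  then have "C_on (Suc (Suc 0)) q V (\<lambda>x. (1 / 2) * (det (?M x) * inverse (det (S x))))"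
    by (intro C_on_cmult[OF V(1)] C_on_mult[OF V(1)] C_on_inverse[OF V(1)] C_on_det C2 det_nz)
  moreover have "(1 / 2) * (det (?M x) * inverse (det (S x))) = half_inv u x" if "x \<in> V" for x
    unfolding matrix_inv_entry[OF det_nz[OF that]] divide_inverse ..
  ultimately show ?thesis by (rule C_on_cong[OF V(1)])
qed

text \<open>Separates data from parameter: the coefficients depend on \<open>\<theta>\<close> but
  not on \<open>n\<close> or \<open>\<omega>\<close>.\<close>

lemma cost_lincomb: "cost S Q x = half_log_det x + (\<Sum>u\<in>UNIV. Q $ fst u $ snd u * half_inv u x)"
  by (simp add: cost_def mat_dot_sum sum_distrib_left distrib_left mult_ac)

lemma C_on_cost: "C_on (Suc (Suc 0)) q V (cost S Q)"
  unfolding cost_lincomb[abs_def]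
  by (intro C_on_add[OF V(1)] C_on_sum[OF V(1)] C_on_cmult[OF V(1)] C_on_half_log_det C_on_half_inv)

lemma partial_partial_cost:
  assumes x: "x \<in> V" and ij: "i < q" "j < q"
  shows "partial i (partial j (cost S Q)) x = partial i (partial j half_log_det) x +
    (\<Sum>u\<in>UNIV. Q $ fst u $ snd u * partial i (partial j (half_inv u)) x)"
proof -
  have 1: "partial j (cost S Q) y = partial j half_log_det y +
      (\<Sum>u\<in>UNIV. Q $ fst u $ snd u * partial j (half_inv u) y)" if "y \<in> V" for y
    unfolding cost_lincomb[abs_def]
    by (rule partial_lincomb[OF C_on_half_log_det C_on_half_inv that ij(2)])
  have "partial i (partial j (cost S Q)) x = partial i (\<lambda>y. partial j half_log_det y +
      (\<Sum>u\<in>UNIV. Q $ fst u $ snd u * partial j (half_inv u) y)) x"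
    by (rule partial_cong[OF V(1) x ij(1) 1])
  also have "\<dots> = partial i (partial j half_log_det) x +
    (\<Sum>u\<in>UNIV. Q $ fst u $ snd u * partial i (partial j (half_inv u)) x)"
    by (rule partial_lincomb[OF C_on_Suc_partial[OF C_on_half_log_det ij(2)]
      C_on_Suc_partial[OF C_on_half_inv ij(2)] x ij(1)])
  finally show ?thesis .
qed

lemma continuous_on_partials:
  assumes "i < q" "j < q"
  shows "continuous_on V (partial i (partial j half_log_det))"
    and "continuous_on V (partial i (partial j (half_inv u)))"
  by (rule C_on_continuous[OF C_on_Suc_partial[OF C_on_Suc_partial[OF C_on_half_log_det assms(2)] assms(1)] V_sub])
    (rule C_on_continuous[OF C_on_Suc_partial[OF C_on_Suc_partial[OF C_on_half_inv assms(2)] assms(1)] V_sub])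

lemma hessian_quasi_loglik:
  assumes T: "0 < T" and n: "1 \<le> n" and x: "x \<in> V"
  shows "(- (1 / real n)) \<cdot>\<^sub>m hessian q (quasi_loglik T X S n \<omega>) x = information q S (realized_cov T n X \<omega>) x"
proof (rule eq_matI)
  let ?c = "cost S (realized_cov T n X \<omega>)"
  \<comment> \<open>The zero and the one-element sum give the shape that
    \<open>partial_lincomb\<close> expects.\<close>
  have eq: "quasi_loglik T X S n \<omega> y = 0 + (\<Sum>u\<in>{()}. - real n * ?c y)" if "y \<in> V" for y
    using quasi_loglik_eq_cost[where S = S and \<theta> = y, OF T n det_pos[OF that]] by simp
  note c0 = C_on_const[OF V_sub, of _ 0]
  have p0: "partial i (\<lambda>x. 0) = (\<lambda>x. 0)" for i by (auto simp: partial_def)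
  fix i j assume "i < dim_row (information q S (realized_cov T n X \<omega>) x)"
    "j < dim_col (information q S (realized_cov T n X \<omega>) x)"
  then have ij: "i < q" "j < q" by (simp_all add: information_def hessian_def)
  have 1: "partial j (quasi_loglik T X S n \<omega>) y = 0 + (\<Sum>u\<in>{()}. - real n * partial j ?c y)" if "y \<in> V" for y
    by (subst partial_cong[OF V(1) that ij(2) eq])
      (use partial_lincomb[where I = "{()}" and c = "\<lambda>_. - real n", OF c0 C_on_cost that ij(2)] in \<open>simp_all add: p0\<close>)
  have "partial i (partial j (quasi_loglik T X S n \<omega>)) x = - real n * partial i (partial j ?c) x"
    by (subst partial_cong[OF V(1) x ij(1) 1])
      (use partial_lincomb[where I = "{()}" and c = "\<lambda>_. - real n",
        OF c0 C_on_Suc_partial[OF C_on_cost ij(2)] x ij(1)] in \<open>simp_all add: p0\<close>)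
  then show "((- (1 / real n)) \<cdot>\<^sub>m hessian q (quasi_loglik T X S n \<omega>) x) $$ (i, j) =
      information q S (realized_cov T n X \<omega>) x $$ (i, j)"
    using ij n by (simp add: information_entry) (simp add: hessian_def)
qed (simp_all add: information_def hessian_def)

lemma obs_information_eq:
  assumes "0 < T" "1 \<le> n" "x \<in> V"
  shows "obs_information T X q S n \<omega> x = (let I = information q S (realized_cov T n X \<omega>) x
      in if pos_def_mat q I then I else 1\<^sub>m q)"
  unfolding obs_information_def hessian_quasi_loglik[OF assms] ..

text \<open>The supremum in \<open>qmle\<close> is one of reals and expresses maximality only over a
  bounded set; continuity on the compact parameter space provides the bound.\<close>

lemma bdd_above_quasi_lik:
  assumes T: "0 < T" and n: "1 \<le> n"
  shows "bdd_above (quasi_lik T X S n \<omega> ` \<Theta>)"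
proof -
  let ?c = "cost S (realized_cov T n X \<omega>)" and ?N = "(2 * pi * (T / real n)) powr (real n * real CARD('n) / 2)"
  have "continuous_on \<Theta> ?c"
    using C_on_continuous[OF C_on_cost V_sub] V(2) by (rule continuous_on_subset)
  then have "continuous_on \<Theta> (\<lambda>x. exp (- real n * ?c x) / ?N)"
    using T n by (intro continuous_intros) auto
  then have "bdd_above ((\<lambda>x. exp (- real n * ?c x) / ?N) ` \<Theta>)"
    using compact_params by (intro bounded_imp_bdd_above compact_imp_bounded compact_continuous_image)
  moreover have "(\<lambda>x. exp (- real n * ?c x) / ?N) ` \<Theta> = quasi_lik T X S n \<omega> ` \<Theta>"
    using V(2) det_pos by (intro image_cong refl) (auto simp: quasi_lik_eq_exp[OF T n] quasi_loglik_eq_cost[OF T n] subset_iff)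
  ultimately show ?thesis by simp
qed

lemma qmle_maximizes:
  assumes T: "0 < T" and n: "1 \<le> n" and est: "qmle P T X q \<Theta> S n est" and \<omega>: "\<omega> \<in> space P"
    and \<theta>: "\<theta> \<in> \<Theta>"
  shows "est \<omega> \<in> \<Theta>" and "quasi_loglik T X S n \<omega> \<theta> \<le> quasi_loglik T X S n \<omega> (est \<omega>)"
proof -
  show e: "est \<omega> \<in> \<Theta>" using est \<omega> by (auto simp: qmle_def)
  have d: "0 < det (S \<theta>)" "0 < det (S (est \<omega>))" using det_pos V(2) \<theta> e by auto
  have "quasi_lik T X S n \<omega> \<theta> \<le> quasi_lik T X S n \<omega> (est \<omega>)"
    using est \<omega> cSUP_upper[OF \<theta> bdd_above_quasi_lik[OF T n]] by (auto simp: qmle_def)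
  then show "quasi_loglik T X S n \<omega> \<theta> \<le> quasi_loglik T X S n \<omega> (est \<omega>)"
    unfolding quasi_lik_eq_exp[where S = S and \<theta> = \<theta>, OF T n d(1)]
      quasi_lik_eq_exp[where S = S and \<theta> = "est \<omega>", OF T n d(2)]
    using T n by (simp add: divide_le_cancel)
qed

end

text \<open>The neighbourhood of smoothness is shrunk to the part with positive determinant, open by
  continuity.\<close>

lemma smooth_model_exists:
  fixes S :: "(nat \<Rightarrow> real) \<Rightarrow> real ^ 'n::finite ^ 'n"
  assumes params: "parameter_space q \<Theta>" and C2: "C2_near q \<Theta> S"
    and pos: "\<And>\<theta>. \<theta> \<in> \<Theta> \<Longrightarrow> 0 < det (S \<theta>)"
  shows "\<exists>V. smooth_model q \<Theta> V S"
proof -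
  obtain U where U: "openin (Euclidean_space q) U" "\<Theta> \<subseteq> U"
    and C: "\<And>a b. C_on (Suc (Suc 0)) q U (\<lambda>x. S x $ a $ b)"
    using C2 unfolding C2_near_def numeral_2_eq_2 by blast
  note sub = openin_Euclidean_subset[OF U(1)]
  let ?V = "U \<inter> (\<lambda>x. det (S x)) -` {0<..}"
  have "continuous_on U (\<lambda>x. det (S x))"
    by (intro continuous_on_det C_on_continuous[OF C sub])
  then have "openin (top_of_set U) ?V" by (intro continuous_openin_preimage_gen) auto
  then have V: "openin (Euclidean_space q) ?V"
    using U(1) openin_trans_full Euclidean_subtopology[OF sub] by metis
  have "smooth_model q \<Theta> ?V S"
  proof
    show "C_on (Suc (Suc 0)) q ?V (\<lambda>x. S x $ a $ b)" for a b
      by (rule C_on_subset[OF C _ sub]) auto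
  qed (use V U pos params in auto)
  then show ?thesis ..
qed

section \<open>Measurability of the information criteria\<close>

context smooth_model
begin

text \<open>\<open>qmle\<close> gives measurability of the first \<open>q\<close> coordinates and
  the others vanish; coordinatewise measurability suffices in the product space.\<close>

lemma qmle_compose_measurable:
  assumes est: "qmle P T X q \<Theta> S n est" and f: "continuous_on V f"
  shows "(\<lambda>\<omega>. f (est \<omega>) :: real) \<in> borel_measurable P"
proof -
  have "(\<lambda>\<omega>. est \<omega> i) \<in> borel_measurable P" for i
  proof (cases "i < q")
    case True
    then show ?thesis using est by (auto simp: qmle_def)
  next
    case False
    then have "est \<omega> i = 0" if "\<omega> \<in> space P" for \<omega>
      using est that V(2) V_sub by (auto simp: qmle_def topspace_Euclidean_space subset_iff)
    then show ?thesis by (simp cong: measurable_cong)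
  qed
  then have "est \<in> measurable P borel" by (rule measurable_coordinatewise_then_product)
  then have "est \<in> measurable P (restrict_space borel \<Theta>)"
    using est by (intro measurable_restrict_space2) (auto simp: qmle_def)
  then show ?thesis
    by (rule measurable_compose)
      (intro borel_measurable_continuous_on_restrict continuous_on_subset[OF f V(2)])
qed

text \<open>The comparison of two criteria has to be an event. The delicate point is the case
  distinction in the observed information, which rests on \<open>sets_pos_def_mat\<close>.\<close>

lemma QBIC_measurable:
  assumes T: "0 < T" and n: "1 \<le> n" and est: "qmle P T X q \<Theta> S n est"
    and Q: "\<And>a b. (\<lambda>\<omega>. realized_cov T n X \<omega> $ a $ b) \<in> borel_measurable P"
  shows "QBIC1 T X q S est n \<in> borel_measurable P" and "QBIC2 T X q S est n \<in> borel_measurable P"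
proof -
  note comp = qmle_compose_measurable[OF est]
  let ?c = "\<lambda>\<omega>. cost S (realized_cov T n X \<omega>) (est \<omega>)"
  let ?I = "\<lambda>\<omega>. information q S (realized_cov T n X \<omega>) (est \<omega>)"
  have inV: "est \<omega> \<in> V" if "\<omega> \<in> space P" for \<omega> using est that V(2) by (auto simp: qmle_def)
  have c: "?c \<in> borel_measurable P"
    unfolding cost_lincomb
    by (intro borel_measurable_add borel_measurable_sum borel_measurable_times Q comp
      C_on_continuous[OF C_on_half_log_det V_sub] C_on_continuous[OF C_on_half_inv V_sub])
  have H: "(\<lambda>\<omega>. quasi_loglik T X S n \<omega> (est \<omega>)) \<in> borel_measurable P"
  proof (rule measurable_cong[THEN iffD2])
    show "quasi_loglik T X S n \<omega> (est \<omega>) = - real n * ?c \<omega>" if "\<omega> \<in> space P" for \<omega>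
      by (rule quasi_loglik_eq_cost[OF T n]) (rule det_pos[OF inV[OF that]])
    show "(\<lambda>\<omega>. - real n * ?c \<omega>) \<in> borel_measurable P"
      by (intro borel_measurable_times borel_measurable_const c)
  qed
  show "QBIC2 T X q S est n \<in> borel_measurable P"
    unfolding QBIC2_def[abs_def]
    by (intro borel_measurable_add borel_measurable_times borel_measurable_const H)
  have I: "(\<lambda>\<omega>. ?I \<omega> $$ (i, j)) \<in> borel_measurable P" if ij: "i < q" "j < q" for i j
  proof -
    have "(\<lambda>\<omega>. partial i (partial j half_log_det) (est \<omega>) + (\<Sum>u\<in>UNIV.
        realized_cov T n X \<omega> $ fst u $ snd u * partial i (partial j (half_inv u)) (est \<omega>))) \<in> borel_measurable P"
      by (intro borel_measurable_add borel_measurable_sum borel_measurable_times Q comp continuous_on_partials ij)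
    moreover have "?I \<omega> $$ (i, j) = partial i (partial j half_log_det) (est \<omega>) + (\<Sum>u\<in>UNIV.
        realized_cov T n X \<omega> $ fst u $ snd u * partial i (partial j (half_inv u)) (est \<omega>))"
      if "\<omega> \<in> space P" for \<omega>
      unfolding information_entry[OF ij] by (rule partial_partial_cost[OF inV[OF that] ij])
    ultimately show ?thesis by (subst measurable_cong)
  qed
  have "(\<lambda>\<omega>. ln (if pos_def_mat q (?I \<omega>) then Determinant.det (real n \<cdot>\<^sub>m ?I \<omega>)
      else Determinant.det (real n \<cdot>\<^sub>m 1\<^sub>m q))) \<in> borel_measurable P"
  proof (intro borel_measurable_ln measurable_If borel_measurable_const sets_pos_def_mat information_carrier I)
    show "(\<lambda>\<omega>. Determinant.det (real n \<cdot>\<^sub>m ?I \<omega>)) \<in> borel_measurable P"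
    proof (rule borel_measurable_det_mat)
      fix i j assume ij: "i < q" "j < q"
      then have "(real n \<cdot>\<^sub>m ?I \<omega>) $$ (i, j) = real n * ?I \<omega> $$ (i, j)" for \<omega>
        using information_carrier[of q S "realized_cov T n X \<omega>" "est \<omega>"] by auto
      then show "(\<lambda>\<omega>. (real n \<cdot>\<^sub>m ?I \<omega>) $$ (i, j)) \<in> borel_measurable P"
        using I[OF ij] by simp
    qed (simp add: information_carrier)
  qed
  moreover have "ln (Determinant.det (real n \<cdot>\<^sub>m obs_information T X q S n \<omega> (est \<omega>))) =
      ln (if pos_def_mat q (?I \<omega>) then Determinant.det (real n \<cdot>\<^sub>m ?I \<omega>)
        else Determinant.det (real n \<cdot>\<^sub>m 1\<^sub>m q))" if "\<omega> \<in> space P" for \<omega>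
    by (simp add: obs_information_eq[OF T n inV[OF that]] Let_def)
  ultimately have "(\<lambda>\<omega>. ln (Determinant.det (real n \<cdot>\<^sub>m obs_information T X q S n \<omega> (est \<omega>)))) \<in> borel_measurable P"
    by (subst measurable_cong)
  then show "QBIC1 T X q S est n \<in> borel_measurable P"
    unfolding QBIC1_def[abs_def]
    by (intro borel_measurable_add borel_measurable_times borel_measurable_const H)
qed

end

section \<open>Correctly specified models\<close>

locale correct_model = smooth_model q \<Theta> V S
  for q \<Theta> V and S :: "(nat \<Rightarrow> real) \<Rightarrow> real ^ 'n::finite ^ 'n" +
  fixes \<theta>0 :: "nat \<Rightarrow> real" and \<kappa> :: real
  assumes interior: "\<theta>0 \<in> Euclidean_space q interior_of \<Theta>"
    and \<kappa>_pos: "0 < \<kappa>"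
    and Y_le: "\<And>\<theta>. \<theta> \<in> \<Theta> \<Longrightarrow> Y_limit S \<theta>0 \<theta> \<le> - \<kappa> * (nrm q (\<lambda>i. \<theta> i - \<theta>0 i))\<^sup>2"
begin

lemma \<theta>0_in: "\<theta>0 \<in> \<Theta>" "\<theta>0 \<in> V"
  using subsetD[OF interior_of_subset interior] V(2) by auto

lemma cost_growth:
  assumes "\<theta> \<in> \<Theta>"
  shows "cost S (S \<theta>0) \<theta>0 + \<kappa> * (nrm q (\<lambda>i. \<theta> i - \<theta>0 i))\<^sup>2 \<le> cost S (S \<theta>0) \<theta>"
proof -
  have "\<theta> \<in> V" using assms V(2) by blast
  then show ?thesis
    using Y_le[OF assms] Y_limit_eq_cost[of S \<theta> \<theta>0] det_pos \<theta>0_in(2) by simp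
qed

text \<open>With the true covariance in place of the data, the cost has a minimum of quadratic
  growth at \<open>\<theta>0\<close>, so the second-order condition applies.\<close>

lemma information_pos_def: "pos_def_mat q (information q S (S \<theta>0) \<theta>0)"
  unfolding pos_def_mat_iff_quad_form[OF information_carrier]
proof (intro ballI impI)
  fix v assume v: "v \<in> Rn q" "v \<noteq> (\<lambda>_. 0)"
  \<comment> \<open>The growth is known on \<open>\<Theta>\<close> only, while the second-order
    condition is stated for an open set.\<close>
  let ?U = "V \<inter> (Euclidean_space q interior_of \<Theta>)"
  have U: "openin (Euclidean_space q) ?U" by (intro openin_Int V(1) openin_interior_of)
  have "0 < (\<Sum>i<q. \<Sum>j<q. v i * v j * partial i (partial j (cost S (S \<theta>0))) \<theta>0)"
  proof (rule C_on_quadratic_minimum[OF U _ _ \<kappa>_pos _ v])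
    show "C_on (Suc (Suc 0)) q ?U (cost S (S \<theta>0))"
      by (rule C_on_subset[OF C_on_cost _ V_sub]) auto
    show "\<theta>0 \<in> ?U" using interior \<theta>0_in by simp
    show "cost S (S \<theta>0) \<theta>0 + \<kappa> * (nrm q (\<lambda>i. y i - \<theta>0 i))\<^sup>2 \<le> cost S (S \<theta>0) y" if "y \<in> ?U" for y
      using that interior_of_subset[of "Euclidean_space q" \<Theta>] by (intro cost_growth) auto
  qed
  then show "0 < quad_form q (information q S (S \<theta>0) \<theta>0) v"
    by (simp add: quad_form_def information_entry)
qed

definition gap :: "real ^ 'n ^ 'n \<Rightarrow> real" where
  "gap Q = (\<Sum>u\<in>UNIV. \<bar>Q $ fst u $ snd u - S \<theta>0 $ fst u $ snd u\<bar>)"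

lemma gap_nonneg: "0 \<le> gap Q"
  by (simp add: gap_def sum_nonneg)

text \<open>On a minimizer the quadratic growth \<open>\<kappa> r\<^sup>2\<close> of the limit cost is dominated by the perturbation,
  which is of order \<open>r * gap Q\<close>; hence \<open>r\<close> is of order \<open>gap Q\<close> and the gain of order \<open>(gap Q)\<^sup>2\<close>.\<close>

lemma minimizer_deviation:
  "\<exists>C\<ge>0. \<forall>Q. \<forall>\<theta>\<in>\<Theta>. cost S Q \<theta> \<le> cost S Q \<theta>0 \<longrightarrow>
    nrm q (\<lambda>i. \<theta> i - \<theta>0 i) \<le> C * gap Q \<and> cost S Q \<theta>0 - cost S Q \<theta> \<le> C * (gap Q)\<^sup>2"
proof -
  have "\<exists>K\<ge>0. \<forall>\<theta>\<in>\<Theta>. \<bar>half_inv u \<theta> - half_inv u \<theta>0\<bar> \<le> K * nrm q (\<lambda>i. \<theta> i - \<theta>0 i)" for u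
    using C_on_lipschitz[OF V(1) C_on_half_inv compact_params convex_params V(2)] \<theta>0_in(1) by blast
  then obtain K where K: "\<And>u. 0 \<le> K u"
    "\<And>u \<theta>. \<theta> \<in> \<Theta> \<Longrightarrow> \<bar>half_inv u \<theta> - half_inv u \<theta>0\<bar> \<le> K u * nrm q (\<lambda>i. \<theta> i - \<theta>0 i)" by metis
  define L where "L = (\<Sum>u\<in>UNIV. K u)"
  have KL: "K u \<le> L" for u unfolding L_def using K(1) by (intro member_le_sum) auto
  have L: "0 \<le> L" unfolding L_def using K(1) by (simp add: sum_nonneg)
  \<comment> \<open>One constant for both estimates: the first summand bounds the distance, the
    second the gain.\<close>
  define C where "C = L / \<kappa> + L * (L / \<kappa>)"
  have "nrm q (\<lambda>i. \<theta> i - \<theta>0 i) \<le> C * gap Q \<and> cost S Q \<theta>0 - cost S Q \<theta> \<le> C * (gap Q)\<^sup>2"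
    if \<theta>: "\<theta> \<in> \<Theta>" and le: "cost S Q \<theta> \<le> cost S Q \<theta>0" for Q \<theta>
  proof -
    define r where "r = nrm q (\<lambda>i. \<theta> i - \<theta>0 i)"
    have r: "0 \<le> r" by (simp add: r_def nrm_nonneg)
    let ?d = "\<lambda>u. Q $ fst u $ snd u - S \<theta>0 $ fst u $ snd u"
    \<comment> \<open>Replacing the true covariance by \<open>Q\<close> adds products of covariance
      errors and coefficient differences; the latter are of order \<open>r\<close> by the Lipschitz
      bound.\<close>
    have "cost S Q \<theta>0 - cost S Q \<theta> = (cost S (S \<theta>0) \<theta>0 - cost S (S \<theta>0) \<theta>)
        + (\<Sum>u\<in>UNIV. ?d u * (half_inv u \<theta>0 - half_inv u \<theta>))"
      unfolding cost_lincomb by (simp add: sum_subtractf algebra_simps)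
    also have "\<dots> \<le> - \<kappa> * r\<^sup>2 + (\<Sum>u\<in>UNIV. \<bar>?d u\<bar> * (L * r))"
    proof (rule add_mono)
      show "cost S (S \<theta>0) \<theta>0 - cost S (S \<theta>0) \<theta> \<le> - \<kappa> * r\<^sup>2"
        using cost_growth[OF \<theta>] by (simp add: r_def)
      show "(\<Sum>u\<in>UNIV. ?d u * (half_inv u \<theta>0 - half_inv u \<theta>)) \<le> (\<Sum>u\<in>UNIV. \<bar>?d u\<bar> * (L * r))"
      proof (rule sum_mono)
        fix u
        have "\<bar>half_inv u \<theta>0 - half_inv u \<theta>\<bar> \<le> K u * r"
          using K(2)[OF \<theta>, of u] by (simp add: r_def abs_minus_commute)
        also have "\<dots> \<le> L * r" using KL r by (rule mult_right_mono)
        finally have "\<bar>?d u\<bar> * \<bar>half_inv u \<theta>0 - half_inv u \<theta>\<bar> \<le> \<bar>?d u\<bar> * (L * r)"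
          by (rule mult_left_mono) simp
        then show "?d u * (half_inv u \<theta>0 - half_inv u \<theta>) \<le> \<bar>?d u\<bar> * (L * r)"
          unfolding abs_mult[symmetric] by (rule order_trans[OF abs_ge_self])
      qed
    qed
    also have "(\<Sum>u\<in>UNIV. \<bar>?d u\<bar> * (L * r)) = L * r * gap Q"
      unfolding gap_def sum_distrib_right[symmetric] by (rule mult.commute)
    finally have main: "cost S Q \<theta>0 - cost S Q \<theta> \<le> - \<kappa> * r\<^sup>2 + L * r * gap Q" .
    have r_le: "r \<le> (L / \<kappa>) * gap Q"
    proof (cases "r = 0")
      case True
      then show ?thesis using L \<kappa>_pos gap_nonneg[of Q] by simp
    next
      case False
      have "r * (\<kappa> * r) \<le> r * (L * gap Q)" using main le by (simp add: power2_eq_square mult_ac)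
      then have "\<kappa> * r \<le> L * gap Q" using r False by (simp add: mult_le_cancel_left)
      then show ?thesis using \<kappa>_pos by (simp add: field_simps)
    qed
    have "cost S Q \<theta>0 - cost S Q \<theta> \<le> L * r * gap Q" using main \<kappa>_pos
      by (smt (verit) mult_nonneg_nonneg zero_le_power2 mult_minus_left)
    also have "\<dots> \<le> L * ((L / \<kappa>) * gap Q) * gap Q"
      using r_le L gap_nonneg[of Q] by (intro mult_right_mono mult_left_mono)
    finally have gain: "cost S Q \<theta>0 - cost S Q \<theta> \<le> L * (L / \<kappa>) * (gap Q)\<^sup>2"
      by (simp add: power2_eq_square mult_ac)
    have "L / \<kappa> \<le> C" "L * (L / \<kappa>) \<le> C" using L \<kappa>_pos by (simp_all add: C_def)
    then have "(L / \<kappa>) * gap Q \<le> C * gap Q" "L * (L / \<kappa>) * (gap Q)\<^sup>2 \<le> C * (gap Q)\<^sup>2"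
      using gap_nonneg[of Q] by (intro mult_right_mono; simp)+
    then show ?thesis using r_le gain by (simp add: r_def)
  qed
  moreover have "0 \<le> C" using L \<kappa>_pos by (simp add: C_def)
  ultimately show ?thesis by blast
qed

context
  fixes P :: "'w measure" and T :: real and X :: "real \<Rightarrow> 'w \<Rightarrow> real ^ 'n" and est :: "nat \<Rightarrow> 'w \<Rightarrow> nat \<Rightarrow> real"
  assumes P: "prob_space P" and T: "0 < T"
    and est: "\<And>n. 1 \<le> n \<Longrightarrow> qmle P T X q \<Theta> S n (est n)"
    and cov: "\<And>a b. ((\<lambda>x. rate (fst x) * (realized_cov T (fst x) X (snd x) $ a $ b - S \<theta>0 $ a $ b))
      \<longlongrightarrow> 0) (whp P)"
begin

lemma rate_gap_whp: "((\<lambda>x. rate (fst x) * gap (realized_cov T (fst x) X (snd x))) \<longlongrightarrow> 0) (whp P)"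
proof -
  have "rate n * gap (realized_cov T n X \<omega>) =
      (\<Sum>u\<in>UNIV. \<bar>rate n * (realized_cov T n X \<omega> $ fst u $ snd u - S \<theta>0 $ fst u $ snd u)\<bar>)" for n \<omega>
    by (simp add: gap_def sum_distrib_left abs_mult rate_nonneg)
  moreover have "((\<lambda>x. \<Sum>u\<in>UNIV. \<bar>rate (fst x) * (realized_cov T (fst x) X (snd x) $ fst u $ snd u
      - S \<theta>0 $ fst u $ snd u)\<bar>) \<longlongrightarrow> (\<Sum>u\<in>(UNIV :: ('n \<times> 'n) set). 0)) (whp P)"
    by (intro tendsto_sum tendsto_rabs_zero cov)
  ultimately show ?thesis by simp
qed

text \<open>As \<open>n / ln n\<close> is the square of \<open>rate n\<close>, the gain divided by
  \<open>ln n\<close> is at most a multiple of the square of \<open>rate n * gap Q\<close>. The same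
  deviation estimate bounds the distance to \<open>\<theta>0\<close> by a multiple of
  \<open>gap Q\<close>, which is consistency.\<close>

lemma
  shows consistency: "((\<lambda>x. nrm q (\<lambda>i. est (fst x) (snd x) i - \<theta>0 i)) \<longlongrightarrow> 0) (whp P)"
    and gain_whp: "((\<lambda>x. (quasi_loglik T X S (fst x) (snd x) (est (fst x) (snd x))
      - quasi_loglik T X S (fst x) (snd x) \<theta>0) / ln (real (fst x))) \<longlongrightarrow> 0) (whp P)"
proof -
  let ?Q = "\<lambda>x. realized_cov T (fst x) X (snd x)" and ?e = "\<lambda>x. est (fst x) (snd x)"
  obtain C where C: "0 \<le> C" "\<And>Q \<theta>. \<theta> \<in> \<Theta> \<Longrightarrow> cost S Q \<theta> \<le> cost S Q \<theta>0 \<Longrightarrow>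
    nrm q (\<lambda>i. \<theta> i - \<theta>0 i) \<le> C * gap Q \<and> cost S Q \<theta>0 - cost S Q \<theta> \<le> C * (gap Q)\<^sup>2"
    using minimizer_deviation by blast
  have dev: "nrm q (\<lambda>i. ?e x i - \<theta>0 i) \<le> C * gap (?Q x) \<and>
      0 \<le> (quasi_loglik T X S (fst x) (snd x) (?e x) - quasi_loglik T X S (fst x) (snd x) \<theta>0) \<and>
      (quasi_loglik T X S (fst x) (snd x) (?e x) - quasi_loglik T X S (fst x) (snd x) \<theta>0) / ln (real (fst x))
        \<le> C * (rate (fst x) * gap (?Q x))\<^sup>2"
    if x: "2 \<le> fst x \<and> snd x \<in> space P" for x
  proof -
    have n: "1 \<le> fst x" "snd x \<in> space P" using x by auto
    note max = qmle_maximizes[OF T n(1) est[OF n(1)] n(2) \<theta>0_in(1)]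
    have eV: "?e x \<in> V" using max(1) V(2) by blast
    note H = quasi_loglik_eq_cost[where S = S and \<theta> = "?e x" and X = X and \<omega> = "snd x", OF T n(1) det_pos[OF eV]]
      quasi_loglik_eq_cost[where S = S and \<theta> = \<theta>0 and X = X and \<omega> = "snd x", OF T n(1) det_pos[OF \<theta>0_in(2)]]
    have le: "cost S (?Q x) (?e x) \<le> cost S (?Q x) \<theta>0"
      using max(2) n(1) unfolding H by simp
    note d = C(2)[OF max(1) le]
    have ln: "0 < ln (real (fst x))" using x by simp
    have "(quasi_loglik T X S (fst x) (snd x) (?e x) - quasi_loglik T X S (fst x) (snd x) \<theta>0) / ln (real (fst x))
      = (rate (fst x))\<^sup>2 * (cost S (?Q x) \<theta>0 - cost S (?Q x) (?e x))"
      unfolding H rate_sq using ln by (simp add: field_simps)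
    also have "\<dots> \<le> (rate (fst x))\<^sup>2 * (C * (gap (?Q x))\<^sup>2)"
      using d by (intro mult_left_mono) auto
    finally show ?thesis using d max(2) by (simp add: power_mult_distrib mult_ac)
  qed
  have ev: "\<forall>\<^sub>F x in whp P. 2 \<le> fst x \<and> snd x \<in> space P" by (rule prob_space.eventually_whp_ge[OF P])
  have gap0: "((\<lambda>x. gap (?Q x)) \<longlongrightarrow> 0) (whp P)"
    by (rule prob_space.tendsto_whp_divide_rate[OF P rate_gap_whp])
  show "((\<lambda>x. nrm q (\<lambda>i. ?e x i - \<theta>0 i)) \<longlongrightarrow> 0) (whp P)"
  proof (rule tendsto_sandwich[OF _ _ tendsto_const])
    show "\<forall>\<^sub>F x in whp P. 0 \<le> nrm q (\<lambda>i. ?e x i - \<theta>0 i)" by (simp add: nrm_nonneg)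
    show "\<forall>\<^sub>F x in whp P. nrm q (\<lambda>i. ?e x i - \<theta>0 i) \<le> C * gap (?Q x)"
      using ev by (rule eventually_mono) (use dev in blast)
    show "((\<lambda>x. C * gap (?Q x)) \<longlongrightarrow> 0) (whp P)"
      using tendsto_mult[OF tendsto_const[of C] gap0] by simp
  qed
  show "((\<lambda>x. (quasi_loglik T X S (fst x) (snd x) (?e x)
      - quasi_loglik T X S (fst x) (snd x) \<theta>0) / ln (real (fst x))) \<longlongrightarrow> 0) (whp P)"
  proof (rule tendsto_sandwich[OF _ _ tendsto_const])
    show "\<forall>\<^sub>F x in whp P. 0 \<le> (quasi_loglik T X S (fst x) (snd x) (?e x)
      - quasi_loglik T X S (fst x) (snd x) \<theta>0) / ln (real (fst x))"
      using ev by (rule eventually_mono) (use dev in force)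
    show "\<forall>\<^sub>F x in whp P. (quasi_loglik T X S (fst x) (snd x) (?e x)
      - quasi_loglik T X S (fst x) (snd x) \<theta>0) / ln (real (fst x)) \<le> C * (rate (fst x) * gap (?Q x))\<^sup>2"
      using ev by (rule eventually_mono) (use dev in blast)
    show "((\<lambda>x. C * (rate (fst x) * gap (?Q x))\<^sup>2) \<longlongrightarrow> 0) (whp P)"
      using tendsto_mult[OF tendsto_const[of C] tendsto_power[OF rate_gap_whp, of 2]] by simp
  qed
qed

lemma tendsto_estimator_compose:
  fixes f :: "(nat \<Rightarrow> real) \<Rightarrow> real"
  assumes f: "continuous_on V f"
  shows "((\<lambda>x. f (est (fst x) (snd x))) \<longlongrightarrow> f \<theta>0) (whp P)"
  unfolding tendsto_iff dist_real_def
proof (intro allI impI)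
  fix e :: real assume e: "0 < e"
  obtain r where r: "0 < r" "\<And>y. y \<in> Rn q \<Longrightarrow> (\<forall>i<q. \<bar>y i - \<theta>0 i\<bar> < r) \<Longrightarrow> \<bar>f y - f \<theta>0\<bar> < e"
    using continuous_on_openin_box[OF V(1) f \<theta>0_in(2) e] by blast
  have "\<forall>\<^sub>F x in whp P. nrm q (\<lambda>i. est (fst x) (snd x) i - \<theta>0 i) < r"
    using order_tendstoD(2)[OF consistency r(1)] .
  then show "\<forall>\<^sub>F x in whp P. \<bar>f (est (fst x) (snd x)) - f \<theta>0\<bar> < e"
    using prob_space.eventually_whp_ge[OF P, of 1]
  proof eventually_elim
    case (elim x)
    have "est (fst x) (snd x) \<in> \<Theta>"
      using qmle_maximizes(1)[OF T _ est _ \<theta>0_in(1)] elim by blast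
    then have "est (fst x) (snd x) \<in> Rn q" using V(2) V_sub by blast
    then show ?case using elim(1) abs_le_nrm[of _ q "\<lambda>i. est (fst x) (snd x) i - \<theta>0 i"]
      by (intro r(2)) (auto intro: le_less_trans)
  qed
qed

text \<open>The determinant of the Hessian of the cost at the estimator converges to a positive
  number, so its logarithm is bounded with high probability and negligible against
  \<open>ln n\<close>.\<close>

lemma det_obs_information_whp:
  "\<exists>B. \<forall>\<^sub>F x in whp P. 0 < Determinant.det (obs_information T X q S (fst x) (snd x) (est (fst x) (snd x))) \<and>
    \<bar>ln (Determinant.det (obs_information T X q S (fst x) (snd x) (est (fst x) (snd x))))\<bar> \<le> B"
proof -
  let ?Q = "\<lambda>x. realized_cov T (fst x) X (snd x)" and ?e = "\<lambda>x. est (fst x) (snd x)"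
  let ?I = "\<lambda>x. information q S (?Q x) (?e x)"
  define d where "d = Determinant.det (information q S (S \<theta>0) \<theta>0)"
  have d: "0 < d"
    unfolding d_def by (rule pos_def_mat_imp_det_pos[OF information_carrier information_pos_def])
  have inV: "?e x \<in> V" if "1 \<le> fst x \<and> snd x \<in> space P" for x
    using qmle_maximizes(1)[OF T _ est _ \<theta>0_in(1)] that V(2) by blast
  have Q: "((\<lambda>x. ?Q x $ a $ b) \<longlongrightarrow> S \<theta>0 $ a $ b) (whp P)" for a b
    using prob_space.tendsto_whp_divide_rate[OF P cov] by (rule LIM_zero_cancel)
  have "((\<lambda>x. Determinant.det (?I x)) \<longlongrightarrow> d) (whp P)"
    unfolding d_def
  proof (rule tendsto_det_mat[OF information_carrier information_carrier])
    fix i j assume ij: "i < q" "j < q"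
    have "((\<lambda>x. partial i (partial j half_log_det) (?e x) + (\<Sum>u\<in>UNIV.
        ?Q x $ fst u $ snd u * partial i (partial j (half_inv u)) (?e x))) \<longlongrightarrow>
        partial i (partial j half_log_det) \<theta>0 + (\<Sum>u\<in>UNIV.
        S \<theta>0 $ fst u $ snd u * partial i (partial j (half_inv u)) \<theta>0)) (whp P)"
      by (intro tendsto_add tendsto_sum tendsto_mult Q tendsto_estimator_compose continuous_on_partials ij)
    also have "partial i (partial j half_log_det) \<theta>0 + (\<Sum>u\<in>UNIV.
        S \<theta>0 $ fst u $ snd u * partial i (partial j (half_inv u)) \<theta>0) = information q S (S \<theta>0) \<theta>0 $$ (i, j)"
      unfolding information_entry[OF ij] by (rule partial_partial_cost[OF \<theta>0_in(2) ij, symmetric])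
    finally have lim: "((\<lambda>x. partial i (partial j half_log_det) (?e x) + (\<Sum>u\<in>UNIV.
        ?Q x $ fst u $ snd u * partial i (partial j (half_inv u)) (?e x))) \<longlongrightarrow>
        information q S (S \<theta>0) \<theta>0 $$ (i, j)) (whp P)" .
    have "\<forall>\<^sub>F x in whp P. partial i (partial j half_log_det) (?e x) + (\<Sum>u\<in>UNIV.
        ?Q x $ fst u $ snd u * partial i (partial j (half_inv u)) (?e x)) = ?I x $$ (i, j)"
      using prob_space.eventually_whp_ge[OF P, of 1]
    proof eventually_elim
      case (elim x)
      show ?case unfolding information_entry[OF ij]
        by (rule partial_partial_cost[OF inV[OF elim] ij, symmetric])
    qed
    with lim show "((\<lambda>x. ?I x $$ (i, j)) \<longlongrightarrow> information q S (S \<theta>0) \<theta>0 $$ (i, j)) (whp P)"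
      by (rule Lim_transform_eventually)
  qed
  then have "\<forall>\<^sub>F x in whp P. d / 2 < Determinant.det (?I x)" "\<forall>\<^sub>F x in whp P. Determinant.det (?I x) < 2 * d"
    using d by (auto dest: order_tendstoD(1)[of _ _ _ "d / 2"] order_tendstoD(2)[of _ _ _ "2 * d"])
  then have "\<forall>\<^sub>F x in whp P. 0 < Determinant.det (obs_information T X q S (fst x) (snd x) (?e x)) \<and>
    \<bar>ln (Determinant.det (obs_information T X q S (fst x) (snd x) (?e x)))\<bar> \<le> \<bar>ln (d / 2)\<bar> + \<bar>ln (2 * d)\<bar>"
    using prob_space.eventually_whp_ge[OF P, of 1]
  proof eventually_elim
    case (elim x)
    have "1 \<le> fst x" using elim(3) by blast
    note o = obs_information_eq[OF T this inV[OF elim(3)], of X "snd x"]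
    have "ln (d / 2) \<le> ln (Determinant.det (?I x))" "ln (Determinant.det (?I x)) \<le> ln (2 * d)"
      using elim(1,2) d by auto
    then have "\<bar>ln (Determinant.det (?I x))\<bar> \<le> \<bar>ln (d / 2)\<bar> + \<bar>ln (2 * d)\<bar>" by linarith
    moreover have "0 < Determinant.det (?I x)" using elim(1) d by linarith
    \<comment> \<open>If the Hessian fails to be positive definite, the identity takes its place and
      the logarithm is 0; the bound covers both branches.\<close>
    ultimately show ?case unfolding o Let_def by (cases "pos_def_mat q (?I x)") (simp_all only: if_True if_False det_one, simp_all)
  qed
  then show ?thesis by blast
qed

end

end

text \<open>The likelihood sees a parameter only through its covariance matrix, so correctly
  specified models agree at their true parameters.\<close>

lemma quasi_loglik_cong:
  "S \<theta> = S' \<theta>' \<Longrightarrow> quasi_loglik T X S n \<omega> \<theta> = quasi_loglik T X S' n \<omega> \<theta>'"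
  by (simp add: quasi_loglik_def quasi_lik_def)

theorem theorem2:
  fixes P :: "'w measure" and F :: "real \<Rightarrow> 'w measure"
    and W1 :: "real \<Rightarrow> 'w \<Rightarrow> real ^ 'r1::finite" and W2 :: "real \<Rightarrow> 'w \<Rightarrow> real ^ 'r2::finite"
    and W3 :: "real \<Rightarrow> 'w \<Rightarrow> real ^ 'r3::finite" and W4 :: "real \<Rightarrow> 'w \<Rightarrow> real ^ 'r4::finite"
    and \<xi> :: "real \<Rightarrow> 'w \<Rightarrow> real ^ 'k1::finite" and \<delta> :: "real \<Rightarrow> 'w \<Rightarrow> real ^ 'p1::enum"
    and \<epsilon> :: "real \<Rightarrow> 'w \<Rightarrow> real ^ 'p2::enum" and \<zeta> \<eta> :: "real \<Rightarrow> 'w \<Rightarrow> real ^ 'k2::finite"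
    and B1 :: "real ^ 'k1 \<Rightarrow> real ^ 'k1" and B2 :: "real ^ 'p1::enum \<Rightarrow> real ^ 'p1::enum"
    and B3 :: "real ^ 'p2::enum \<Rightarrow> real ^ 'p2::enum" and B4 :: "real ^ 'k2 \<Rightarrow> real ^ 'k2"
    and c1 :: "real ^ 'k1" and c2 :: "real ^ 'p1::enum" and c3 :: "real ^ 'p2::enum" and c4 :: "real ^ 'k2"
    and sem0 :: "('k1, 'k2, 'p1, 'p2, 'r1, 'r2, 'r3, 'r4) sem"
    and X :: "real \<Rightarrow> 'w \<Rightarrow> real ^ ('p1 + 'p2)" and T :: real
    and M :: nat and q :: "nat \<Rightarrow> nat" and \<Theta> :: "nat \<Rightarrow> (nat \<Rightarrow> real) set"
    and model :: "nat \<Rightarrow> (nat \<Rightarrow> real) \<Rightarrow> ('k1, 'k2, 'p1, 'p2, 'r1, 'r2, 'r3, 'r4) sem"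
    and S :: "nat \<Rightarrow> (nat \<Rightarrow> real) \<Rightarrow> real ^ ('p1 + 'p2) ^ ('p1 + 'p2)"
    and est :: "nat \<Rightarrow> nat \<Rightarrow> 'w \<Rightarrow> nat \<Rightarrow> real"
    and \<pi> :: "nat \<Rightarrow> nat \<Rightarrow> (nat \<Rightarrow> real) \<Rightarrow> real"
    and MM :: "nat set" and \<theta>0 :: "nat \<Rightarrow> nat \<Rightarrow> real" and mstar m :: nat
  assumes dims: "CARD('k1) \<le> CARD('p1)" "CARD('k2) \<le> CARD('p2)"
    and basis: "stochastic_basis P F"
    and wiener: "wiener_process P F W1" "wiener_process P F W2"
      "wiener_process P F W3" "wiener_process P F W4"
    and wiener_indep: "prob_space.indep_sets P
      (\<lambda>i. [process_events P W1, process_events P W2, process_events P W3, process_events P W4] ! i)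
      {..<4}"
    and true_regular: "regular_sem sem0"
    and sde: "diffusion_solution P F W1 B1 (S1 sem0) c1 \<xi>"
      "diffusion_solution P F W2 B2 (S2 sem0) c2 \<delta>"
      "diffusion_solution P F W3 B3 (S3 sem0) c3 \<epsilon>"
      "diffusion_solution P F W4 B4 (S4 sem0) c4 \<zeta>"
    and structural: "\<And>t \<omega>. 0 \<le> t \<Longrightarrow> \<omega> \<in> space P \<Longrightarrow>
      \<eta> t \<omega> = Bmat sem0 *v \<eta> t \<omega> + Gam sem0 *v \<xi> t \<omega> + \<zeta> t \<omega>"
    and observed: "\<And>t \<omega>. 0 \<le> t \<Longrightarrow> \<omega> \<in> space P \<Longrightarrow>
      X t \<omega> = stack (Lambda1 sem0 *v \<xi> t \<omega> + \<delta> t \<omega>) (Lambda2 sem0 *v \<eta> t \<omega> + \<epsilon> t \<omega>)"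
    and horizon: "0 < T"
    and params: "\<And>m. m \<in> {1..M} \<Longrightarrow> parameter_space (q m) (\<Theta> m)"
    and model_regular: "\<And>m \<theta>. m \<in> {1..M} \<Longrightarrow> \<theta> \<in> \<Theta> m \<Longrightarrow> regular_sem (model m \<theta>)"
    and S_def: "S = (\<lambda>m \<theta>. sem_Sigma (model m \<theta>))"
    and smooth: "\<And>m. m \<in> {1..M} \<Longrightarrow> C2_near (q m) (\<Theta> m) (S m)"
    and estimator: "\<And>m n. m \<in> {1..M} \<Longrightarrow> 1 \<le> n \<Longrightarrow> qmle P T X (q m) (\<Theta> m) (S m) n (est m n)"
    and prior: "\<And>m n. m \<in> {1..M} \<Longrightarrow> 1 \<le> n \<Longrightarrow> prior_density (q m) (\<Theta> m) (\<pi> m n)"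
    and MM_def: "MM = correct_models M \<Theta> S (sem_Sigma sem0)"
    and true_param: "\<And>m. m \<in> MM \<Longrightarrow> \<theta>0 m \<in> Euclidean_space (q m) interior_of \<Theta> m"
      "\<And>m. m \<in> MM \<Longrightarrow> sem_Sigma sem0 = S m (\<theta>0 m)"
    and optimal: "{mstar} = {m. is_arg_min q (\<lambda>m. m \<in> MM) m}"
    and A: "condition_A P T B1 \<xi>" "condition_A P T B2 \<delta>"
      "condition_A P T B3 \<epsilon>" "condition_A P T B4 \<zeta>"
    and B: "\<And>m. m \<in> MM \<Longrightarrow> condition_B (q m) (\<Theta> m) (\<pi> m) (\<theta>0 m)"
    and C1: "\<And>m. m \<in> MM \<Longrightarrow> condition_C1 (q m) (\<Theta> m) (S m) (\<theta>0 m)"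
    and m: "m \<in> MM - {mstar}"
    and nested: "nested (space P) T X q \<Theta> S mstar m"
  shows "(\<lambda>n. measure P {\<omega> \<in> space P.
           QBIC1 T X (q mstar) (S mstar) (est mstar n) n \<omega> < QBIC1 T X (q m) (S m) (est m n) n \<omega>})
           \<longlonglongrightarrow> 1 \<and>
         (\<lambda>n. measure P {\<omega> \<in> space P.
           QBIC2 T X (q mstar) (S mstar) (est mstar n) n \<omega> < QBIC2 T X (q m) (S m) (est m n) n \<omega>})
           \<longlonglongrightarrow> 1"
proof -
  have P: "prob_space P" using basis by (rule stochastic_basis_prob_space)
  interpret prob_space P by (rule P)
  have mstar: "mstar \<in> MM"
    using optimal by (auto simp: is_arg_min_def set_eq_iff)
  have m': "m \<in> MM" and less: "q mstar < q m"
    using m nested by (auto simp: nested_def)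
  have MM: "k \<in> {1..M}" if "k \<in> MM" for k using that by (auto simp: MM_def correct_models_def)
  have cont: "continuous_on UNIV B1" "continuous_on UNIV B2" "continuous_on UNIV B3" "continuous_on UNIV B4"
    using A by (auto simp: condition_A_def lipschitz_on_continuous_on)
  have Psi: "invertible (Psi sem0)" using true_regular by (simp add: regular_sem_def)
  note obs = borel_measurable_observation[OF basis wiener wiener_indep Psi sde cont structural observed horizon]
  note cov = realized_cov_whp[OF basis wiener wiener_indep Psi sde cont structural observed horizon]
  have Qm: "(\<lambda>\<omega>. realized_cov T n X \<omega> $ a $ b) \<in> borel_measurable P" if "1 \<le> n" for n a b
  proof -
    have "(\<lambda>\<omega>. increment T n X \<omega> i $ c) \<in> borel_measurable P" if "i \<in> {1..n}" for i c
      unfolding increment_def vector_minus_component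
      using grid[OF horizon \<open>1 \<le> n\<close> that] by (intro borel_measurable_diff obs)
    then show ?thesis unfolding realized_cov_def
      by (simp only: vec_lambda_beta) (intro borel_measurable_times borel_measurable_const borel_measurable_sum)
  qed
  have model: "\<exists>V \<kappa>. correct_model (q k) (\<Theta> k) V (S k) (\<theta>0 k) \<kappa>" if k: "k \<in> MM" for k
  proof -
    have "0 < det (S k \<theta>)" if "\<theta> \<in> \<Theta> k" for \<theta>
      unfolding S_def by (rule det_sem_Sigma_pos[OF model_regular[OF MM[OF k] that]])
    then obtain V where V: "smooth_model (q k) (\<Theta> k) V (S k)"
      using smooth_model_exists[OF params[OF MM[OF k]] smooth[OF MM[OF k]]] by blast
    obtain \<kappa> where "0 < \<kappa>" "\<forall>\<theta>\<in>\<Theta> k. Y_limit (S k) (\<theta>0 k) \<theta> \<le> - \<kappa> * (nrm (q k) (\<lambda>i. \<theta> i - \<theta>0 k i))\<^sup>2"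
      using C1[OF k] by (auto simp: condition_C1_def)
    then have "correct_model (q k) (\<Theta> k) V (S k) (\<theta>0 k) \<kappa>"
      using V true_param(1)[OF k] by (intro correct_model.intro correct_model_axioms.intro) auto
    then show ?thesis by blast
  qed
  obtain V \<kappa> where M: "correct_model (q m) (\<Theta> m) V (S m) (\<theta>0 m) \<kappa>" using model[OF m'] by blast
  obtain V' \<kappa>' where M': "correct_model (q mstar) (\<Theta> mstar) V' (S mstar) (\<theta>0 mstar) \<kappa>'"
    using model[OF mstar] by blast
  interpret M: correct_model "q m" "\<Theta> m" V "S m" "\<theta>0 m" \<kappa> by (rule M)
  interpret M': correct_model "q mstar" "\<Theta> mstar" V' "S mstar" "\<theta>0 mstar" \<kappa>' by (rule M')
  note e = estimator[OF MM[OF m']] and e' = estimator[OF MM[OF mstar]]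
  note covm = cov[unfolded true_param(2)[OF m']] and covm' = cov[unfolded true_param(2)[OF mstar]]

  let ?G = "\<lambda>x. quasi_loglik T X (S m) (fst x) (snd x) (est m (fst x) (snd x))
      - quasi_loglik T X (S m) (fst x) (snd x) (\<theta>0 m)"
  let ?D = "\<lambda>x. Determinant.det (obs_information T X (q m) (S m) (fst x) (snd x) (est m (fst x) (snd x)))"
  let ?D' = "\<lambda>x. Determinant.det (obs_information T X (q mstar) (S mstar) (fst x) (snd x) (est mstar (fst x) (snd x)))"
  obtain B where B: "\<forall>\<^sub>F x in whp P. 0 < ?D x \<and> \<bar>ln (?D x)\<bar> \<le> B"
    using M.det_obs_information_whp[OF P horizon e covm] by blast
  obtain B' where B': "\<forall>\<^sub>F x in whp P. 0 < ?D' x \<and> \<bar>ln (?D' x)\<bar> \<le> B'"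
    using M'.det_obs_information_whp[OF P horizon e' covm'] by blast
  \<comment> \<open>The constant 1/8 leaves room: the gain enters doubled, at most
    \<open>ln n / 4\<close>, and the log-determinants contribute less than \<open>ln n / 8\<close>,
    against dimension terms that differ by at least \<open>ln n\<close>.\<close>
  have G: "\<forall>\<^sub>F x in whp P. ?G x / ln (real (fst x)) < 1 / 8"
    using order_tendstoD(2)[OF M.gain_whp[OF P horizon e covm], of "1 / 8"] by simp
  have "filterlim (\<lambda>n. ln (real n)) at_top sequentially" by real_asymp
  then have "\<forall>\<^sub>F n in sequentially. 8 * (B + B') < ln (real n)" by (simp add: filterlim_at_top_dense)
  from eventually_whp_sequentially[OF this]
  have large: "\<forall>\<^sub>F x in whp P. 8 * (B + B') < ln (real (fst x))" .

  have dim_obs: "dim_col (obs_information T X p S' n \<omega> \<theta>) = p" for n p S' \<omega> \<theta>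
    by (simp add: obs_information_def Let_def hessian_def)
  have "\<forall>\<^sub>F x in whp P.
      QBIC1 T X (q mstar) (S mstar) (est mstar (fst x)) (fst x) (snd x) < QBIC1 T X (q m) (S m) (est m (fst x)) (fst x) (snd x) \<and>
      QBIC2 T X (q mstar) (S mstar) (est mstar (fst x)) (fst x) (snd x) < QBIC2 T X (q m) (S m) (est m (fst x)) (fst x) (snd x)"
    using B B' G large eventually_whp_ge[of 2]
  proof eventually_elim
    case (elim x)
    obtain n \<omega> where x: "x = (n, \<omega>)" by (cases x)
    have n: "2 \<le> n" "1 \<le> n" and \<omega>: "\<omega> \<in> space P" using elim(5) by (auto simp: x)
    have ln: "0 < ln (real n)" using n by simp
    let ?H = "quasi_loglik T X (S m) n \<omega> (est m n \<omega>)"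
      and ?H' = "quasi_loglik T X (S mstar) n \<omega> (est mstar n \<omega>)"
    \<comment> \<open>Both true parameters yield the same covariance, and maximizing in Model
      \<open>mstar\<close> only raises the likelihood from there; what remains is the gain of Model
      \<open>m\<close>.\<close>
    have "quasi_loglik T X (S m) n \<omega> (\<theta>0 m) = quasi_loglik T X (S mstar) n \<omega> (\<theta>0 mstar)"
      using true_param(2)[OF m'] true_param(2)[OF mstar] by (intro quasi_loglik_cong) simp
    also have "\<dots> \<le> ?H'"
      by (rule M'.qmle_maximizes(2)[OF horizon n(2) e'[OF n(2)] \<omega> M'.\<theta>0_in(1)])
    finally have "?H - ?H' \<le> ?G (n, \<omega>)" by simp
    also have "\<dots> \<le> ln (real n) / 8" using elim(3) ln by (simp add: x field_simps)
    finally have gain: "?H - ?H' \<le> ln (real n) / 8" .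
    have "real (q mstar) + 1 \<le> real (q m)" using less by simp
    then have dim: "real (q mstar) * ln (real n) + ln (real n) \<le> real (q m) * ln (real n)"
      using ln by (metis distrib_right less_imp_le mult_1 mult_right_mono)
    \<comment> \<open>The factor \<open>n\<close> leaves the determinant of a \<open>p\<close> by
      \<open>p\<close> matrix as \<open>n ^ p\<close>, so the first criterion is the second plus a
      log-determinant already bounded.\<close>
    have lnD: "ln (real n ^ p * d) = real p * ln (real n) + ln d" if "0 < d" for p d
      using that n by (simp add: ln_mult ln_realpow)
    have Q1: "QBIC1 T X (q m) (S m) (est m n) n \<omega> = - 2 * ?H + (real (q m) * ln (real n) + ln (?D x))"
      using elim(1) by (simp add: QBIC1_def dim_obs lnD x)
    have Q1': "QBIC1 T X (q mstar) (S mstar) (est mstar n) n \<omega> = - 2 * ?H' + (real (q mstar) * ln (real n) + ln (?D' x))"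
      using elim(2) by (simp add: QBIC1_def dim_obs lnD x)
    have "QBIC1 T X (q mstar) (S mstar) (est mstar n) n \<omega> < QBIC1 T X (q m) (S m) (est m n) n \<omega>"
      unfolding Q1 Q1' using elim(1,2,4) gain dim ln by (simp add: x abs_le_iff)
    moreover have "QBIC2 T X (q mstar) (S mstar) (est mstar n) n \<omega> < QBIC2 T X (q m) (S m) (est m n) n \<omega>"
      unfolding QBIC2_def using gain dim ln by linarith
    ultimately show ?case by (simp add: x)
  qed
  then have ev: "\<forall>\<^sub>F x in whp P. case x of (n, \<omega>) \<Rightarrow>
      QBIC1 T X (q mstar) (S mstar) (est mstar n) n \<omega> < QBIC1 T X (q m) (S m) (est m n) n \<omega>"
    "\<forall>\<^sub>F x in whp P. case x of (n, \<omega>) \<Rightarrow>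
      QBIC2 T X (q mstar) (S mstar) (est mstar n) n \<omega> < QBIC2 T X (q m) (S m) (est m n) n \<omega>"
    by (auto elim!: eventually_mono)
  \<comment> \<open>At \<open>n = 0\<close> the step \<open>T / n\<close> degenerates, so
    measurability is claimed from \<open>n = 1\<close> on, which is enough for the limit.\<close>
  have meas: "{\<omega> \<in> space P. QBIC1 T X (q mstar) (S mstar) (est mstar n) n \<omega> < QBIC1 T X (q m) (S m) (est m n) n \<omega>} \<in> events"
    "{\<omega> \<in> space P. QBIC2 T X (q mstar) (S mstar) (est mstar n) n \<omega> < QBIC2 T X (q m) (S m) (est m n) n \<omega>} \<in> events"
    if n: "1 \<le> n" for n
    using M.QBIC_measurable[OF horizon n e[OF n] Qm[OF n]] M'.QBIC_measurable[OF horizon n e'[OF n] Qm[OF n]]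
    by (auto intro!: borel_measurable_less)
  show ?thesis
  proof
    show "(\<lambda>n. measure P {\<omega> \<in> space P.
        QBIC1 T X (q mstar) (S mstar) (est mstar n) n \<omega> < QBIC1 T X (q m) (S m) (est m n) n \<omega>}) \<longlonglongrightarrow> 1"
      using eventually_whpD[OF ev(1)] meas(1) unfolding eventually_sequentially by auto
    show "(\<lambda>n. measure P {\<omega> \<in> space P.
        QBIC2 T X (q mstar) (S mstar) (est mstar n) n \<omega> < QBIC2 T X (q m) (S m) (est m n) n \<omega>}) \<longlonglongrightarrow> 1"
      using eventually_whpD[OF ev(2)] meas(2) unfolding eventually_sequentially by auto
  qed
qed

end
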